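(* Let $X$ be an affine scheme of finite type over $k$ and $\mathfrak{v}\subseteq \operatorname{Vect}(X)$ a Lie subalgebra. Suppose that for every integer $i\ge 0$, the locus of points $x\in X$ at which the evaluation $\mathfrak{v}|_x\subseteq T_xX_{\mathrm{red}}$ has dimension $\le i$ has dimension at most $i$. Then the coinvariant space $(\mathcal{O}_X)_{\mathfrak{v}}=\mathcal{O}_X/\mathfrak{v}(\mathcal{O}_X)$ is finite-dimensional.
   Context: $k$ is an algebraically closed field of characteristic zero; points of $X$ are closed points. $\operatorname{Vect}(X)$ is the Lie algebra of $k$-linear derivations of $\mathcal{O}_X$ (vector fields). Every vector field is tangent to $X_{\mathrm{red}}$, so for $x\in X$ the evaluation $\mathfrak{v}|_x=\{\xi|_x:\xi\in\mathfrak{v}\}$ is a subspace of $T_xX_{\mathrm{red}}$. $\mathfrak{v}(\mathcal{O}_X)$ denotes the $k$-span of all $\xi(f)$, $\xi\in\mathfrak{v}$, $f\in\mathcal{O}_X$. *)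

theory Defs
  imports "HOL-Computational_Algebra.Polynomial" "HOL-Library.Function_Algebras"
begin

text \<open>A commutative k-algebra A is a type 'a :: comm_ring_1 together with the
structure map phi : k -> A (a unital ring homomorphism); scalar multiplication
is c . a = phi c * a.\<close>

definition kalg_struct :: "('k::field \<Rightarrow> 'a::comm_ring_1) \<Rightarrow> bool" where
  "kalg_struct \<phi> \<longleftrightarrow> (\<forall>a b. \<phi> (a + b) = \<phi> a + \<phi> b) \<and> (\<forall>a b. \<phi> (a * b) = \<phi> a * \<phi> b) \<and> \<phi> 1 = 1"

inductive_set gen_alg :: "('k::field \<Rightarrow> 'a::comm_ring_1) \<Rightarrow> 'a set \<Rightarrow> 'a set"
  for \<phi> G where
  gen: "g \<in> G \<Longrightarrow> g \<in> gen_alg \<phi> G"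
| scal: "\<phi> c \<in> gen_alg \<phi> G"
| add: "a \<in> gen_alg \<phi> G \<Longrightarrow> b \<in> gen_alg \<phi> G \<Longrightarrow> a + b \<in> gen_alg \<phi> G"
| mult: "a \<in> gen_alg \<phi> G \<Longrightarrow> b \<in> gen_alg \<phi> G \<Longrightarrow> a * b \<in> gen_alg \<phi> G"

text \<open>Finitely generated k-algebra = coordinate ring of an affine scheme of finite type.\<close>
definition fin_gen_kalg :: "('k::field \<Rightarrow> 'a::comm_ring_1) \<Rightarrow> bool" where
  "fin_gen_kalg \<phi> \<longleftrightarrow> kalg_struct \<phi> \<and> (\<exists>G. finite G \<and> gen_alg \<phi> G = UNIV)"

definition vector_field :: "('k::field \<Rightarrow> 'a::comm_ring_1) \<Rightarrow> ('a \<Rightarrow> 'a) \<Rightarrow> bool" where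
  "vector_field \<phi> D \<longleftrightarrow> (\<forall>f g. D (f + g) = D f + D g) \<and> (\<forall>c f. D (\<phi> c * f) = \<phi> c * D f)
      \<and> (\<forall>f g. D (f * g) = f * D g + g * D f)"

definition Vect :: "('k::field \<Rightarrow> 'a::comm_ring_1) \<Rightarrow> ('a \<Rightarrow> 'a) set" where
  "Vect \<phi> = {D. vector_field \<phi> D}"

definition lie_subalgebra :: "('k::field \<Rightarrow> 'a::comm_ring_1) \<Rightarrow> ('a \<Rightarrow> 'a) set \<Rightarrow> bool" where
  "lie_subalgebra \<phi> V \<longleftrightarrow> V \<subseteq> Vect \<phi> \<and> (\<lambda>_. 0) \<in> V
     \<and> (\<forall>D\<in>V. \<forall>E\<in>V. (\<lambda>f. D f + E f) \<in> V)
     \<and> (\<forall>c. \<forall>D\<in>V. (\<lambda>f. \<phi> c * D f) \<in> V)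
     \<and> (\<forall>D\<in>V. \<forall>E\<in>V. (\<lambda>f. D (E f) - E (D f)) \<in> V)"

text \<open>(Closed) points of X = Spec A: k-algebra homomorphisms A -> k
 (k algebraically closed, A finitely generated).\<close>
definition points :: "('k::field \<Rightarrow> 'a::comm_ring_1) \<Rightarrow> ('a \<Rightarrow> 'k) set" where
  "points \<phi> = {x. (\<forall>f g. x (f + g) = x f + x g) \<and> (\<forall>f g. x (f * g) = x f * x g) \<and> (\<forall>c. x (\<phi> c) = c)}"

definition eval_at :: "('a \<Rightarrow> 'a) set \<Rightarrow> ('a \<Rightarrow> 'k) \<Rightarrow> ('a \<Rightarrow> 'k) set" where
  "eval_at V x = {(\<lambda>f. x (D f)) | D. D \<in> V}"

definition tvdim :: "('a \<Rightarrow> 'k::field) set \<Rightarrow> nat" where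
  "tvdim W = vector_space.dim (\<lambda>c (t::'a \<Rightarrow> 'k) a. c * t a) W"

definition zeroset :: "('k::field \<Rightarrow> 'a::comm_ring_1) \<Rightarrow> 'a set \<Rightarrow> ('a \<Rightarrow> 'k) set" where
  "zeroset \<phi> T = {x \<in> points \<phi>. \<forall>f\<in>T. x f = 0}"

definition closed_in_sub :: "('k::field \<Rightarrow> 'a::comm_ring_1) \<Rightarrow> ('a \<Rightarrow> 'k) set \<Rightarrow> ('a \<Rightarrow> 'k) set \<Rightarrow> bool" where
  "closed_in_sub \<phi> S C \<longleftrightarrow> (\<exists>T. C = S \<inter> zeroset \<phi> T)"

definition zar_irreducible :: "('k::field \<Rightarrow> 'a::comm_ring_1) \<Rightarrow> ('a \<Rightarrow> 'k) set \<Rightarrow> bool" where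
  "zar_irreducible \<phi> Z \<longleftrightarrow> Z \<noteq> {} \<and> Z \<subseteq> points \<phi> \<and>
     (\<forall>T1 T2. Z \<subseteq> zeroset \<phi> T1 \<union> zeroset \<phi> T2 \<longrightarrow> Z \<subseteq> zeroset \<phi> T1 \<or> Z \<subseteq> zeroset \<phi> T2)"

definition zar_dim_le :: "('k::field \<Rightarrow> 'a::comm_ring_1) \<Rightarrow> ('a \<Rightarrow> 'k) set \<Rightarrow> nat \<Rightarrow> bool" where
  "zar_dim_le \<phi> S n \<longleftrightarrow> (\<forall>Z m. (\<forall>j\<le>m. closed_in_sub \<phi> S (Z j) \<and> zar_irreducible \<phi> (Z j))
       \<and> (\<forall>j<m. Z j \<subset> Z (Suc j)) \<longrightarrow> m \<le> n)"

definition vO :: "('k::field \<Rightarrow> 'a::comm_ring_1) \<Rightarrow> ('a \<Rightarrow> 'a) set \<Rightarrow> 'a set" where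
  "vO \<phi> V = module.span (\<lambda>c a. \<phi> c * a) {D f | D f. D \<in> V}"

definition fin_dim_quotient :: "('k::field \<Rightarrow> 'a::comm_ring_1) \<Rightarrow> 'a set \<Rightarrow> bool" where
  "fin_dim_quotient \<phi> W \<longleftrightarrow> (\<exists>F. finite F \<and> module.span (\<lambda>c a. \<phi> c * a) (F \<union> W) = UNIV)"

end

theory Submission
  imports Defs "HOL-Library.Poly_Mapping" "HOL-Library.FuncSet"
begin

text \<open>
The proof is an elementary version of the fact that the D-module governing the coinvariants is
holonomic.  Choose generators \<open>x\<^sub>1, \<dots>, x\<^sub>n\<close> of the algebra \<open>A\<close> and let
\<open>A[\<xi>\<^sub>1, \<dots>, \<xi>\<^sub>n]\<close> be the functions on \<open>X \<times> k\<^sup>n\<close>.  By the rank condition the common zero set of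
the symbols \<open>\<Sum> D(x\<^sub>i) \<xi>\<^sub>i\<close>, \<open>D \<in> V\<close>, has dimension at most \<open>n\<close>: over a stratum of dimension \<open>d\<close>
the rank is at least \<open>d\<close>, so the fibres have dimension at most \<open>n - d\<close>.  Hence any \<open>n + 1\<close> of the
\<open>2n\<close> coordinates satisfy a polynomial relation lying in the ideal of the symbols.

An element \<open>l\<close> of the dual of the coinvariants turns \<open>A[\<xi>]\<close> into formal power series in
\<open>y\<^sub>1, \<dots>, y\<^sub>n\<close>, where \<open>a \<in> A\<close> is sent to \<open>l(a exp(x \<bullet> y))\<close> and \<open>\<xi>\<^sub>i\<close> acts as multiplication by
\<open>y\<^sub>i\<close>.  Invariance of \<open>l\<close> says that a multiple of a symbol is sent to the same series as an
element of lower order in \<open>\<xi>\<close>, so by the relations above the images of the elements of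
filtration degree at most \<open>W\<close> span a space of dimension at most \<open>C W\<^sup>n\<close>, with \<open>C\<close> independent of
the functionals.  On the other hand, \<open>r\<close> independent functionals \<open>l\<^sub>i\<close> with a dual family
\<open>g\<^sub>j \<in> A\<close> make the elements \<open>g\<^sub>j \<xi>\<^sup>\<beta>\<close> linearly independent, which gives \<open>r\<close> times the number of
monomials.  Comparing the two estimates gives a bound for \<open>r\<close>.
\<close>

section \<open>Polynomials and their evaluation\<close>

text \<open>Three obstacles shape the proof. The hypothesis speaks of chains of irreducible closed
  sets, whereas the argument counts monomials. The bridge: \<open>d\<close> coordinates that are
  algebraically independent modulo a prime give a chain of \<open>d + 1\<close> primes starting at
  it, and the Nullstellensatz turns this into a chain of closed sets. Transcendence degree occurs
  only as a bound on the size of independent sets of generators, and is used through the growth it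
  forces. Secondly, \<open>A\<close> may have nilpotents, so a relation valid on the zero set of the
  symbols is not enough; it has to lie in the ideal itself. The values of nonzero polynomials in
  fixed coordinates form a multiplicative set. If the ideal missed it, so would some prime above the
  ideal, and only such a prime has to be refuted. Thirdly, the constant must not depend on the
  functionals. The relations are therefore chosen first, and the functionals enter only as one
  subspace \<open>K\<close> modulo which monomials are counted. Both counts then have the same
  exponent \<open>n\<close>, so that their constants can be compared.\<close>

type_synonym mon = "nat \<Rightarrow>\<^sub>0 nat"
type_synonym 'c mp = "(nat \<Rightarrow>\<^sub>0 nat) \<Rightarrow>\<^sub>0 'c"

abbreviation single :: "'i \<Rightarrow> 'c \<Rightarrow> ('i \<Rightarrow>\<^sub>0 'c::zero)" where
  "single \<equiv> Poly_Mapping.single"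

abbreviation var_mon :: "nat \<Rightarrow> mon" where
  "var_mon i \<equiv> single i (Suc 0)"

abbreviation keys :: "('i \<Rightarrow>\<^sub>0 'c::zero) \<Rightarrow> 'i set" where
  "keys \<equiv> Poly_Mapping.keys"

abbreviation lookup :: "('i \<Rightarrow>\<^sub>0 'c::zero) \<Rightarrow> 'i \<Rightarrow> 'c" where
  "lookup \<equiv> Poly_Mapping.lookup"

text \<open>Only additivity in the coefficient is built in, because coefficients lie in
  \<open>k\<close> or in \<open>A\<close>. Evaluation, homogeneous parts and the pairing with
  functionals are all instances.\<close>

definition extend_linear :: "(mon \<Rightarrow> 'c::comm_monoid_add \<Rightarrow> 'b::comm_monoid_add) \<Rightarrow> 'c mp \<Rightarrow> 'b" where
  "extend_linear g p = (\<Sum>m\<in>keys p. g m (lookup p m))"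

lemma extend_linear_0 [simp]: "extend_linear g 0 = 0"
  by (simp add: extend_linear_def)

lemma extend_linear_add:
  assumes "\<And>m. g m 0 = 0" "\<And>m a b. g m (a + b) = g m a + g m b"
  shows "extend_linear g (p + q) = extend_linear g p + extend_linear g q"
  unfolding extend_linear_def
  by (rule setsum_keys_plus_distrib) (use assms in auto)

lemma extend_linear_single:
  assumes "\<And>m. g m 0 = 0"
  shows "extend_linear g (single m c) = g m c"
  using assms by (cases "c = 0") (auto simp: extend_linear_def)

lemma mp_sum_singles: "p = (\<Sum>m\<in>keys p. single m (lookup p m))"
proof (rule poly_mapping_eqI)
  fix k
  have "(\<Sum>m\<in>keys p. lookup (single m (lookup p m)) k)
      = (\<Sum>m\<in>keys p. if m = k then lookup p m else 0)"
    by (intro sum.cong) (auto simp: lookup_single when_def)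
  also have "\<dots> = lookup p k"
    by (auto simp: in_keys_iff)
  finally show "lookup p k = lookup (\<Sum>m\<in>keys p. single m (lookup p m)) k"
    by (simp add: lookup_sum)
qed

lemma mp_induct [case_names zero single add]:
  fixes p :: "'c::comm_monoid_add mp"
  assumes "P 0" "\<And>m c. P (single m c)" "\<And>p q. P p \<Longrightarrow> P q \<Longrightarrow> P (p + q)"
  shows "P p"
proof -
  have "P (\<Sum>m\<in>M. single m (lookup p m))" if "finite M" for M
    using that by induction (use assms in auto)
  from this[of "keys p"] show ?thesis
    by (simp flip: mp_sum_singles)
qed

lemma keys_add_mon: "keys (m + m' :: mon) = keys m \<union> keys m'"
  by (auto simp: in_keys_iff lookup_add)

lemma lookup_eq_0: "keys m \<subseteq> S \<Longrightarrow> i \<notin> S \<Longrightarrow> lookup m i = 0"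
  by (auto simp: in_keys_iff)

lemma var_mon_neq_0 [simp]: "var_mon i \<noteq> 0" "0 \<noteq> var_mon i"
  by (metis lookup_single_eq lookup_zero nat.distinct(1))+

definition mon_eval :: "(nat \<Rightarrow> 'r::comm_ring_1) \<Rightarrow> mon \<Rightarrow> 'r" where
  "mon_eval z m = (\<Prod>i\<in>keys m. z i ^ lookup m i)"

lemma mon_eval_superset:
  assumes "finite F" "keys m \<subseteq> F"
  shows "mon_eval z m = (\<Prod>i\<in>F. z i ^ lookup m i)"
  unfolding mon_eval_def
  by (rule prod.mono_neutral_left) (use assms in \<open>auto simp: in_keys_iff\<close>)

lemma mon_eval_0 [simp]: "mon_eval z 0 = 1"
  by (simp add: mon_eval_def)

lemma mon_eval_add: "mon_eval z (m + m') = mon_eval z m * mon_eval z m'"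
proof -
  let ?F = "keys m \<union> keys m'"
  have "mon_eval z (m + m') = (\<Prod>i\<in>?F. z i ^ lookup (m + m') i)"
    by (rule mon_eval_superset) (auto simp: keys_add_mon)
  also have "\<dots> = (\<Prod>i\<in>?F. z i ^ lookup m i) * (\<Prod>i\<in>?F. z i ^ lookup m' i)"
    by (simp add: lookup_add power_add prod.distrib)
  also have "\<dots> = mon_eval z m * mon_eval z m'"
    by (simp add: mon_eval_superset[symmetric])
  finally show ?thesis .
qed

lemma mon_eval_single [simp]: "mon_eval z (single i e) = z i ^ e"
  by (cases "e = 0") (auto simp: mon_eval_def)

text \<open>The weights are a parameter: total degree, the degree in one group of coordinates, and a
  mixture that makes some coordinates heavy are all needed.\<close>

definition weight :: "(nat \<Rightarrow> nat) \<Rightarrow> mon \<Rightarrow> nat" where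
  "weight \<omega> m = (\<Sum>i\<in>keys m. \<omega> i * lookup m i)"

lemma weight_superset:
  assumes "finite F" "keys m \<subseteq> F"
  shows "weight \<omega> m = (\<Sum>i\<in>F. \<omega> i * lookup m i)"
  unfolding weight_def
  by (rule sum.mono_neutral_left) (use assms in \<open>auto simp: in_keys_iff\<close>)

lemma weight_0 [simp]: "weight \<omega> 0 = 0"
  by (simp add: weight_def)

lemma weight_add: "weight \<omega> (m + m') = weight \<omega> m + weight \<omega> m'"
proof -
  let ?F = "keys m \<union> keys m'"
  have "weight \<omega> (m + m') = (\<Sum>i\<in>?F. \<omega> i * lookup (m + m') i)"
    by (rule weight_superset) (auto simp: keys_add_mon)
  also have "\<dots> = weight \<omega> m + weight \<omega> m'"
    by (simp add: lookup_add distrib_left sum.distrib weight_superset[symmetric])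
  finally show ?thesis .
qed

lemma weight_single [simp]: "weight \<omega> (single i e) = \<omega> i * e"
  by (cases "e = 0") (auto simp: weight_def)

lemma lookup_le_weight:
  assumes "\<And>i. i \<in> keys m \<Longrightarrow> 1 \<le> \<omega> i"
  shows "lookup m i \<le> weight \<omega> m"
proof (cases "i \<in> keys m")
  case True
  have "lookup m i \<le> \<omega> i * lookup m i"
    using assms[OF True] by (cases "\<omega> i") auto
  also have "\<dots> \<le> weight \<omega> m"
    unfolding weight_def by (rule member_le_sum[OF True]) auto
  finally show ?thesis .
qed (simp add: in_keys_iff)

lemma weight_le_card:
  assumes "finite F" "keys m \<subseteq> F" "\<And>i. i \<in> F \<Longrightarrow> lookup m i \<le> b" "\<And>i. i \<in> F \<Longrightarrow> \<omega> i \<le> a"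
  shows "weight \<omega> m \<le> card F * (a * b)"
  unfolding weight_superset[OF assms(1,2)]
  using sum_bounded_above[of F "\<lambda>i. \<omega> i * lookup m i" "a * b"] assms(3,4)
  by (simp add: mult_le_mono)

lemma mon_split_var:
  fixes m :: mon
  assumes "i \<in> keys m"
  obtains m' where "m = m' + var_mon i" "keys m' \<subseteq> keys m" "lookup m i = Suc (lookup m' i)"
proof
  have *: "0 < lookup m i"
    using assms by (auto simp: in_keys_iff)
  let ?m = "m - var_mon i"
  show "m = ?m + var_mon i"
    using * by (intro poly_mapping_eqI) (auto simp: lookup_add lookup_minus lookup_single when_def)
  show "keys ?m \<subseteq> keys m"
    by (auto simp: in_keys_iff lookup_minus)
  show "lookup m i = Suc (lookup ?m i)"
    using * by (auto simp: lookup_minus)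
qed

lemma mon_induct [case_names zero var]:
  fixes m :: mon
  assumes "P 0" "\<And>m i. P m \<Longrightarrow> P (m + var_mon i)"
  shows "P m"
proof (induction "weight (\<lambda>_. 1) m" arbitrary: m rule: less_induct)
  case less
  show ?case
  proof (cases "m = 0")
    case False
    then obtain i where "i \<in> keys m"
      by (metis all_not_in_conv keys_eq_empty)
    then obtain m' where "m = m' + var_mon i"
      by (rule mon_split_var)
    then show ?thesis
      using assms(2)[OF less[of m']] by (simp add: weight_add)
  qed (use assms in simp)
qed

definition supp_in :: "nat set \<Rightarrow> 'c::zero mp \<Rightarrow> bool" where
  "supp_in S p \<longleftrightarrow> (\<forall>m\<in>keys p. keys m \<subseteq> S)"

lemma supp_in_0 [simp]: "supp_in S 0"
  by (simp add: supp_in_def)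

lemma supp_in_single [intro]: "keys m \<subseteq> S \<Longrightarrow> supp_in S (single m c)"
  by (auto simp: supp_in_def split: if_splits)

lemma supp_in_add [intro]: "supp_in S p \<Longrightarrow> supp_in S q \<Longrightarrow> supp_in S (p + q)"
  using keys_add[of p q] by (auto simp: supp_in_def)

lemma supp_in_mult [intro]:
  fixes p q :: "'c::semiring_0 mp"
  assumes "supp_in S p" "supp_in S q"
  shows "supp_in S (p * q)"
  unfolding supp_in_def
proof
  fix m assume "m \<in> keys (p * q)"
  then obtain a b where "m = a + b" "a \<in> keys p" "b \<in> keys q"
    using keys_mult[of p q] by auto
  with assms show "keys m \<subseteq> S"
    by (auto simp: supp_in_def keys_add_mon)
qed

lemma supp_in_uminus [intro]: "supp_in S (p::'c::ab_group_add mp) \<Longrightarrow> supp_in S (- p)"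
  by (auto simp: supp_in_def in_keys_iff)

lemma supp_in_diff [intro]:
  "supp_in S (p::'c::ab_group_add mp) \<Longrightarrow> supp_in S q \<Longrightarrow> supp_in S (p - q)"
  using supp_in_add[of S p "- q"] by (auto simp: supp_in_uminus)

lemma supp_in_1 [simp]: "supp_in S (1::'c::zero_neq_one mp)"
  by (auto simp: supp_in_def)

lemma supp_in_power [intro]: "supp_in S (p::'c::comm_ring_1 mp) \<Longrightarrow> supp_in S (p ^ e)"
  by (induction e) auto

lemma supp_in_sum [intro]:
  "(\<And>i. i \<in> I \<Longrightarrow> supp_in S (f i)) \<Longrightarrow> supp_in S (\<Sum>i\<in>I. f i)"
  by (induction I rule: infinite_finite_induct) auto

lemma supp_in_mono: "supp_in S p \<Longrightarrow> S \<subseteq> T \<Longrightarrow> supp_in T p"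
  by (auto simp: supp_in_def)

lemma supp_in_induct [consumes 1, case_names zero single add]:
  fixes p :: "'c::comm_monoid_add mp"
  assumes "supp_in S p" "P 0" "\<And>m c. keys m \<subseteq> S \<Longrightarrow> P (single m c)"
    "\<And>p q. P p \<Longrightarrow> P q \<Longrightarrow> P (p + q)"
  shows "P p"
proof -
  have "P (\<Sum>m\<in>M. single m (lookup p m))" if "finite M" "M \<subseteq> keys p" for M
    using that by induction (use assms in \<open>auto simp: supp_in_def\<close>)
  from this[of "keys p"] show ?thesis
    by (simp flip: mp_sum_singles)
qed

definition poly_eval :: "('k::field \<Rightarrow> 'r::comm_ring_1) \<Rightarrow> (nat \<Rightarrow> 'r) \<Rightarrow> 'k mp \<Rightarrow> 'r" where
  "poly_eval \<phi> z = extend_linear (\<lambda>m c. \<phi> c * mon_eval z m)"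

text \<open>Besides \<open>A\<close> itself, the instances are the polynomials over
  \<open>k\<close>, where evaluation is substitution, and \<open>A[\<xi>]\<close>.\<close>

locale kalgebra =
  fixes \<phi> :: "'k::field \<Rightarrow> 'r::comm_ring_1"
  assumes kalg: "kalg_struct \<phi>"
begin

lemma phi_add: "\<phi> (a + b) = \<phi> a + \<phi> b"
  and phi_mult: "\<phi> (a * b) = \<phi> a * \<phi> b"
  and phi_1 [simp]: "\<phi> 1 = 1"
  using kalg by (auto simp: kalg_struct_def)

lemma phi_0 [simp]: "\<phi> 0 = 0"
  using phi_add[of 0 0] by simp

lemma phi_uminus: "\<phi> (- a) = - \<phi> a"
  using phi_add[of a "- a"] by (simp add: eq_neg_iff_add_eq_0 add.commute)

lemma phi_diff: "\<phi> (a - b) = \<phi> a - \<phi> b"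
  using phi_add[of a "- b"] by (simp add: phi_uminus)

lemma phi_inverse: "c \<noteq> 0 \<Longrightarrow> \<phi> (inverse c) * \<phi> c = 1"
  by (simp flip: phi_mult)

sublocale vs: vector_space "\<lambda>c a. \<phi> c * a"
  by unfold_locales (auto simp: phi_add phi_mult algebra_simps)

declare vs.scale_scale [simp del]

lemma poly_eval_0 [simp]: "poly_eval \<phi> z 0 = 0"
  by (simp add: poly_eval_def)

lemma poly_eval_add: "poly_eval \<phi> z (p + q) = poly_eval \<phi> z p + poly_eval \<phi> z q"
  unfolding poly_eval_def
  by (rule extend_linear_add) (auto simp: phi_add algebra_simps)

lemma poly_eval_single: "poly_eval \<phi> z (single m c) = \<phi> c * mon_eval z m"
  unfolding poly_eval_def by (rule extend_linear_single) auto

lemma poly_eval_const [simp]: "poly_eval \<phi> z (single 0 c) = \<phi> c"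
  by (simp add: poly_eval_single)

lemma poly_eval_var [simp]: "poly_eval \<phi> z (single (var_mon i) 1) = z i"
  using poly_eval_single[of z "var_mon i" 1] by simp

lemma poly_eval_1 [simp]: "poly_eval \<phi> z 1 = 1"
  using poly_eval_const[of z 1] by simp

lemma poly_eval_uminus: "poly_eval \<phi> z (- p) = - poly_eval \<phi> z p"
  using poly_eval_add[of z p "- p"] by (simp add: eq_neg_iff_add_eq_0 add.commute)

lemma poly_eval_diff: "poly_eval \<phi> z (p - q) = poly_eval \<phi> z p - poly_eval \<phi> z q"
  using poly_eval_add[of z p "- q"] by (simp add: poly_eval_uminus)

lemma poly_eval_mult: "poly_eval \<phi> z (p * q) = poly_eval \<phi> z p * poly_eval \<phi> z q"
proof (induction p rule: mp_induct)
  case zero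
  show ?case by (simp only: mult_zero_left poly_eval_0)
next
  case (single m c)
  show ?case
  proof (induction q rule: mp_induct)
    case zero
    show ?case by (simp only: mult_zero_right poly_eval_0)
  next
    case (single m' c')
    show ?case
      unfolding mult_single poly_eval_single phi_mult mon_eval_add by (simp only: ac_simps)
  next
    case (add p q)
    then show ?case
      by (simp only: poly_eval_add distrib_left)
  qed
next
  case (add p p')
  then show ?case
    by (simp only: poly_eval_add distrib_right)
qed

lemma poly_eval_power: "poly_eval \<phi> z (p ^ e) = poly_eval \<phi> z p ^ e"
  by (induction e) (auto simp: poly_eval_mult)

lemma poly_eval_sum: "poly_eval \<phi> z (\<Sum>i\<in>I. f i) = (\<Sum>i\<in>I. poly_eval \<phi> z (f i))"
  by (induction I rule: infinite_finite_induct) (auto simp: poly_eval_add)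

lemma poly_eval_in_span:
  assumes "\<And>m. m \<in> keys p \<Longrightarrow> mon_eval z m \<in> vs.span B"
  shows "poly_eval \<phi> z p \<in> vs.span B"
  unfolding poly_eval_def extend_linear_def
  by (intro vs.span_sum vs.span_scale assms)

end

section \<open>Growth of monomials modulo a subspace\<close>

text \<open>The exchange inequality in the quotient by \<open>K\<close>, phrased for an indexed
  family so that no quotient space has to be formed. Induction on \<open>X\<close>: a member of the
  family that involves \<open>x\<close> is used to clear \<open>x\<close> from the others.\<close>

lemma (in vector_space) card_le_of_independent_mod:
  assumes "finite X" "finite T" "subspace K"
    and "\<And>t. t \<in> T \<Longrightarrow> f t \<in> span (X \<union> K)"
    and "\<And>c. (\<Sum>t\<in>T. scale (c t) (f t)) \<in> K \<Longrightarrow> \<forall>t\<in>T. c t = 0"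
  shows "card T \<le> card X"
  using assms
proof (induction X arbitrary: T f rule: finite_induct)
  case empty
  have "T = {}"
  proof (rule ccontr)
    assume "T \<noteq> {}"
    then obtain t where t: "t \<in> T" by auto
    have "(\<Sum>s\<in>T. scale (if s = t then 1 else 0) (f s)) = (\<Sum>s\<in>T. if s = t then f s else 0)"
      by (intro sum.cong) auto
    also have "\<dots> = f t"
      using t empty.prems(1) by simp
    also have "f t \<in> K"
      using empty.prems(2,3) t by (metis Un_empty_left span_eq_iff)
    finally show False
      using empty.prems(4)[of "\<lambda>s. if s = t then 1 else 0"] t by auto
  qed
  then show ?case by simp
next
  case (insert x X)
  show ?case
  proof (cases "\<forall>t\<in>T. f t \<in> span (X \<union> K)")
    case True
    then have "card T \<le> card X"
      using insert.prems by (intro insert.IH) auto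
    then show ?thesis
      using insert.hyps by simp
  next
    case False
    then obtain t0 where t0: "t0 \<in> T" "f t0 \<notin> span (X \<union> K)" by auto
    have "\<exists>a. f t - scale a x \<in> span (X \<union> K)" if "t \<in> T" for t
      using insert.prems(3)[OF that] by (simp add: span_breakdown_eq)
    then obtain a where a: "\<And>t. t \<in> T \<Longrightarrow> f t - scale (a t) x \<in> span (X \<union> K)"
      by metis
    have a0: "a t0 \<noteq> 0"
      using a[OF t0(1)] t0(2) by auto
    define g where "g t = f t - scale (a t / a t0) (f t0)" for t
    have "card (T - {t0}) \<le> card X"
    proof (rule insert.IH)
      show "g t \<in> span (X \<union> K)" if "t \<in> T - {t0}" for t
      proof -
        have "g t = (f t - scale (a t) x) - scale (a t / a t0) (f t0 - scale (a t0) x)"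
          using a0 by (simp add: g_def algebra_simps)
        then show ?thesis
          using span_diff[OF a span_scale[OF a]] t0 that by simp
      qed
      show "\<forall>t\<in>T - {t0}. c t = 0" if c: "(\<Sum>t\<in>T - {t0}. scale (c t) (g t)) \<in> K" for c
      proof -
        define s where "s = (\<Sum>t\<in>T - {t0}. c t * (a t / a t0))"
        \<comment> \<open>The coefficient \<open>- s\<close> at \<open>t0\<close> turns a relation
          among the reduced vectors \<open>g t\<close> into one among the
          \<open>f t\<close>.\<close>
        define c' where "c' t = (if t = t0 then - s else c t)" for t
        have "(\<Sum>t\<in>T. scale (c' t) (f t)) = scale (- s) (f t0) + (\<Sum>t\<in>T - {t0}. scale (c t) (f t))"
          using insert.prems(1) t0(1) by (subst sum.remove[of _ t0]) (auto simp: c'_def intro!: sum.cong)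
        also have "\<dots> = (\<Sum>t\<in>T - {t0}. scale (c t) (g t))"
          by (simp add: g_def s_def scale_right_diff_distrib sum_subtractf scale_sum_left)
        finally have "\<forall>t\<in>T. c' t = 0"
          using c insert.prems(4) by simp
        then show ?thesis
          by (auto simp: c'_def split: if_splits)
      qed
    qed (use insert.prems in auto)
    then show ?thesis
      using insert.hyps insert.prems(1) t0(1) by (simp add: card_Diff_singleton)
  qed
qed

text \<open>A leading monomial in \<open>d + 1\<close> variables with exponents at most
  \<open>e\<close> divides every monomial whose exponents there are all at least \<open>e\<close>.
  These are the monomials for which that conclusion fails.\<close>

definition standard_mons :: "nat \<Rightarrow> nat \<Rightarrow> nat \<Rightarrow> nat \<Rightarrow> mon set" where
  "standard_mons N d e W =
    {m. keys m \<subseteq> {..<N} \<and> (\<forall>i. lookup m i \<le> W) \<and> card {i \<in> {..<N}. e \<le> lookup m i} \<le> d}"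

lemma inj_on_restrict_lookup: "inj_on (\<lambda>m. restrict (lookup m) S) {m::mon. keys m \<subseteq> S}"
proof (rule inj_onI)
  fix m m' :: mon
  assume *: "m \<in> {m. keys m \<subseteq> S}" "m' \<in> {m. keys m \<subseteq> S}"
    "restrict (lookup m) S = restrict (lookup m') S"
  have "lookup m i = lookup m' i" for i
  proof (cases "i \<in> S")
    case True
    then show ?thesis
      using fun_cong[OF *(3), of i] by simp
  next
    case False
    then show ?thesis
      using *(1,2) by (simp add: lookup_eq_0[of _ S])
  qed
  then show "m = m'"
    by (simp add: poly_mapping_eqI)
qed

text \<open>There are at most \<open>2 ^ N\<close> choices for the set \<open>T\<close> of variables
  with large exponent; each of those exponents has \<open>W + 1\<close> values, the others have
  \<open>e\<close>. What matters is that \<open>W + 1\<close> occurs to the power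
  \<open>d\<close>.\<close>

lemma finite_card_standard_mons:
  assumes "1 \<le> e"
  shows "finite (standard_mons N d e W)"
    and "card (standard_mons N d e W) \<le> 2 ^ N * e ^ N * (W + 1) ^ d"
proof -
  let ?F = "\<lambda>T. PiE {..<N} (\<lambda>i. if i \<in> T then {..W} else {..<e})"
  let ?TT = "{T. T \<subseteq> {..<N} \<and> card T \<le> d}"
  let ?r = "\<lambda>m::mon. restrict (lookup m) {..<N}"
  have sub: "?r ` standard_mons N d e W \<subseteq> (\<Union>T\<in>?TT. ?F T)"
  proof
    fix f assume "f \<in> ?r ` standard_mons N d e W"
    then obtain m where m: "m \<in> standard_mons N d e W" "f = ?r m" by auto
    let ?T = "{i \<in> {..<N}. e \<le> lookup m i}"
    have "f \<in> ?F ?T"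
      using m by (auto simp: standard_mons_def)
    moreover have "?T \<in> ?TT"
      using m by (auto simp: standard_mons_def)
    ultimately show "f \<in> (\<Union>T\<in>?TT. ?F T)" by blast
  qed
  have fin: "finite ?TT"
    by (rule finite_subset[of _ "Pow {..<N}"]) auto
  have finU: "finite (\<Union>T\<in>?TT. ?F T)"
    using fin by (intro finite_UN_I finite_PiE) auto
  have inj: "inj_on ?r (standard_mons N d e W)"
    by (rule inj_on_subset[OF inj_on_restrict_lookup]) (auto simp: standard_mons_def)
  show "finite (standard_mons N d e W)"
    using finite_imageD[OF finite_subset[OF sub finU] inj] .
  have cF: "card (?F T) \<le> e ^ N * (W + 1) ^ d" if "T \<in> ?TT" for T
  proof -
    have T: "T \<subseteq> {..<N}" "finite T" "card T \<le> d"
      using that finite_subset by auto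
    have "card (?F T) = (\<Prod>i<N. if i \<in> T then W + 1 else e)"
      by (auto simp: card_PiE intro!: prod.cong)
    also have "\<dots> = (W + 1) ^ card T * e ^ card ({..<N} - T)"
      using T by (simp add: prod.If_cases Int_absorb1 Diff_eq)
    also have "\<dots> \<le> (W + 1) ^ d * e ^ N"
    proof (intro mult_mono power_increasing)
      show "card ({..<N} - T) \<le> N"
        using card_mono[of "{..<N}" "{..<N} - T"] by simp
    qed (use T assms in auto)
    finally show ?thesis by (simp add: mult.commute)
  qed
  have "card (standard_mons N d e W) = card (?r ` standard_mons N d e W)"
    using inj by (simp add: card_image)
  also have "\<dots> \<le> card (\<Union>T\<in>?TT. ?F T)"
    by (rule card_mono[OF finU sub])
  also have "\<dots> \<le> (\<Sum>T\<in>?TT. card (?F T))"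
    by (rule card_UN_le[OF fin])
  also have "\<dots> \<le> card ?TT * (e ^ N * (W + 1) ^ d)"
    using sum_bounded_above[of ?TT "\<lambda>T. card (?F T)", OF cF] by simp
  also have "\<dots> \<le> 2 ^ N * (e ^ N * (W + 1) ^ d)"
  proof (rule mult_right_mono)
    have "card ?TT \<le> card (Pow {..<N})"
      by (rule card_mono) auto
    then show "card ?TT \<le> 2 ^ N"
      by (simp add: card_Pow)
  qed simp
  finally show "card (standard_mons N d e W) \<le> 2 ^ N * e ^ N * (W + 1) ^ d"
    by (simp add: mult.assoc)
qed

lemma mon_diff_add:
  fixes m m' :: mon
  assumes "\<And>i. lookup m' i \<le> lookup m i"
  shows "m = m' + (m - m')" "keys (m - m') \<subseteq> keys m"
  using assms by (auto intro!: poly_mapping_eqI simp: lookup_add lookup_minus in_keys_iff)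

lemma finite_mons_le: "finite {m::mon. keys m \<subseteq> {..<N} \<and> (\<forall>i. lookup m i \<le> W)}"
proof -
  have "card {i \<in> {..<N}. 1 \<le> lookup m i} \<le> card {..<N}" for m :: mon
    by (rule card_mono) auto
  then have "{m::mon. keys m \<subseteq> {..<N} \<and> (\<forall>i. lookup m i \<le> W)} \<subseteq> standard_mons N N 1 W"
    unfolding standard_mons_def by (intro Collect_mono) (simp only: card_lessThan, blast)
  then show ?thesis
    by (rule finite_subset) (simp add: finite_card_standard_mons)
qed

text \<open>Meaningful for nonzero \<open>h\<close> only, since \<open>Max\<close> of the empty set
  is unspecified.\<close>

definition wdeg :: "(nat \<Rightarrow> nat) \<Rightarrow> 'c::zero mp \<Rightarrow> nat" where
  "wdeg \<omega> h = Max (weight \<omega> ` keys h)"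

text \<open>The tie is broken by the linear order on finitely supported maps, which is compatible
  with addition. Comparing weights first ensures that rewriting never raises the weight.\<close>

definition mon_less :: "(nat \<Rightarrow> nat) \<Rightarrow> mon \<Rightarrow> mon \<Rightarrow> bool" where
  "mon_less \<omega> m m' \<longleftrightarrow> weight \<omega> m < weight \<omega> m' \<or> weight \<omega> m = weight \<omega> m' \<and> m < m'"

lemma mon_less_add: "mon_less \<omega> m m' \<Longrightarrow> mon_less \<omega> (m + a) (m' + a)"
  by (auto simp: mon_less_def weight_add intro: add_strict_right_mono)

lemma leading_monomial:
  fixes h :: "'c::zero mp"
  assumes "h \<noteq> 0"
  obtains \<mu> where "\<mu> \<in> keys h" "weight \<omega> \<mu> = wdeg \<omega> h"
    "\<And>m. m \<in> keys h \<Longrightarrow> m \<noteq> \<mu> \<Longrightarrow> mon_less \<omega> m \<mu>"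
proof -
  let ?L = "{m \<in> keys h. weight \<omega> m = wdeg \<omega> h}"
  have ne: "keys h \<noteq> {}"
    using assms by (simp add: keys_eq_empty)
  have "wdeg \<omega> h \<in> weight \<omega> ` keys h"
    unfolding wdeg_def using ne by (intro Max_in) auto
  then have L: "?L \<noteq> {}" "finite ?L" by auto
  have mx: "Max ?L \<in> ?L"
    using L by (intro Max_in) auto
  show ?thesis
  proof (rule that[of "Max ?L"])
    show "mon_less \<omega> m (Max ?L)" if m: "m \<in> keys h" "m \<noteq> Max ?L" for m
    proof -
      have le: "weight \<omega> m \<le> wdeg \<omega> h"
        unfolding wdeg_def using m by (intro Max_ge) auto
      show ?thesis
      proof (cases "weight \<omega> m = wdeg \<omega> h")
        case True
        then have "m \<le> Max ?L"
          using m L by (intro Max_ge) auto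
        with m(2) have "m < Max ?L"
          by (simp add: less_le)
        with True mx show ?thesis
          by (auto simp: mon_less_def)
      qed (use le mx in \<open>auto simp: mon_less_def\<close>)
    qed
  qed (use mx in auto)
qed

context kalgebra
begin

text \<open>Monomials divisible by the leading monomial of a relation are rewritten into smaller ones;
  what remains are monomials with at most \<open>d\<close> large exponents.\<close>

lemma standard_mons_span:
  assumes sub: "vs.subspace K"
    and \<omega>: "\<And>i. i < N \<Longrightarrow> 1 \<le> \<omega> i"
    and h: "\<And>S. S \<subseteq> {..<N} \<Longrightarrow> card S = Suc d \<Longrightarrow> supp_in S (h S)"
    and \<mu>: "\<And>S. S \<subseteq> {..<N} \<Longrightarrow> card S = Suc d \<Longrightarrow> \<mu> S \<in> keys (h S)"
      "\<And>S. S \<subseteq> {..<N} \<Longrightarrow> card S = Suc d \<Longrightarrow> weight \<omega> (\<mu> S) = wdeg \<omega> (h S)"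
      "\<And>S m. S \<subseteq> {..<N} \<Longrightarrow> card S = Suc d \<Longrightarrow> m \<in> keys (h S) \<Longrightarrow> m \<noteq> \<mu> S \<Longrightarrow> mon_less \<omega> m (\<mu> S)"
    and e: "\<And>S i. S \<subseteq> {..<N} \<Longrightarrow> card S = Suc d \<Longrightarrow> lookup (\<mu> S) i \<le> e"
    and rel: "\<And>S \<tau>. S \<subseteq> {..<N} \<Longrightarrow> card S = Suc d \<Longrightarrow> keys \<tau> \<subseteq> {..<N} \<Longrightarrow>
      poly_eval \<phi> z (h S) * mon_eval z \<tau> \<in> vs.span (mon_eval z `
        {\<sigma>. keys \<sigma> \<subseteq> {..<N} \<and> weight \<omega> \<sigma> < wdeg \<omega> (h S) + weight \<omega> \<tau>} \<union> K)"
    and \<tau>: "keys \<tau> \<subseteq> {..<N}" "weight \<omega> \<tau> \<le> W"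
  shows "mon_eval z \<tau> \<in> vs.span (mon_eval z ` standard_mons N d e W \<union> K)"
proof -
  let ?B = "mon_eval z ` standard_mons N d e W \<union> K"
  define F where "F = {\<tau>. keys \<tau> \<subseteq> {..<N} \<and> weight \<omega> \<tau> \<le> W}"
  have F_le: "lookup \<tau> i \<le> W" if "\<tau> \<in> F" for \<tau> i
    using lookup_le_weight[of \<tau> \<omega> i] that \<omega> by (force simp: F_def)
  have finF: "finite F"
    by (rule finite_subset[OF _ finite_mons_le[of N W]]) (use F_le in \<open>auto simp: F_def\<close>)
  \<comment> \<open>The number of smaller monomials of weight at most \<open>W\<close> is the
    induction measure; as \<open>F\<close> is finite, well-foundedness of the monomial order is not
    an issue.\<close>
  define below where "below \<tau> = {\<sigma> \<in> F. mon_less \<omega> \<sigma> \<tau>}" for \<tau>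
  have smaller: "card (below \<sigma>) < card (below \<tau>)" if "\<sigma> \<in> F" "mon_less \<omega> \<sigma> \<tau>" for \<sigma> \<tau>
  proof (rule psubset_card_mono)
    show "finite (below \<tau>)"
      using finF by (simp add: below_def)
    have "\<sigma> \<in> below \<tau>" "\<sigma> \<notin> below \<sigma>"
      using that by (auto simp: below_def mon_less_def)
    moreover have "below \<sigma> \<subseteq> below \<tau>"
      using that by (auto simp: below_def mon_less_def)
    ultimately show "below \<sigma> \<subset> below \<tau>" by blast
  qed
  have "mon_eval z \<tau> \<in> vs.span ?B" if "\<tau> \<in> F" for \<tau>
    using that
  proof (induction "card (below \<tau>)" arbitrary: \<tau> rule: less_induct)
    case less
    have IH: "mon_eval z \<sigma> \<in> vs.span ?B" if "keys \<sigma> \<subseteq> {..<N}" "mon_less \<omega> \<sigma> \<tau>" for \<sigma>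
    proof -
      have "\<sigma> \<in> F"
        using that less.prems by (auto simp: F_def mon_less_def)
      then show ?thesis
        using less.hyps smaller that by blast
    qed
    show ?case
    proof (cases "\<tau> \<in> standard_mons N d e W")
      case True
      then show ?thesis
        by (intro vs.span_base) auto
    next
      case False
      then have "Suc d \<le> card {i \<in> {..<N}. e \<le> lookup \<tau> i}"
        using less.prems F_le by (auto simp: standard_mons_def F_def)
      then obtain S where S: "S \<subseteq> {i \<in> {..<N}. e \<le> lookup \<tau> i}" "card S = Suc d"
        using obtain_subset_with_card_n by metis
      then have S': "S \<subseteq> {..<N}" by auto
      have le: "lookup (\<mu> S) i \<le> lookup \<tau> i" for i
      proof (cases "i \<in> S")
        case True
        then show ?thesis
          using e[OF S' S(2), of i] S(1) by auto
      next
        case False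
        then have "lookup (\<mu> S) i = 0"
          using h[OF S' S(2)] \<mu>(1)[OF S' S(2)] by (auto simp: supp_in_def intro: lookup_eq_0)
        then show ?thesis by simp
      qed
      define \<tau>' where "\<tau>' = \<tau> - \<mu> S"
      have \<tau>': "\<tau> = \<mu> S + \<tau>'" "keys \<tau>' \<subseteq> {..<N}"
        using mon_diff_add[of "\<mu> S" \<tau>, OF le] less.prems by (auto simp: \<tau>'_def F_def)
      let ?h = "h S"
      let ?c = "lookup ?h"
      have c: "?c (\<mu> S) \<noteq> 0"
        using \<mu>(1)[OF S' S(2)] by (simp add: in_keys_iff)
      let ?rest = "\<Sum>m\<in>keys ?h - {\<mu> S}. \<phi> (?c m) * mon_eval z (m + \<tau>')"
      have "poly_eval \<phi> z ?h * mon_eval z \<tau>' = (\<Sum>m\<in>keys ?h. \<phi> (?c m) * mon_eval z (m + \<tau>'))"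
        by (simp add: poly_eval_def extend_linear_def sum_distrib_right mon_eval_add mult.assoc)
      also have "\<dots> = \<phi> (?c (\<mu> S)) * mon_eval z \<tau> + ?rest"
        using \<mu>(1)[OF S' S(2)] \<tau>'(1) by (simp add: sum.remove)
      finally have eq: "\<phi> (?c (\<mu> S)) * mon_eval z \<tau> = poly_eval \<phi> z ?h * mon_eval z \<tau>' - ?rest"
        by simp
      have "?rest \<in> vs.span ?B"
      proof (intro vs.span_sum vs.span_scale IH)
        fix m assume m: "m \<in> keys ?h - {\<mu> S}"
        then show "keys (m + \<tau>') \<subseteq> {..<N}"
          using h[OF S' S(2)] S' \<tau>'(2) by (auto simp: supp_in_def keys_add_mon)
        show "mon_less \<omega> (m + \<tau>') \<tau>"
          unfolding \<tau>'(1) using \<mu>(3)[OF S' S(2)] m by (intro mon_less_add) auto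
      qed
      \<comment> \<open>The relation need not vanish modulo \<open>K\<close>: it may leave monomials
        of strictly smaller weight, which the induction hypothesis covers.\<close>
      moreover have "poly_eval \<phi> z ?h * mon_eval z \<tau>' \<in> vs.span ?B"
      proof (rule subsetD[OF vs.span_minimal rel[OF S' S(2) \<tau>'(2)]])
        have w: "weight \<omega> \<tau> = wdeg \<omega> ?h + weight \<omega> \<tau>'"
          by (subst \<tau>'(1)) (simp add: weight_add \<mu>(2)[OF S' S(2)])
        show "mon_eval z ` {\<sigma>. keys \<sigma> \<subseteq> {..<N} \<and> weight \<omega> \<sigma> < wdeg \<omega> ?h + weight \<omega> \<tau>'} \<union> K
          \<subseteq> vs.span ?B"
          using IH by (auto simp: mon_less_def w[symmetric] intro: vs.span_base)
      qed simp
      ultimately have "\<phi> (?c (\<mu> S)) * mon_eval z \<tau> \<in> vs.span ?B"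
        unfolding eq by (rule vs.span_diff[rotated])
      then have "\<phi> (inverse (?c (\<mu> S))) * (\<phi> (?c (\<mu> S)) * mon_eval z \<tau>) \<in> vs.span ?B"
        by (rule vs.span_scale)
      then show ?thesis
        using phi_inverse[OF c] by (simp add: mult.assoc[symmetric])
    qed
  qed
  then show ?thesis
    using \<tau> by (auto simp: F_def)
qed

text \<open>\<open>C\<close> depends only on the leading monomials of the polynomials
  \<open>h S\<close>, while \<open>K\<close> and \<open>W\<close> are quantified after it. This
  order of quantifiers is what later makes the bound independent of the functionals.\<close>

lemma monomial_growth:
  fixes h :: "nat set \<Rightarrow> 'k mp"
  assumes \<omega>: "\<And>i. i < N \<Longrightarrow> 1 \<le> \<omega> i"
    and h: "\<And>S. S \<subseteq> {..<N} \<Longrightarrow> card S = Suc d \<Longrightarrow> h S \<noteq> 0 \<and> supp_in S (h S)"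
  obtains C where "\<And>K W. vs.subspace K \<Longrightarrow>
    (\<And>S \<tau>. S \<subseteq> {..<N} \<Longrightarrow> card S = Suc d \<Longrightarrow> keys \<tau> \<subseteq> {..<N} \<Longrightarrow>
      poly_eval \<phi> z (h S) * mon_eval z \<tau> \<in> vs.span (mon_eval z `
        {\<sigma>. keys \<sigma> \<subseteq> {..<N} \<and> weight \<omega> \<sigma> < wdeg \<omega> (h S) + weight \<omega> \<tau>} \<union> K)) \<Longrightarrow>
    \<exists>X. finite X \<and> card X \<le> C * (W + 1) ^ d \<and>
      (\<forall>\<tau>. keys \<tau> \<subseteq> {..<N} \<longrightarrow> weight \<omega> \<tau> \<le> W \<longrightarrow> mon_eval z \<tau> \<in> vs.span (X \<union> K))"
proof -
  define good where "good S \<longleftrightarrow> S \<subseteq> {..<N} \<and> card S = Suc d" for S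
  have "\<exists>\<mu>. good S \<longrightarrow> \<mu> \<in> keys (h S) \<and> weight \<omega> \<mu> = wdeg \<omega> (h S) \<and>
      (\<forall>m\<in>keys (h S). m \<noteq> \<mu> \<longrightarrow> mon_less \<omega> m \<mu>)" for S
    using h[of S] leading_monomial[of "h S" \<omega>] unfolding good_def by metis
  then obtain \<mu> where \<mu>: "\<And>S. good S \<Longrightarrow> \<mu> S \<in> keys (h S) \<and> weight \<omega> (\<mu> S) = wdeg \<omega> (h S) \<and>
      (\<forall>m\<in>keys (h S). m \<noteq> \<mu> S \<longrightarrow> mon_less \<omega> m (\<mu> S))"
    by metis
  \<comment> \<open>A crude common bound: the sum of all exponents of all chosen leading monomials.
    \<open>Suc\<close> gives \<open>1 \<le> e\<close>, as the count requires.\<close>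
  define e where "e = Suc (\<Sum>S\<in>Pow {..<N}. \<Sum>i<N. lookup (\<mu> S) i)"
  have e: "lookup (\<mu> S) i \<le> e" if S: "good S" for S i
  proof (cases "i < N")
    case True
    have "lookup (\<mu> S) i \<le> (\<Sum>i<N. lookup (\<mu> S) i)"
      using True by (intro member_le_sum) auto
    also have "\<dots> \<le> (\<Sum>S\<in>Pow {..<N}. \<Sum>i<N. lookup (\<mu> S) i)"
      using S by (intro member_le_sum[of S "Pow {..<N}" "\<lambda>S. \<Sum>i<N. lookup (\<mu> S) i"]) (auto simp: good_def)
    finally show ?thesis by (simp add: e_def)
  next
    case False
    then have "i \<notin> keys (\<mu> S)"
      using h[of S] \<mu>[OF S] S by (auto simp: supp_in_def good_def)
    then show ?thesis by (simp add: in_keys_iff)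
  qed
  show ?thesis
  proof (rule that)
    fix K W
    assume "vs.subspace K" and
      "\<And>S \<tau>. S \<subseteq> {..<N} \<Longrightarrow> card S = Suc d \<Longrightarrow> keys \<tau> \<subseteq> {..<N} \<Longrightarrow>
        poly_eval \<phi> z (h S) * mon_eval z \<tau> \<in> vs.span (mon_eval z `
          {\<sigma>. keys \<sigma> \<subseteq> {..<N} \<and> weight \<omega> \<sigma> < wdeg \<omega> (h S) + weight \<omega> \<tau>} \<union> K)"
    then have "mon_eval z \<tau> \<in> vs.span (mon_eval z ` standard_mons N d e W \<union> K)"
      if "keys \<tau> \<subseteq> {..<N}" "weight \<omega> \<tau> \<le> W" for \<tau>
      using that \<omega> h e \<mu>
      by (intro standard_mons_span[where h = h and \<mu> = \<mu> and \<omega> = \<omega>]) (auto simp: good_def)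
    moreover have "finite (mon_eval z ` standard_mons N d e W)"
      by (simp add: finite_card_standard_mons e_def)
    moreover have "card (mon_eval z ` standard_mons N d e W) \<le> 2 ^ N * e ^ N * (W + 1) ^ d"
    proof -
      have "1 \<le> e" by (simp add: e_def)
      from finite_card_standard_mons[OF this, of N d W] show ?thesis
        using card_image_le le_trans by blast
    qed
    ultimately show "\<exists>X. finite X \<and> card X \<le> 2 ^ N * e ^ N * (W + 1) ^ d \<and>
      (\<forall>\<tau>. keys \<tau> \<subseteq> {..<N} \<longrightarrow> weight \<omega> \<tau> \<le> W \<longrightarrow> mon_eval z \<tau> \<in> vs.span (X \<union> K))"
      by blast
  qed
qed

end

section \<open>Prime ideals and elimination\<close>

definition ideal_of :: "'r::comm_ring_1 set \<Rightarrow> bool" where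
  "ideal_of I \<longleftrightarrow> 0 \<in> I \<and> (\<forall>a\<in>I. \<forall>b\<in>I. a + b \<in> I) \<and> (\<forall>r. \<forall>a\<in>I. r * a \<in> I)"

definition prime_ideal_of :: "'r::comm_ring_1 set \<Rightarrow> bool" where
  "prime_ideal_of P \<longleftrightarrow> ideal_of P \<and> 1 \<notin> P \<and> (\<forall>a b. a * b \<in> P \<longrightarrow> a \<in> P \<or> b \<in> P)"

lemma ideal_0: "ideal_of I \<Longrightarrow> 0 \<in> I"
  and ideal_add: "ideal_of I \<Longrightarrow> a \<in> I \<Longrightarrow> b \<in> I \<Longrightarrow> a + b \<in> I"
  and ideal_mult: "ideal_of I \<Longrightarrow> a \<in> I \<Longrightarrow> r * a \<in> I"
  by (auto simp: ideal_of_def)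

lemma ideal_mult_right: "ideal_of I \<Longrightarrow> a \<in> I \<Longrightarrow> a * r \<in> I"
  using ideal_mult[of I a r] by (simp add: mult.commute)

lemma ideal_uminus: "ideal_of I \<Longrightarrow> a \<in> I \<Longrightarrow> - a \<in> I"
  using ideal_mult[of I a "- 1"] by simp

lemma ideal_diff: "ideal_of I \<Longrightarrow> a \<in> I \<Longrightarrow> b \<in> I \<Longrightarrow> a - b \<in> I"
  using ideal_add[of I a "- b"] ideal_uminus[of I b] by simp

lemma prime_ideal_ideal: "prime_ideal_of P \<Longrightarrow> ideal_of P"
  and prime_ideal_1: "prime_ideal_of P \<Longrightarrow> 1 \<notin> P"
  and prime_ideal_mult: "prime_ideal_of P \<Longrightarrow> a * b \<in> P \<Longrightarrow> a \<in> P \<or> b \<in> P"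
  by (auto simp: prime_ideal_of_def)

lemma prime_ideal_power: "prime_ideal_of P \<Longrightarrow> a ^ e \<in> P \<Longrightarrow> a \<in> P"
  by (induction e) (auto simp: prime_ideal_1 dest: prime_ideal_mult)

text \<open>The ideal \<open>I + a R\<close>.\<close>

definition adjoin :: "'r::comm_ring_1 set \<Rightarrow> 'r \<Rightarrow> 'r set" where
  "adjoin I a = {b. \<exists>r. b - a * r \<in> I}"

lemma ideal_adjoin:
  assumes "ideal_of I"
  shows "ideal_of (adjoin I a)" "I \<subseteq> adjoin I a" "a \<in> adjoin I a"
proof -
  show "ideal_of (adjoin I a)"
    unfolding ideal_of_def
  proof (intro conjI ballI allI)
    show "0 \<in> adjoin I a"
      using ideal_0[OF assms] by (auto simp: adjoin_def intro: exI[of _ 0])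
  next
    fix b c assume "b \<in> adjoin I a" "c \<in> adjoin I a"
    then obtain r s where "b - a * r \<in> I" "c - a * s \<in> I"
      by (auto simp: adjoin_def)
    then have "(b + c) - a * (r + s) \<in> I"
      using ideal_add[OF assms] by (fastforce simp: algebra_simps)
    then show "b + c \<in> adjoin I a"
      by (auto simp: adjoin_def)
  next
    fix r b assume "b \<in> adjoin I a"
    then obtain s where "b - a * s \<in> I"
      by (auto simp: adjoin_def)
    then have "r * b - a * (r * s) \<in> I"
      using ideal_mult[OF assms, of "b - a * s" r] by (simp add: algebra_simps)
    then show "r * b \<in> adjoin I a"
      by (auto simp: adjoin_def)
  qed
  show "I \<subseteq> adjoin I a"
    by (auto simp: adjoin_def intro: exI[of _ 0])
  show "a \<in> adjoin I a"
    using ideal_0[OF assms] by (auto simp: adjoin_def intro: exI[of _ 1])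
qed

text \<open>Krull: an ideal maximal among those disjoint from a multiplicative set is prime.
  Maximality is also exported, because \<open>nullstellensatz\<close> derives its contradiction from
  it.\<close>

lemma ex_prime_ideal_avoiding:
  fixes I M :: "'r::comm_ring_1 set"
  assumes I: "ideal_of I" and M: "1 \<in> M" "\<And>a b. a \<in> M \<Longrightarrow> b \<in> M \<Longrightarrow> a * b \<in> M"
    and disj: "I \<inter> M = {}"
  obtains P where "prime_ideal_of P" "I \<subseteq> P" "P \<inter> M = {}"
    "\<And>J. ideal_of J \<Longrightarrow> P \<subset> J \<Longrightarrow> J \<inter> M \<noteq> {}"
proof -
  define \<A> where "\<A> = {J. ideal_of J \<and> I \<subseteq> J \<and> J \<inter> M = {}}"
  have "\<exists>P\<in>\<A>. \<forall>J\<in>\<A>. P \<subseteq> J \<longrightarrow> J = P"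
  proof (rule subset_Zorn_nonempty)
    show "\<A> \<noteq> {}"
      using I disj by (auto simp: \<A>_def)
    fix \<C> assume \<C>: "\<C> \<noteq> {}" "subset.chain \<A> \<C>"
    then obtain J0 where J0: "J0 \<in> \<C>" by auto
    have mem: "ideal_of J" "I \<subseteq> J" "J \<inter> M = {}" if "J \<in> \<C>" for J
      using \<C>(2) that by (auto simp: \<A>_def subset_chain_def)
    have "ideal_of (\<Union>\<C>)"
      unfolding ideal_of_def
    proof (intro conjI ballI allI)
      show "0 \<in> \<Union>\<C>"
        using ideal_0[OF mem(1)[OF J0]] J0 by blast
    next
      fix a b assume "a \<in> \<Union>\<C>" "b \<in> \<Union>\<C>"
      then obtain J where "J \<in> \<C>" "a \<in> J" "b \<in> J"
        using \<C>(2) by (auto simp: subset_chain_def) (meson in_mono)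
      then show "a + b \<in> \<Union>\<C>"
        using ideal_add[OF mem(1)] by blast
    next
      fix r a assume "a \<in> \<Union>\<C>"
      then show "r * a \<in> \<Union>\<C>"
        using ideal_mult[OF mem(1)] by blast
    qed
    then show "\<Union>\<C> \<in> \<A>"
      using mem J0 by (fastforce simp: \<A>_def)
  qed
  then obtain P where P: "ideal_of P" "I \<subseteq> P" "P \<inter> M = {}"
    and "\<forall>J\<in>\<A>. P \<subseteq> J \<longrightarrow> J = P"
    by (auto simp: \<A>_def)
  then have max: "J \<inter> M \<noteq> {}" if "ideal_of J" "P \<subset> J" for J
    using that P(2) unfolding \<A>_def by blast
  have meet: "\<exists>r. \<exists>m\<in>M. m - a * r \<in> P" if "a \<notin> P" for a
  proof -
    have "P \<subset> adjoin P a"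
      using ideal_adjoin[OF P(1), of a] that by blast
    then have "adjoin P a \<inter> M \<noteq> {}"
      using max ideal_adjoin(1)[OF P(1)] by blast
    then show ?thesis
      by (auto simp: adjoin_def)
  qed
  have "prime_ideal_of P"
    unfolding prime_ideal_of_def
  proof (intro conjI allI impI P(1))
    show "1 \<notin> P"
      using P(3) M(1) by auto
    fix a b assume ab: "a * b \<in> P"
    show "a \<in> P \<or> b \<in> P"
    proof (rule ccontr)
      assume "\<not> (a \<in> P \<or> b \<in> P)"
      then obtain r m s n where *: "m \<in> M" "m - a * r \<in> P" "n \<in> M" "n - b * s \<in> P"
        using meet[of a] meet[of b] by blast
      have "m * n = (m - a * r) * n + (a * r) * (n - b * s) + (a * b) * (r * s)"
        by (simp add: algebra_simps)
      also have "\<dots> \<in> P"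
        using ideal_mult_right[OF P(1) *(2), of n] ideal_mult[OF P(1) *(4), of "a * r"]
          ideal_mult_right[OF P(1) ab, of "r * s"]
        by (intro ideal_add P(1))
      finally show False
        using M(2)[OF *(1,3)] P(3) by blast
    qed
  qed
  then show ?thesis
    using P max by (intro that[of P]) auto
qed

text \<open>Nakayama's lemma by elimination: \<open>W\<close> plays the role of the units of the local ring
  \<open>R\<close> with maximal ideal \<open>\<mm>\<close>.\<close>

lemma nakayama_elimination:
  fixes R \<mm> W Y :: "'r::comm_ring_1 set" and b :: "'e \<Rightarrow> 'r"
  assumes "finite E"
    and R: "\<And>r s. r \<in> R \<Longrightarrow> s \<in> R \<Longrightarrow> r * s \<in> R"
    and \<mm>: "\<mm> \<subseteq> R" "\<And>r a. r \<in> R \<Longrightarrow> a \<in> \<mm> \<Longrightarrow> r * a \<in> \<mm>" "\<And>a c. a \<in> \<mm> \<Longrightarrow> c \<in> \<mm> \<Longrightarrow> a + c \<in> \<mm>"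
    and W: "W \<subseteq> R" "1 \<in> W" "\<And>v w. v \<in> W \<Longrightarrow> w \<in> W \<Longrightarrow> v * w \<in> W"
      "\<And>w a. w \<in> W \<Longrightarrow> a \<in> \<mm> \<Longrightarrow> w - a \<in> W"
    and Y: "\<And>r y. r \<in> R \<Longrightarrow> y \<in> Y \<Longrightarrow> r * y \<in> Y" "\<And>x y. x \<in> Y \<Longrightarrow> y \<in> Y \<Longrightarrow> x + y \<in> Y"
    and ex: "\<And>e. e \<in> E \<Longrightarrow> \<exists>w\<in>W. \<exists>a. (\<forall>f\<in>E. a f \<in> \<mm>) \<and> w * b e - (\<Sum>f\<in>E. a f * b f) \<in> Y"
  shows "\<forall>e\<in>E. \<exists>w\<in>W. w * b e \<in> Y"
  using \<open>finite E\<close> ex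
proof (induction E rule: finite_induct)
  case (insert e0 E)
  obtain w0 a0 where 0: "w0 \<in> W" "\<And>f. f \<in> insert e0 E \<Longrightarrow> a0 f \<in> \<mm>"
    "w0 * b e0 - (\<Sum>f\<in>insert e0 E. a0 f * b f) \<in> Y"
    using insert.prems[of e0] by auto
  \<comment> \<open>The term with \<open>b e0\<close> on the right is moved to the left;
    \<open>w1\<close> is still a unit, so \<open>b e0\<close> can be eliminated from the other
    congruences.\<close>
  define w1 where "w1 = w0 - a0 e0"
  have w1: "w1 \<in> W"
    using W(4) 0 by (simp add: w1_def)
  have red0: "w1 * b e0 - (\<Sum>f\<in>E. a0 f * b f) \<in> Y"
    using 0(3) insert.hyps by (simp add: w1_def algebra_simps)
  have "\<forall>e\<in>E. \<exists>w\<in>W. w * b e \<in> Y"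
  proof (rule insert.IH)
    fix e assume e: "e \<in> E"
    obtain w a where 1: "w \<in> W" "\<And>f. f \<in> insert e0 E \<Longrightarrow> a f \<in> \<mm>"
      "w * b e - (\<Sum>f\<in>insert e0 E. a f * b f) \<in> Y"
      using insert.prems[of e] e by auto
    let ?c = "\<lambda>f. w1 * a f + a e0 * a0 f"
    have "w1 * (w * b e - (\<Sum>f\<in>insert e0 E. a f * b f)) + a e0 * (w1 * b e0 - (\<Sum>f\<in>E. a0 f * b f)) \<in> Y"
      using 1 red0 w1 W(1) \<mm>(1) by (intro Y) auto
    also have "w1 * (w * b e - (\<Sum>f\<in>insert e0 E. a f * b f)) + a e0 * (w1 * b e0 - (\<Sum>f\<in>E. a0 f * b f))
        = (w1 * w) * b e - (\<Sum>f\<in>E. ?c f * b f)"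
      using insert.hyps
      by (simp add: algebra_simps sum_distrib_left sum.distrib)
    finally have "(w1 * w) * b e - (\<Sum>f\<in>E. ?c f * b f) \<in> Y" .
    moreover have "\<forall>f\<in>E. ?c f \<in> \<mm>"
      using \<mm>(2)[OF subsetD[OF W(1) w1] 1(2)] \<mm>(2)[OF subsetD[OF \<mm>(1) 1(2)] 0(2)] by (auto intro: \<mm>(3))
    moreover have "w1 * w \<in> W"
      using W(3) w1 1 by auto
    ultimately show "\<exists>w\<in>W. \<exists>a. (\<forall>f\<in>E. a f \<in> \<mm>) \<and> w * b e - (\<Sum>f\<in>E. a f * b f) \<in> Y"
      by (intro bexI[of _ "w1 * w"] exI[of _ ?c]) auto
  qed
  then obtain v where v: "\<And>e. e \<in> E \<Longrightarrow> v e \<in> W" "\<And>e. e \<in> E \<Longrightarrow> v e * b e \<in> Y"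
    by metis
  have prodW: "(\<Prod>f\<in>F. v f) \<in> W" if "finite F" "F \<subseteq> E" for F
    using that by (induction F rule: finite_induct) (auto intro!: W v)
  \<comment> \<open>A common denominator: \<open>p\<close> carries every remaining
    \<open>b f\<close> into \<open>Y\<close> at once, which is needed to substitute back for
    \<open>b e0\<close>.\<close>
  define p where "p = (\<Prod>f\<in>E. v f)"
  have p: "p \<in> W" "p * b f \<in> Y" if "f \<in> E" for f
  proof -
    show "p \<in> W"
      using prodW insert.hyps by (auto simp: p_def)
    have "p * b f = (\<Prod>f\<in>E - {f}. v f) * (v f * b f)"
      using insert.hyps that by (simp add: p_def prod.remove mult_ac)
    also have "\<dots> \<in> Y"
      using Y(1)[OF subsetD[OF W(1) prodW[of "E - {f}"]] v(2)[OF that]] insert.hyps by simp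
    finally show "p * b f \<in> Y" .
  qed
  have pW: "p \<in> W"
    using prodW insert.hyps by (auto simp: p_def)
  have "(p * w1) * b e0 \<in> Y"
  proof -
    have "p * (w1 * b e0 - (\<Sum>f\<in>E. a0 f * b f)) \<in> Y"
      using red0 pW W(1) by (intro Y) auto
    moreover have "p * (\<Sum>f\<in>E. a0 f * b f) = (\<Sum>f\<in>E. a0 f * (p * b f))"
      by (simp add: sum_distrib_left mult_ac)
    moreover have "x + (\<Sum>f\<in>F. a0 f * (p * b f)) \<in> Y" if "x \<in> Y" "finite F" "F \<subseteq> E" for x F
      using that(2,3)
    proof (induction F rule: finite_induct)
      case (insert f F)
      have "(x + (\<Sum>f\<in>F. a0 f * (p * b f))) + a0 f * (p * b f) \<in> Y"
        using insert p 0(2) \<mm>(1) by (intro Y(2)[OF _ Y(1)[of "a0 f" "p * b f"]]) auto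
      then show ?case
        using insert by (simp add: algebra_simps)
    qed (use that in simp)
    ultimately have "p * (w1 * b e0 - (\<Sum>f\<in>E. a0 f * b f)) + p * (\<Sum>f\<in>E. a0 f * b f) \<in> Y"
      using insert.hyps by simp
    then show ?thesis
      by (simp add: algebra_simps)
  qed
  moreover have "p * w1 \<in> W"
    using W(3) pW w1 by auto
  ultimately show ?case
    using v by auto
qed simp

section \<open>Algebraic independence modulo an ideal\<close>

lemma kalg_struct_const: "kalg_struct (single 0 :: 'k::field \<Rightarrow> 'k mp)"
  by (auto simp: kalg_struct_def single_add mult_single)

section \<open>Specialising one variable of a polynomial\<close>

lemma mon_eval_cong: "(\<And>i. i \<in> keys m \<Longrightarrow> z i = z' i) \<Longrightarrow> mon_eval z m = mon_eval z' m"
  by (auto simp: mon_eval_def intro!: prod.cong)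

lemma mon_eval_var: "mon_eval (\<lambda>i. single (var_mon i) 1) m = (single m 1 :: 'k::comm_ring_1 mp)"
  by (induction m rule: mon_induct) (auto simp: mon_eval_add mult_single)

definition subst_var :: "nat \<Rightarrow> 'k::field \<Rightarrow> 'k mp \<Rightarrow> 'k mp" where
  "subst_var s c = poly_eval (single 0)
     (\<lambda>i. if i = s then single 0 c else single (var_mon i) 1)"

lemma subst_var_0 [simp]: "subst_var s c 0 = 0"
  and subst_var_1 [simp]: "subst_var s c 1 = 1"
  and subst_var_const [simp]: "subst_var s c (single 0 a) = single 0 a"
  and subst_var_add: "subst_var s c (p + q) = subst_var s c p + subst_var s c q"
  and subst_var_diff: "subst_var s c (p - q) = subst_var s c p - subst_var s c q"
  and subst_var_mult: "subst_var s c (p * q) = subst_var s c p * subst_var s c q"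
  and subst_var_power: "subst_var s c (p ^ e) = subst_var s c p ^ e"
  and subst_var_sum: "subst_var s c (\<Sum>i\<in>I. g i) = (\<Sum>i\<in>I. subst_var s c (g i))"
proof -
  interpret kalgebra "single 0 :: 'a \<Rightarrow> 'a mp"
    by (rule kalgebra.intro[OF kalg_struct_const])
  show "subst_var s c 0 = 0" "subst_var s c 1 = 1"
    "subst_var s c (single 0 a) = single 0 a"
    "subst_var s c (p + q) = subst_var s c p + subst_var s c q"
    "subst_var s c (p - q) = subst_var s c p - subst_var s c q"
    "subst_var s c (p * q) = subst_var s c p * subst_var s c q"
    "subst_var s c (p ^ e) = subst_var s c p ^ e"
    "subst_var s c (\<Sum>i\<in>I. g i) = (\<Sum>i\<in>I. subst_var s c (g i))"
    unfolding subst_var_def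
    by (rule poly_eval_0 poly_eval_1 poly_eval_const poly_eval_add poly_eval_diff poly_eval_mult
        poly_eval_power poly_eval_sum)+
qed

lemma subst_var_var [simp]: "subst_var s c (single (var_mon s) 1) = single 0 c"
  by (simp add: subst_var_def kalgebra.poly_eval_var[OF kalgebra.intro[OF kalg_struct_const]])

definition drop_var :: "nat \<Rightarrow> mon \<Rightarrow> mon" where
  "drop_var s m = m - single s (lookup m s)"

lemma drop_var_add: "drop_var s m + single s (lookup m s) = m"
  by (intro poly_mapping_eqI) (auto simp: drop_var_def lookup_add lookup_minus lookup_single when_def)

lemma keys_drop_var: "keys (drop_var s m) = keys m - {s}"
  by (auto simp: drop_var_def in_keys_iff lookup_minus lookup_single when_def split: if_splits)

lemma lookup_drop_var: "lookup (drop_var s m) i = (if i = s then 0 else lookup m i)"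
  by (auto simp: drop_var_def lookup_minus lookup_single when_def)

lemma subst_var_single:
  "subst_var s c (single m a) = single (drop_var s m) (a * c ^ lookup m s)"
proof -
  let ?z = "\<lambda>i. if i = s then single 0 c else single (var_mon i) 1 :: 'a mp"
  have "mon_eval ?z (drop_var s m) = mon_eval (\<lambda>i. single (var_mon i) 1) (drop_var s m)"
    by (rule mon_eval_cong) (auto simp: keys_drop_var)
  then have 1: "mon_eval ?z (drop_var s m) = single (drop_var s m) 1"
    by (simp add: mon_eval_var)
  have "mon_eval ?z m = mon_eval ?z (drop_var s m + single s (lookup m s))"
    by (simp only: drop_var_add)
  also have "\<dots> = single (drop_var s m) 1 * single 0 c ^ lookup m s"
    unfolding mon_eval_add 1 by simp
  also have "single 0 c ^ e = (single 0 (c ^ e) :: 'a mp)" for e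
    by (induction e) (auto simp: mult_single)
  finally show ?thesis
    unfolding subst_var_def kalgebra.poly_eval_single[OF kalgebra.intro[OF kalg_struct_const]]
    by (simp add: mult_single)
qed

lemma subst_var_eq:
  assumes "supp_in S p" "s \<notin> S"
  shows "subst_var s c p = p"
  using assms(1)
proof (induction rule: supp_in_induct)
  case zero
  then show ?case by simp
next
  case (single m a)
  then have "lookup m s = 0"
    using assms(2) by (auto intro: lookup_eq_0)
  moreover from this have "drop_var s m = m"
    by (simp add: drop_var_def)
  ultimately show ?case
    by (simp add: subst_var_single)
next
  case (add p q)
  then show ?case
    by (simp add: subst_var_add)
qed

text \<open>Collected by the monomials in the other variables, \<open>H\<close> has some nonzero
  coefficient, a polynomial in \<open>X_s\<close> alone. It has finitely many roots and the field is
  infinite.\<close>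

lemma ex_subst_var_nonzero:
  fixes H :: "'k::field_char_0 mp"
  assumes "H \<noteq> 0"
  obtains c where "subst_var s c H \<noteq> 0"
proof -
  obtain m0 where m0: "m0 \<in> keys H"
    using assms by (metis all_not_in_conv keys_eq_empty)
  define G where "G = {m \<in> keys H. drop_var s m = drop_var s m0}"
  \<comment> \<open>The coefficient of the monomial \<open>drop_var s m0\<close> in
    \<open>H\<close>, as a polynomial in \<open>X_s\<close>.\<close>
  define q where "q = (\<Sum>m\<in>G. monom (lookup H m) (lookup m s))"
  have G: "finite G" "m0 \<in> G"
    using m0 by (auto simp: G_def)
  have inj: "m = m0" if "m \<in> G" "lookup m s = lookup m0 s" for m
  proof -
    have eq: "drop_var s m = drop_var s m0"
      using that(1) by (simp add: G_def)
    have "m = drop_var s m + single s (lookup m s)"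
      by (rule drop_var_add[symmetric])
    also have "\<dots> = drop_var s m0 + single s (lookup m0 s)"
      unfolding that(2) eq ..
    also have "\<dots> = m0"
      by (rule drop_var_add)
    finally show ?thesis .
  qed
  have "coeff q (lookup m0 s) = (\<Sum>m\<in>G. if m = m0 then lookup H m0 else 0)"
    unfolding q_def coeff_sum using inj by (intro sum.cong) auto
  also have "\<dots> = lookup H m0"
    using G by simp
  finally have "q \<noteq> 0"
    using m0 by (auto simp: in_keys_iff)
  then have "finite {c. poly q c = 0}"
    by (rule poly_roots_finite)
  then obtain c where c: "poly q c \<noteq> 0"
    using ex_new_if_finite[OF infinite_UNIV_char_0[where 'a = 'k]] by auto
  have "subst_var s c H = subst_var s c (\<Sum>m\<in>keys H. single m (lookup H m))"
    by (simp flip: mp_sum_singles)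
  also have "\<dots> = (\<Sum>m\<in>keys H. single (drop_var s m) (lookup H m * c ^ lookup m s))"
    by (simp only: subst_var_sum subst_var_single)
  finally have "subst_var s c H
    = (\<Sum>m\<in>keys H. single (drop_var s m) (lookup H m * c ^ lookup m s))" .
  then have "lookup (subst_var s c H) (drop_var s m0)
      = (\<Sum>m\<in>keys H. lookup H m * c ^ lookup m s when drop_var s m = drop_var s m0)"
    by (simp add: lookup_sum lookup_single)
  also have "\<dots> = (\<Sum>m\<in>G. lookup H m * c ^ lookup m s)"
    unfolding G_def when_def by (rule sum.inter_filter[symmetric]) simp
  also have "\<dots> = poly q c"
    by (simp add: q_def poly_sum poly_monom)
  finally show ?thesis
    using c by (intro that[of c]) auto
qed

section \<open>Counting monomials against the growth of an algebra\<close>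

definition box_mons :: "nat set \<Rightarrow> nat \<Rightarrow> mon set" where
  "box_mons S b = {m. keys m \<subseteq> S \<and> (\<forall>i. lookup m i \<le> b)}"

lemma card_box_mons:
  assumes "finite S"
  shows "finite (box_mons S b)" "card (box_mons S b) = (b + 1) ^ card S"
proof -
  let ?r = "\<lambda>m::mon. restrict (lookup m) S"
  have inj: "inj_on ?r (box_mons S b)"
    by (rule inj_on_subset[OF inj_on_restrict_lookup]) (auto simp: box_mons_def)
  have im: "?r ` box_mons S b = PiE S (\<lambda>_. {..b})"
  proof
    show "?r ` box_mons S b \<subseteq> PiE S (\<lambda>_. {..b})"
      by (auto simp: box_mons_def)
    show "PiE S (\<lambda>_. {..b}) \<subseteq> ?r ` box_mons S b"
    proof
      fix f assume f: "f \<in> PiE S (\<lambda>_. {..b})"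
      define m where "m = (\<Sum>i\<in>S. single i (f i))"
      have m: "lookup m j = (if j \<in> S then f j else 0)" for j
        using assms by (simp add: m_def lookup_sum lookup_single when_def)
      then have "m \<in> box_mons S b"
        using f by (auto simp: box_mons_def in_keys_iff PiE_def Pi_def split: if_splits)
      moreover have "f = ?r m"
        using f m by (intro ext) (auto simp: PiE_def extensional_def)
      ultimately show "f \<in> ?r ` box_mons S b" by blast
    qed
  qed
  show "finite (box_mons S b)"
    by (rule finite_imageD[OF _ inj]) (simp add: im assms finite_PiE)
  show "card (box_mons S b) = (b + 1) ^ card S"
    using card_image[OF inj] assms by (simp add: im card_PiE)
qed

text \<open>A count of order \<open>d\<close> in a range linear in \<open>m\<close> is overtaken by
  one of order \<open>d + 1\<close>; the least \<open>m\<close> allowed here is the one used in the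
  applications.\<close>

lemma power_growth_bound:
  fixes C D d m W :: nat
  assumes "W \<le> D * m" "C * (D + 1) ^ d \<le> m"
  shows "C * (W + 1) ^ d < (m + 1) ^ Suc d"
proof -
  have "W + 1 \<le> (D + 1) * (m + 1)"
    using assms(1) by (simp add: algebra_simps)
  then have "C * (W + 1) ^ d \<le> C * ((D + 1) * (m + 1)) ^ d"
    by (intro mult_left_mono power_mono) auto
  also have "\<dots> = C * (D + 1) ^ d * (m + 1) ^ d"
    by (simp only: power_mult_distrib mult.assoc)
  also have "\<dots> < (m + 1) * (m + 1) ^ d"
    using assms(2) by (intro mult_strict_right_mono) auto
  finally show ?thesis by simp
qed

lemma (in kalgebra) ideal_subspace: "ideal_of I \<Longrightarrow> vs.subspace I"
  by (auto simp: vs.subspace_def ideal_of_def)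

definition (in kalgebra) indep_mod :: "'r set \<Rightarrow> (nat \<Rightarrow> 'r) \<Rightarrow> nat set \<Rightarrow> bool" where
  "indep_mod P z S \<longleftrightarrow> (\<forall>p. supp_in S p \<longrightarrow> poly_eval \<phi> z p \<in> P \<longrightarrow> p = 0)"

locale fg_algebra = kalgebra \<phi> for \<phi> :: "'k::field_char_0 \<Rightarrow> 'r::comm_ring_1" +
  fixes z :: "nat \<Rightarrow> 'r" and n :: nat
  assumes generated: "\<exists>p. supp_in {..<n} p \<and> a = poly_eval \<phi> z p"
begin

abbreviation ev :: "'k mp \<Rightarrow> 'r" where
  "ev \<equiv> poly_eval \<phi> z"

definition deg_le :: "nat \<Rightarrow> 'r set" where
  "deg_le D = vs.span (mon_eval z ` {m. keys m \<subseteq> {..<n} \<and> weight (\<lambda>_. 1) m \<le> D})"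

lemma deg_le_mono: "D \<le> E \<Longrightarrow> deg_le D \<subseteq> deg_le E"
  unfolding deg_le_def by (intro vs.span_mono) auto

lemma deg_le_add: "a \<in> deg_le D \<Longrightarrow> b \<in> deg_le D \<Longrightarrow> a + b \<in> deg_le D"
  and deg_le_scale: "a \<in> deg_le D \<Longrightarrow> \<phi> c * a \<in> deg_le D"
  unfolding deg_le_def by (auto intro: vs.span_add vs.span_scale)

lemma mon_eval_deg_le: "keys m \<subseteq> {..<n} \<Longrightarrow> weight (\<lambda>_. 1) m \<le> D \<Longrightarrow> mon_eval z m \<in> deg_le D"
  unfolding deg_le_def by (intro vs.span_base) auto

lemma ex_deg_le: "\<exists>D. a \<in> deg_le D"
proof -
  obtain p where p: "supp_in {..<n} p" "a = ev p"
    using generated by blast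
  have "ev p \<in> deg_le (Max (weight (\<lambda>_. 1) ` keys p))"
    unfolding deg_le_def
    by (intro poly_eval_in_span vs.span_base imageI) (use p in \<open>auto simp: supp_in_def\<close>)
  with p show ?thesis by blast
qed

lemma deg_le_mult:
  assumes "a \<in> deg_le D" "b \<in> deg_le E"
  shows "a * b \<in> deg_le (D + E)"
  using assms(1) unfolding deg_le_def[of D]
proof (induction a rule: vs.span_induct_alt)
  case base
  then show ?case by (simp add: deg_le_def vs.span_zero)
next
  case (step c x y)
  then obtain m where m: "keys m \<subseteq> {..<n}" "weight (\<lambda>_. 1) m \<le> D" "x = mon_eval z m" by auto
  have "x * b \<in> deg_le (D + E)"
    using assms(2) unfolding deg_le_def[of E]
  proof (induction b rule: vs.span_induct_alt)
    case base
    then show ?case by (simp add: deg_le_def vs.span_zero)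
  next
    case (step c' x' y')
    then obtain m' where m': "keys m' \<subseteq> {..<n}" "weight (\<lambda>_. 1) m' \<le> E" "x' = mon_eval z m'" by auto
    have "x * x' \<in> deg_le (D + E)"
      unfolding m(3) m'(3) mon_eval_add[symmetric]
      by (rule mon_eval_deg_le) (use m m' in \<open>auto simp: keys_add_mon weight_add\<close>)
    then have "\<phi> c' * (x * x') + x * y' \<in> deg_le (D + E)"
      using step by (intro deg_le_add deg_le_scale) auto
    then show ?case
      by (simp add: distrib_left mult.left_commute)
  qed
  then have "\<phi> c * (x * b) + y * b \<in> deg_le (D + E)"
    using step by (intro deg_le_add deg_le_scale) auto
  then show ?case
    by (simp add: distrib_right mult.assoc)
qed

lemma deg_le_power: "a \<in> deg_le D \<Longrightarrow> a ^ i \<in> deg_le (i * D)"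
proof (induction i)
  case 0
  then show ?case
    using mon_eval_deg_le[of 0 0] by simp
next
  case (Suc i)
  then show ?case
    using deg_le_mult[of a D "a ^ i" "i * D"] by simp
qed

text \<open>Stands for transcendence degree at most \<open>d\<close> modulo \<open>P\<close>, tested
  on subsets of the generators only.\<close>

definition max_indep :: "'r set \<Rightarrow> nat \<Rightarrow> bool" where
  "max_indep P d \<longleftrightarrow> (\<forall>S. S \<subseteq> {..<n} \<longrightarrow> indep_mod P z S \<longrightarrow> card S \<le> d)"

text \<open>Any \<open>d + 1\<close> generators are dependent modulo \<open>P\<close>, so
  \<open>monomial_growth\<close> applies with \<open>K = P\<close>. Multiples of the relations lie
  in \<open>P\<close> outright, without lower order terms.\<close>

lemma growth_mod_ideal:
  assumes P: "ideal_of P" and d: "max_indep P d"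
  obtains C where "\<And>W. \<exists>X. finite X \<and> card X \<le> C * (W + 1) ^ d \<and> deg_le W \<subseteq> vs.span (X \<union> P)"
proof -
  have "\<exists>h. S \<subseteq> {..<n} \<longrightarrow> card S = Suc d \<longrightarrow> supp_in S h \<and> h \<noteq> 0 \<and> ev h \<in> P" for S
    using d unfolding max_indep_def indep_mod_def
    by (metis not_less_eq_eq order_refl)
  then obtain h where h: "\<And>S. S \<subseteq> {..<n} \<Longrightarrow> card S = Suc d \<Longrightarrow> supp_in S (h S) \<and> h S \<noteq> 0 \<and> ev (h S) \<in> P"
    by metis
  obtain C where C: "\<And>K W. vs.subspace K \<Longrightarrow>
    (\<And>S \<tau>. S \<subseteq> {..<n} \<Longrightarrow> card S = Suc d \<Longrightarrow> keys \<tau> \<subseteq> {..<n} \<Longrightarrow>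
      ev (h S) * mon_eval z \<tau> \<in> vs.span (mon_eval z `
        {\<sigma>. keys \<sigma> \<subseteq> {..<n} \<and> weight (\<lambda>_. 1) \<sigma> < wdeg (\<lambda>_. 1) (h S) + weight (\<lambda>_. 1) \<tau>} \<union> K)) \<Longrightarrow>
    \<exists>X. finite X \<and> card X \<le> C * (W + 1) ^ d \<and>
      (\<forall>\<tau>. keys \<tau> \<subseteq> {..<n} \<longrightarrow> weight (\<lambda>_. 1) \<tau> \<le> W \<longrightarrow> mon_eval z \<tau> \<in> vs.span (X \<union> K))"
    by (rule monomial_growth[of n "\<lambda>_. 1" d h z]) (use h in auto)
  show ?thesis
  proof (rule that)
    fix W
    have "\<exists>X. finite X \<and> card X \<le> C * (W + 1) ^ d \<and>
      (\<forall>\<tau>. keys \<tau> \<subseteq> {..<n} \<longrightarrow> weight (\<lambda>_. 1) \<tau> \<le> W \<longrightarrow> mon_eval z \<tau> \<in> vs.span (X \<union> P))"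
    proof (rule C[OF ideal_subspace[OF P]])
      fix S \<tau> assume "S \<subseteq> {..<n}" "card S = Suc d"
      then have "ev (h S) * mon_eval z \<tau> \<in> P"
        using h P by (intro ideal_mult_right) auto
      then show "ev (h S) * mon_eval z \<tau> \<in> vs.span (mon_eval z `
        {\<sigma>. keys \<sigma> \<subseteq> {..<n} \<and> weight (\<lambda>_. 1) \<sigma> < wdeg (\<lambda>_. 1) (h S) + weight (\<lambda>_. 1) \<tau>} \<union> P)"
        by (intro vs.span_base) auto
    qed
    then obtain X where X: "finite X" "card X \<le> C * (W + 1) ^ d"
      "\<And>\<tau>. keys \<tau> \<subseteq> {..<n} \<Longrightarrow> weight (\<lambda>_. 1) \<tau> \<le> W \<Longrightarrow> mon_eval z \<tau> \<in> vs.span (X \<union> P)"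
      by blast
    then have "deg_le W \<subseteq> vs.span (X \<union> P)"
      unfolding deg_le_def by (intro vs.span_minimal) auto
    with X show "\<exists>X. finite X \<and> card X \<le> C * (W + 1) ^ d \<and> deg_le W \<subseteq> vs.span (X \<union> P)"
      by blast
  qed
qed

text \<open>The monomials in \<open>S\<close> and \<open>f\<close> grow like a polynomial of degree \<open>d + 1\<close>,
  faster than the algebra modulo \<open>P\<close>.\<close>

lemma algebraic_relation:
  assumes P: "ideal_of P" and d: "max_indep P d" and S: "S \<subseteq> {..<n}" "card S = d"
  obtains M :: nat and q where "\<And>i. supp_in S (q i)" "\<exists>i<M. q i \<noteq> 0" "(\<Sum>i<M. ev (q i) * f ^ i) \<in> P"
proof -
  obtain D where D: "f \<in> deg_le D"
    using ex_deg_le by blast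
  obtain C where C: "\<And>W. \<exists>X. finite X \<and> card X \<le> C * (W + 1) ^ d \<and> deg_le W \<subseteq> vs.span (X \<union> P)"
    using growth_mod_ideal[OF P d] by blast
  have finS: "finite S"
    using S finite_subset by auto
  \<comment> \<open>Powers \<open>f ^ i\<close> with \<open>i \<le> m\<close> have degree at most
    \<open>D * m\<close>, and monomials of the box in \<open>d\<close> variables at most
    \<open>d * m\<close>. The value of \<open>m\<close> is the threshold of
    \<open>power_growth_bound\<close> for \<open>D + d\<close>.\<close>
  define m where "m = C * ((D + d) + 1) ^ d"
  define T where "T = {..<Suc m} \<times> box_mons S m"
  define F where "F t = f ^ fst t * mon_eval z (snd t)" for t
  have T: "finite T" "card T = (m + 1) ^ Suc d"
    using card_box_mons[OF finS] S by (auto simp: T_def card_cartesian_product)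
  obtain X where X: "finite X" "card X \<le> C * ((D + d) * m + 1) ^ d" "deg_le ((D + d) * m) \<subseteq> vs.span (X \<union> P)"
    using C by blast
  have F: "F t \<in> vs.span (X \<union> P)" if tT: "t \<in> T" for t
  proof -
    obtain i \<beta> where t: "t = (i, \<beta>)" "i \<le> m" "\<beta> \<in> box_mons S m"
      using tT by (cases t) (auto simp: T_def less_Suc_eq_le)
    have "weight (\<lambda>_. 1) \<beta> \<le> card S * (1 * m)"
      using t by (intro weight_le_card finS) (auto simp: box_mons_def)
    then have "mon_eval z \<beta> \<in> deg_le (d * m)"
      using t S by (intro mon_eval_deg_le) (auto simp: box_mons_def)
    moreover have "f ^ i \<in> deg_le (i * D)"
      using D by (rule deg_le_power)
    ultimately have "F t \<in> deg_le (i * D + d * m)"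
      unfolding F_def t by (auto intro: deg_le_mult)
    moreover have "i * D + d * m \<le> (D + d) * m"
      using t by (simp add: algebra_simps)
    ultimately show ?thesis
      using X(3) deg_le_mono by blast
  qed
  have "\<exists>c. (\<Sum>t\<in>T. \<phi> (c t) * F t) \<in> P \<and> \<not> (\<forall>t\<in>T. c t = 0)"
  proof (rule ccontr)
    assume "\<not> ?thesis"
    then have "card T \<le> card X"
      using F X(1) T(1) ideal_subspace[OF P] by (intro vs.card_le_of_independent_mod) auto
    also have "\<dots> < card T"
      using X(2) power_growth_bound[of "(D + d) * m" "D + d" m C d] T(2) by (simp add: m_def)
    finally show False by simp
  qed
  then obtain c t0 where c: "(\<Sum>t\<in>T. \<phi> (c t) * F t) \<in> P" "t0 \<in> T" "c t0 \<noteq> 0"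
    by blast
  define q where "q i = (\<Sum>\<beta>\<in>box_mons S m. single \<beta> (c (i, \<beta>)))" for i
  show ?thesis
  proof (rule that)
    show "supp_in S (q i)" for i
      unfolding q_def by (intro supp_in_sum supp_in_single) (auto simp: box_mons_def)
    have "lookup (q (fst t0)) (snd t0) = c t0"
      using c(2) card_box_mons(1)[OF finS, of m]
      by (auto simp: q_def lookup_sum lookup_single when_def T_def)
    then show "\<exists>i<Suc m. q i \<noteq> 0"
      using c by (intro exI[of _ "fst t0"]) (auto simp: T_def)
    have "(\<Sum>t\<in>T. \<phi> (c t) * F t) = (\<Sum>i<Suc m. \<Sum>\<beta>\<in>box_mons S m. \<phi> (c (i, \<beta>)) * F (i, \<beta>))"
      unfolding T_def by (simp add: sum.cartesian_product case_prod_unfold)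
    also have "\<dots> = (\<Sum>i<Suc m. ev (q i) * f ^ i)"
      unfolding q_def poly_eval_sum poly_eval_single F_def sum_distrib_right
      by (intro sum.cong) (auto simp: mult_ac)
    finally show "(\<Sum>i<Suc m. ev (q i) * f ^ i) \<in> P"
      using c by simp
  qed
qed

text \<open>Since \<open>P\<close> is prime and misses \<open>f\<close>, factors \<open>f\<close>
  can be cancelled from an algebraic relation until its constant term is nonzero. Then
  \<open>f\<close> divides this constant term modulo \<open>P\<close>.\<close>

lemma algebraic_unit:
  assumes P: "prime_ideal_of P" and d: "max_indep P d" and S: "S \<subseteq> {..<n}" "card S = d"
    and f: "f \<notin> P"
  obtains g r where "supp_in S r" "r \<noteq> 0" "f * g - ev r \<in> P"
proof -
  have "\<exists>g r. supp_in S r \<and> r \<noteq> 0 \<and> f * g - ev r \<in> P"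
    if "\<And>i. supp_in S (q i)" "\<exists>i<M. q i \<noteq> 0" "(\<Sum>i<M. ev (q i) * f ^ i) \<in> P" for M :: nat and q
    using that
  proof (induction M arbitrary: q)
    case (Suc M)
    let ?g = "\<Sum>i<M. ev (q (Suc i)) * f ^ i"
    have eq: "(\<Sum>i<Suc M. ev (q i) * f ^ i) = ev (q 0) + f * ?g"
      unfolding sum.lessThan_Suc_shift by (simp add: sum_distrib_left mult_ac)
    show ?case
    proof (cases "q 0 = 0")
      case True
      then have "?g \<in> P"
        using Suc.prems(3) eq f prime_ideal_mult[OF P] by auto
      moreover have "\<exists>i<M. q (Suc i) \<noteq> 0"
        using Suc.prems(2) True by (metis less_Suc_eq_0_disj)
      ultimately show ?thesis
        using Suc.IH[of "\<lambda>i. q (Suc i)"] Suc.prems(1) by blast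
    next
      case False
      have "f * ?g - ev (- q 0) \<in> P"
        using Suc.prems(3) unfolding eq poly_eval_uminus by (simp add: add.commute)
      moreover have "supp_in S (- q 0)" "- q 0 \<noteq> 0"
        using Suc.prems(1) False by (auto simp: supp_in_uminus)
      ultimately show ?thesis
        by blast
    qed
  qed auto
  note * = this
  obtain M :: nat and q where "\<And>i. supp_in S (q i)" "\<exists>i<M. q i \<noteq> 0" "(\<Sum>i<M. ev (q i) * f ^ i) \<in> P"
    by (rule algebraic_relation[OF prime_ideal_ideal[OF P] d S, where f = f]) (rule that)
  from *[OF this] show ?thesis
    by (elim exE conjE) (rule that)
qed

text \<open>Vanishing top coefficients are dropped from the relation. The degree stays positive
  because a relation of degree zero would contradict the independence of \<open>S\<close>.\<close>

lemma algebraic_equation: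
  assumes P: "ideal_of P" and d: "max_indep P d" and S: "S \<subseteq> {..<n}" "card S = d" "indep_mod P z S"
  obtains D q where "0 < D" "\<And>i. supp_in S (q i)" "q D \<noteq> 0" "(\<Sum>i\<le>D. ev (q i) * f ^ i) \<in> P"
proof -
  have "\<exists>D q. 0 < D \<and> (\<forall>i. supp_in S (q i)) \<and> q D \<noteq> 0 \<and> (\<Sum>i\<le>D. ev (q i) * f ^ i) \<in> P"
    if "\<And>i. supp_in S (q i)" "\<exists>i<M. q i \<noteq> 0" "(\<Sum>i<M. ev (q i) * f ^ i) \<in> P" for M :: nat and q
    using that(2,3)
  proof (induction M)
    case (Suc M)
    show ?case
    proof (cases "q M = 0")
      case True
      then show ?thesis
        using Suc by (auto simp: less_Suc_eq)
    next
      case False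
      have "M \<noteq> 0"
      proof
        assume "M = 0"
        then have "ev (q 0) \<in> P"
          using Suc.prems by simp
        then show False
          using S(3) that(1) False \<open>M = 0\<close> by (auto simp: indep_mod_def)
      qed
      then show ?thesis
        using that(1) False Suc.prems(2) by (intro exI[of _ M] exI[of _ q]) (auto simp: lessThan_Suc_atMost)
    qed
  qed auto
  note * = this
  obtain M :: nat and q where "\<And>i. supp_in S (q i)" "\<exists>i<M. q i \<noteq> 0" "(\<Sum>i<M. ev (q i) * f ^ i) \<in> P"
    by (rule algebraic_relation[OF P d S(1,2), where f = f]) (rule that)
  from *[OF this] show ?thesis
    by (elim exE conjE) (rule that, auto)
qed

end

section \<open>Chains of primes and the Nullstellensatz\<close>

context fg_algebra
begin

lemma ev_var_mult: "z j * mon_eval z m = mon_eval z (m + var_mon j)"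
  by (simp add: mon_eval_add)

text \<open>After inverting the product \<open>h\<close> of the leading coefficients of the algebraic equations of the
  generators, the algebra modulo \<open>P\<close> is a finite module over the polynomials in \<open>S\<close>.\<close>

lemma generic_finiteness:
  assumes P: "ideal_of P" and d: "max_indep P d" and S: "S \<subseteq> {..<n}" "card S = d" "indep_mod P z S"
  obtains E h where "finite E" "0 \<in> E" "supp_in S h" "h \<noteq> 0"
    "\<And>a. \<exists>N r. (\<forall>e. supp_in S (r e)) \<and> ev (h ^ N) * a - (\<Sum>e\<in>E. ev (r e) * mon_eval z e) \<in> P"
proof -
  have "\<exists>D q. 0 < D \<and> (\<forall>i. supp_in S (q i)) \<and> q D \<noteq> 0 \<and> (\<Sum>i\<le>D. ev (q i) * z j ^ i) \<in> P" for j
    by (rule algebraic_equation[OF P d S, where f = "z j"]) blast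
  then obtain D q where Dq: "\<And>j. 0 < D j" "\<And>j i. supp_in S (q j i)" "\<And>j. q j (D j) \<noteq> 0"
    "\<And>j. (\<Sum>i\<le>D j. ev (q j i) * z j ^ i) \<in> P"
    by metis
  define h where "h = (\<Prod>j<n. q j (D j))"
  \<comment> \<open>Exponents below the degrees of the equations, in the variables outside
    \<open>S\<close>; for \<open>j\<close> in \<open>S\<close> the condition is just
    \<open>0 < D j\<close>.\<close>
  define E where "E = {e :: mon. keys e \<subseteq> {..<n} - S \<and> (\<forall>j. lookup e j < D j)}"
  have supp_prod: "supp_in S (\<Prod>j\<in>F. q j (D j))" for F
    by (induction F rule: infinite_finite_induct) (auto intro: Dq(2))
  have h: "supp_in S h" "h \<noteq> 0"
    using Dq(3) supp_prod by (auto simp: h_def)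
  have "E \<subseteq> {m. keys m \<subseteq> {..<n} \<and> (\<forall>i. lookup m i \<le> (\<Sum>j<n. D j))}"
  proof
    fix e assume e: "e \<in> E"
    have "lookup e i \<le> (\<Sum>j<n. D j)" for i
    proof (cases "i < n")
      case True
      have "lookup e i \<le> D i"
        using e by (auto simp: E_def intro: less_imp_le)
      also have "\<dots> \<le> (\<Sum>j<n. D j)"
        using True by (intro member_le_sum) auto
      finally show ?thesis .
    next
      case False
      then have "lookup e i = 0"
        using e by (intro lookup_eq_0[of _ "{..<n}"]) (auto simp: E_def)
      then show ?thesis by simp
    qed
    with e show "e \<in> {m. keys m \<subseteq> {..<n} \<and> (\<forall>i. lookup m i \<le> (\<Sum>j<n. D j))}"
      by (auto simp: E_def)
  qed
  then have finE: "finite E"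
    by (rule finite_subset) (rule finite_mons_le)
  \<comment> \<open>The module over the polynomials in \<open>S\<close> generated by
    \<open>E\<close> modulo \<open>P\<close>. It suffices that \<open>ev h * z j\<close> maps
    \<open>L\<close> into itself.\<close>
  define L where "L = {a. \<exists>r. (\<forall>e. supp_in S (r e)) \<and> a - (\<Sum>e\<in>E. ev (r e) * mon_eval z e) \<in> P}"
  have L_P: "a \<in> L" if "a \<in> P" for a
    unfolding L_def mem_Collect_eq using that by (intro exI[of _ "\<lambda>_. 0"]) auto
  have L_add: "a + b \<in> L" if ab: "a \<in> L" "b \<in> L" for a b
  proof -
    obtain r s where r: "\<And>e. supp_in S (r e)" "a - (\<Sum>e\<in>E. ev (r e) * mon_eval z e) \<in> P"
      and s: "\<And>e. supp_in S (s e)" "b - (\<Sum>e\<in>E. ev (s e) * mon_eval z e) \<in> P"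
      using ab unfolding L_def by blast
    have "(a + b) - (\<Sum>e\<in>E. ev (r e + s e) * mon_eval z e)
        = (a - (\<Sum>e\<in>E. ev (r e) * mon_eval z e)) + (b - (\<Sum>e\<in>E. ev (s e) * mon_eval z e))"
      by (simp add: poly_eval_add distrib_right sum.distrib)
    also have "\<dots> \<in> P"
      by (rule ideal_add[OF P r(2) s(2)])
    finally show ?thesis
      unfolding L_def mem_Collect_eq using r s by (intro exI[of _ "\<lambda>e. r e + s e"]) auto
  qed
  have L_scale: "ev p * a \<in> L" if p: "supp_in S p" "a \<in> L" for p a
  proof -
    obtain r where r: "\<And>e. supp_in S (r e)" "a - (\<Sum>e\<in>E. ev (r e) * mon_eval z e) \<in> P"
      using p(2) unfolding L_def by blast
    have "ev p * a - (\<Sum>e\<in>E. ev (p * r e) * mon_eval z e) = ev p * (a - (\<Sum>e\<in>E. ev (r e) * mon_eval z e))"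
      by (simp add: poly_eval_mult right_diff_distrib sum_distrib_left mult.assoc)
    also have "\<dots> \<in> P"
      by (rule ideal_mult[OF P r(2)])
    finally show ?thesis
      unfolding L_def mem_Collect_eq using r p by (intro exI[of _ "\<lambda>e. p * r e"]) auto
  qed
  have L_sum: "sum g I \<in> L" if "\<And>i. i \<in> I \<Longrightarrow> g i \<in> L" for g :: "'i \<Rightarrow> 'r" and I
    using that by (induction I rule: infinite_finite_induct) (auto intro: L_add L_P ideal_0[OF P])
  have L_E: "mon_eval z e \<in> L" if e: "e \<in> E" for e
  proof -
    have "(\<Sum>f\<in>E. ev (if f = e then 1 else 0) * mon_eval z f) = (\<Sum>f\<in>E. if f = e then mon_eval z f else 0)"
      by (intro sum.cong) auto
    also have "\<dots> = mon_eval z e"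
      using e finE by simp
    finally show ?thesis
      unfolding L_def mem_Collect_eq using ideal_0[OF P]
      by (intro exI[of _ "\<lambda>f. if f = e then 1 else 0"]) auto
  qed
  have L_mult_E: "ev h * (z j * mon_eval z e) \<in> L" if j: "j < n" and e: "e \<in> E" for j e
  proof (cases "j \<in> S")
    case True
    have "ev (h * single (var_mon j) 1) * mon_eval z e \<in> L"
      using True h e by (intro L_scale L_E supp_in_mult supp_in_single) auto
    then show ?thesis
      by (simp add: poly_eval_mult mult.assoc)
  next
    case False
    show ?thesis
    proof (cases "Suc (lookup e j) < D j")
      case True
      have "e + var_mon j \<in> E"
        using e True False j by (auto simp: E_def keys_add_mon lookup_add lookup_single when_def)
      then show ?thesis
        unfolding ev_var_mult using h by (intro L_scale L_E)
    next
      \<comment> \<open>Here multiplication by \<open>z j\<close> reaches the power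
        \<open>D j\<close>, which the equation of \<open>z j\<close> rewrites; \<open>?h'\<close>
        completes its leading coefficient to \<open>h\<close>.\<close>
      case lt: False
      then have D: "D j = Suc (lookup e j)"
        using e by (auto simp: E_def intro!: antisym Suc_leI simp: not_less)
      define e' where "e' = drop_var j e"
      have e'_E: "e' + single j i \<in> E" if "i < D j" for i
        using e that False j Dq(1)
        by (auto simp: E_def e'_def keys_add_mon keys_drop_var lookup_add lookup_single when_def
            lookup_drop_var)
      have "mon_eval z e = mon_eval z e' * z j ^ lookup e j"
        using mon_eval_add[of z e' "single j (lookup e j)"]
        by (simp add: e'_def drop_var_add)
      then have ze: "z j * mon_eval z e = mon_eval z e' * z j ^ D j"
        by (simp add: D mult_ac)
      let ?h' = "\<Prod>i\<in>{..<n} - {j}. q i (D i)"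
      have h': "h = ?h' * q j (D j)"
        using j by (simp add: h_def prod.remove mult.commute)
      have "(\<Sum>i\<le>D j. ev (q j i) * z j ^ i) = ev (q j (D j)) * z j ^ D j + (\<Sum>i<D j. ev (q j i) * z j ^ i)"
        by (simp add: lessThan_Suc_atMost[symmetric] add.commute)
      with Dq(4)[of j] have "ev ?h' * mon_eval z e' * (ev (q j (D j)) * z j ^ D j + (\<Sum>i<D j. ev (q j i) * z j ^ i)) \<in> P"
        by (intro ideal_mult[OF P]) simp
      then have 1: "ev ?h' * mon_eval z e' * (ev (q j (D j)) * z j ^ D j + (\<Sum>i<D j. ev (q j i) * z j ^ i)) \<in> L"
        by (rule L_P)
      have 2: "(\<Sum>i<D j. ev (- (?h' * q j i)) * mon_eval z (e' + single j i)) \<in> L"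
        using supp_prod Dq(2) e'_E by (intro L_sum L_scale L_E supp_in_uminus supp_in_mult) auto
      have "ev h * (z j * mon_eval z e) = ev ?h' * mon_eval z e' * (ev (q j (D j)) * z j ^ D j + (\<Sum>i<D j. ev (q j i) * z j ^ i))
          + (\<Sum>i<D j. ev (- (?h' * q j i)) * mon_eval z (e' + single j i))"
        unfolding ze h'
        by (simp add: poly_eval_mult poly_eval_uminus mon_eval_add sum_negf distrib_left sum_distrib_left mult_ac)
      also have "\<dots> \<in> L"
        by (rule L_add[OF 1 2])
      finally show ?thesis .
    qed
  qed
  have L_mult: "ev h * (z j * a) \<in> L" if j: "j < n" and a: "a \<in> L" for j a
  proof -
    obtain r where r: "\<And>e. supp_in S (r e)" "a - (\<Sum>e\<in>E. ev (r e) * mon_eval z e) \<in> P"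
      using a unfolding L_def by blast
    have "ev h * (z j * a) = ev h * z j * (a - (\<Sum>e\<in>E. ev (r e) * mon_eval z e))
        + (\<Sum>e\<in>E. ev (r e) * (ev h * (z j * mon_eval z e)))"
      by (simp add: algebra_simps sum_distrib_left)
    also have "\<dots> \<in> L"
      using r j by (intro L_add L_P[OF ideal_mult[OF P]] L_sum L_scale L_mult_E) auto
    finally show ?thesis .
  qed
  have E0: "0 \<in> E"
    using Dq(1) by (auto simp: E_def)
  have mon: "\<exists>N. ev (h ^ N) * mon_eval z m \<in> L" if "keys m \<subseteq> {..<n}" for m
    using that
  proof (induction m rule: mon_induct)
    case zero
    then show ?case
      using L_E[OF E0] by (intro exI[of _ 0]) simp
  next
    case (var m j)
    then obtain N where "ev (h ^ N) * mon_eval z m \<in> L" "j < n"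
      by (auto simp: keys_add_mon)
    then have "ev h * (z j * (ev (h ^ N) * mon_eval z m)) \<in> L"
      by (intro L_mult)
    then show ?case
      by (intro exI[of _ "Suc N"]) (simp add: poly_eval_mult mon_eval_add mult_ac)
  qed
  have all: "\<exists>N. ev (h ^ N) * ev p \<in> L" if "supp_in {..<n} p" for p
    using that
  proof (induction rule: supp_in_induct)
    case zero
    then show ?case
      using L_P[OF ideal_0[OF P]] by simp
  next
    case (single m c)
    then obtain N where "ev (h ^ N) * mon_eval z m \<in> L"
      using mon by blast
    then have "ev (single 0 c) * (ev (h ^ N) * mon_eval z m) \<in> L"
      using L_scale[OF supp_in_single[of 0 S c]] by (simp only: keys_zero empty_subsetI)
    then show ?case
      by (intro exI[of _ N]) (simp add: poly_eval_single mult_ac)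
  next
    case (add p p')
    then obtain N N' where N: "ev (h ^ N) * ev p \<in> L" "ev (h ^ N') * ev p' \<in> L" by auto
    have "ev (h ^ N') * (ev (h ^ N) * ev p) + ev (h ^ N) * (ev (h ^ N') * ev p') \<in> L"
      by (intro L_add L_scale[OF supp_in_power[OF h(1)] N(1)] L_scale[OF supp_in_power[OF h(1)] N(2)])
    then show ?case
      by (intro exI[of _ "N + N'"]) (simp add: poly_eval_add poly_eval_mult power_add algebra_simps)
  qed
  have "\<exists>N r. (\<forall>e. supp_in S (r e)) \<and> ev (h ^ N) * a - (\<Sum>e\<in>E. ev (r e) * mon_eval z e) \<in> P" for a
    using generated[of a] all unfolding L_def by blast
  then show ?thesis
    using that[OF finE E0 h] by blast
qed

text \<open>The prime is found above \<open>P + (z s - c)\<close> for a suitable scalar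
  \<open>c\<close>. If no such prime had the required properties, some polynomial in
  \<open>S\<close> not killed by \<open>X_s = c\<close> would be a multiple of
  \<open>z s - c\<close> modulo \<open>P\<close>. By \<open>generic_finiteness\<close> and Nakayama
  over the polynomials in \<open>S\<close>, localised at \<open>X_s - c\<close>, another such
  polynomial would lie in \<open>P\<close>, against the independence of \<open>S\<close>.\<close>

lemma ex_smaller_prime_quotient:
  assumes P: "prime_ideal_of P" and d: "max_indep P d" and S: "S \<subseteq> {..<n}" "card S = d" "indep_mod P z S"
    and s: "s \<in> S" and f: "f \<notin> P"
  obtains Q where "prime_ideal_of Q" "P \<subset> Q" "f \<notin> Q" "indep_mod Q z (S - {s})"
proof -
  note PI = prime_ideal_ideal[OF P]
  obtain E h where E: "finite E" "0 \<in> E" and h: "supp_in S h" "h \<noteq> 0" and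
    fin: "\<And>a. \<exists>N r. (\<forall>e. supp_in S (r e)) \<and> ev (h ^ N) * a - (\<Sum>e\<in>E. ev (r e) * mon_eval z e) \<in> P"
    by (rule generic_finiteness[OF PI d S]) (rule that)
  obtain g r0 where r0: "supp_in S r0" "r0 \<noteq> 0" "f * g - ev r0 \<in> P"
    by (rule algebraic_unit[OF P d S(1,2) f]) (rule that)
  \<comment> \<open>Both denominators must survive the specialisation: \<open>h\<close> from
    \<open>generic_finiteness\<close> and \<open>r0\<close>, a multiple of \<open>f\<close> modulo
    \<open>P\<close>.\<close>
  obtain c where c: "subst_var s c (h * r0) \<noteq> 0"
    using ex_subst_var_nonzero[of "h * r0" s] h r0 by auto
  let ?X = "single (var_mon s) 1 - single 0 c :: 'k mp"
  define \<pi> where "\<pi> = z s - \<phi> c"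
  have ev_X: "ev ?X = \<pi>"
    by (simp add: poly_eval_diff \<pi>_def)
  have supp_X: "supp_in S ?X"
    using s by (intro supp_in_diff supp_in_single) auto
  \<comment> \<open>Avoiding this one set says both that \<open>f\<close> is missed and that the
    coordinates in \<open>S - {s}\<close> stay independent.\<close>
  define M where "M = {ev \<tau> * f ^ e | \<tau> e. supp_in (S - {s}) \<tau> \<and> \<tau> \<noteq> 0}"
  have "adjoin P \<pi> \<inter> M = {}"
  proof (rule ccontr)
    assume "adjoin P \<pi> \<inter> M \<noteq> {}"
    then obtain \<tau> e u where \<tau>: "supp_in (S - {s}) \<tau>" "\<tau> \<noteq> 0" "ev \<tau> * f ^ e - \<pi> * u \<in> P"
      by (auto simp: M_def adjoin_def)
    \<comment> \<open>Multiplication by \<open>g ^ e\<close> trades \<open>f ^ e\<close> for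
      \<open>r0 ^ e\<close>, so that only a polynomial in \<open>S\<close> remains on the
      left.\<close>
    define w0 where "w0 = \<tau> * r0 ^ e"
    define v where "v = u * g ^ e"
    have w0: "supp_in S w0" "subst_var s c w0 \<noteq> 0"
    proof -
      show "supp_in S w0"
        using supp_in_mono[OF \<tau>(1), of S] r0 by (auto simp: w0_def intro!: supp_in_mult supp_in_power)
      show "subst_var s c w0 \<noteq> 0"
        using \<tau> c subst_var_eq[OF \<tau>(1), of s c] by (simp add: w0_def subst_var_mult subst_var_power)
    qed
    have w0_v: "ev w0 - \<pi> * v \<in> P"
    proof -
      have "ev (r0 ^ e) - (f * g) ^ e \<in> P" for e
      proof (induction e)
        case (Suc e)
        have "ev (r0 ^ Suc e) - (f * g) ^ Suc e = ev r0 * (ev (r0 ^ e) - (f * g) ^ e) - (f * g) ^ e * (f * g - ev r0)"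
          by (simp add: poly_eval_mult algebra_simps)
        also have "\<dots> \<in> P"
          by (intro ideal_diff ideal_mult PI Suc r0)
        finally show ?case .
      qed (simp add: ideal_0[OF PI])
      then have "ev \<tau> * (ev (r0 ^ e) - (f * g) ^ e) + g ^ e * (ev \<tau> * f ^ e - \<pi> * u) \<in> P"
        by (intro ideal_add ideal_mult PI \<tau>)
      also have "ev \<tau> * (ev (r0 ^ e) - (f * g) ^ e) + g ^ e * (ev \<tau> * f ^ e - \<pi> * u) = ev w0 - \<pi> * v"
        by (simp add: w0_def v_def poly_eval_mult power_mult_distrib algebra_simps)
      finally show ?thesis .
    qed
    \<comment> \<open>\<open>?W\<close> plays the units of the localisation at the prime
      \<open>X_s - c\<close>, and \<open>?m\<close> the multiples of \<open>X_s - c\<close>.\<close>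
    let ?R = "{ev p | p. supp_in S p}"
    let ?W = "{ev p | p. supp_in S p \<and> subst_var s c p \<noteq> 0}"
    let ?m = "{\<pi> * ev p | p. supp_in S p}"
    have "\<forall>e\<in>E. \<exists>w\<in>?W. w * mon_eval z e \<in> P"
    proof (rule nakayama_elimination[where R = ?R and \<mm> = ?m, OF E(1)])
      show "r * s \<in> ?R" if "r \<in> ?R" "s \<in> ?R" for r s
        using that by (auto simp flip: poly_eval_mult)
      show "?m \<subseteq> ?R"
        using supp_X by (auto simp flip: ev_X poly_eval_mult)
      show "r * a \<in> ?m" if ra: "r \<in> ?R" "a \<in> ?m" for r a
      proof -
        obtain p p' where "r = ev p" "a = \<pi> * ev p'" "supp_in S p" "supp_in S p'"
          using ra by auto
        then show ?thesis
          by (auto intro!: exI[of _ "p * p'"] simp: poly_eval_mult mult_ac)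
      qed
      show "a + b \<in> ?m" if ab: "a \<in> ?m" "b \<in> ?m" for a b
      proof -
        obtain p p' where "a = \<pi> * ev p" "b = \<pi> * ev p'" "supp_in S p" "supp_in S p'"
          using ab by auto
        then show ?thesis
          by (auto intro!: exI[of _ "p + p'"] simp: poly_eval_add distrib_left)
      qed
      show "?W \<subseteq> ?R" by auto
      show "1 \<in> ?W"
        by (auto intro!: exI[of _ 1])
      show "v * w \<in> ?W" if vw: "v \<in> ?W" "w \<in> ?W" for v w
      proof -
        obtain p p' where "v = ev p" "w = ev p'" "supp_in S p" "supp_in S p'"
          "subst_var s c p \<noteq> 0" "subst_var s c p' \<noteq> 0"
          using vw by auto
        then show ?thesis
          by (auto intro!: exI[of _ "p * p'"] simp: poly_eval_mult subst_var_mult)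
      qed
      show "w - a \<in> ?W" if wa: "w \<in> ?W" "a \<in> ?m" for w a
      proof -
        obtain p p' where p: "w = ev p" "a = \<pi> * ev p'" "supp_in S p" "supp_in S p'" "subst_var s c p \<noteq> 0"
          using wa by auto
        have "w - a = ev (p - ?X * p')"
          by (simp add: p poly_eval_diff[of _ p] poly_eval_mult ev_X)
        moreover have "supp_in S (p - ?X * p')"
          using p supp_X by (intro supp_in_diff[of S p] supp_in_mult)
        moreover have "subst_var s c (p - ?X * p') \<noteq> 0"
          using p by (simp add: subst_var_diff subst_var_mult)
        ultimately show ?thesis by blast
      qed
      show "r * y \<in> P" if "y \<in> P" for r y
        by (rule ideal_mult[OF PI that])
      show "x + y \<in> P" if "x \<in> P" "y \<in> P" for x y
        by (rule ideal_add[OF PI that])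
      fix e assume e: "e \<in> E"
      obtain N r where r: "\<And>e. supp_in S (r e)"
        "ev (h ^ N) * (v * mon_eval z e) - (\<Sum>e\<in>E. ev (r e) * mon_eval z e) \<in> P"
        using fin[of "v * mon_eval z e"] by blast
      \<comment> \<open>Modulo \<open>P\<close>, \<open>w0\<close> acts as \<open>\<pi> * v\<close>,
        and \<open>h ^ N\<close> brings \<open>v * z^e\<close> back into the span of
        \<open>E\<close>. So a unit times \<open>z^e\<close> is a combination of \<open>E\<close>
        with coefficients in \<open>?m\<close>.\<close>
      have "ev (h ^ N) * mon_eval z e * (ev w0 - \<pi> * v)
          + \<pi> * (ev (h ^ N) * (v * mon_eval z e) - (\<Sum>e\<in>E. ev (r e) * mon_eval z e)) \<in> P"
        by (intro ideal_add ideal_mult PI w0_v r)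
      also have "ev (h ^ N) * mon_eval z e * (ev w0 - \<pi> * v)
          + \<pi> * (ev (h ^ N) * (v * mon_eval z e) - (\<Sum>e\<in>E. ev (r e) * mon_eval z e))
          = ev (h ^ N * w0) * mon_eval z e - (\<Sum>f\<in>E. \<pi> * ev (r f) * mon_eval z f)"
        by (simp add: poly_eval_mult algebra_simps sum_distrib_left)
      finally have "ev (h ^ N * w0) * mon_eval z e - (\<Sum>f\<in>E. \<pi> * ev (r f) * mon_eval z f) \<in> P" .
      moreover have "ev (h ^ N * w0) \<in> ?W"
        using h w0 c by (auto intro!: exI[of _ "h ^ N * w0"] simp: subst_var_mult subst_var_power)
      moreover have "\<forall>f\<in>E. \<pi> * ev (r f) \<in> ?m"
        using r by auto
      ultimately show "\<exists>w\<in>?W. \<exists>a. (\<forall>f\<in>E. a f \<in> ?m) \<and> w * mon_eval z e - (\<Sum>f\<in>E. a f * mon_eval z f) \<in> P"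
        by (intro bexI[of _ "ev (h ^ N * w0)"] exI[of _ "\<lambda>f. \<pi> * ev (r f)"]) auto
    qed
    \<comment> \<open>Taken at the exponent \<open>0\<close>, whose monomial is \<open>1\<close>:
      the unit itself lies in \<open>P\<close>.\<close>
    then obtain p where "supp_in S p" "subst_var s c p \<noteq> 0" "ev p \<in> P"
      using E(2) by fastforce
    then show False
      using S(3) by (auto simp: indep_mod_def)
  qed
  moreover have "1 \<in> M"
    unfolding M_def mem_Collect_eq by (rule exI[of _ 1], rule exI[of _ 0]) simp
  moreover have "a * b \<in> M" if ab: "a \<in> M" "b \<in> M" for a b
  proof -
    obtain \<tau> e \<tau>' e' where *: "a = ev \<tau> * f ^ e" "b = ev \<tau>' * f ^ e'" "supp_in (S - {s}) \<tau>"
      "supp_in (S - {s}) \<tau>'" "\<tau> \<noteq> 0" "\<tau>' \<noteq> 0"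
      using ab by (auto simp: M_def)
    then have "a * b = ev (\<tau> * \<tau>') * f ^ (e + e')" "supp_in (S - {s}) (\<tau> * \<tau>')" "\<tau> * \<tau>' \<noteq> 0"
      by (auto simp: poly_eval_mult power_add mult_ac)
    then show ?thesis
      unfolding M_def by blast
  qed
  ultimately obtain Q where Q: "prime_ideal_of Q" "adjoin P \<pi> \<subseteq> Q" "Q \<inter> M = {}"
    using ex_prime_ideal_avoiding[of "adjoin P \<pi>" M] ideal_adjoin(1)[OF PI] by metis
  show ?thesis
  proof (rule that[OF Q(1)])
    have "\<pi> \<notin> P"
    proof
      assume "\<pi> \<in> P"
      then have "?X = 0"
        using S(3) supp_X by (auto simp: indep_mod_def simp flip: ev_X)
      then have "lookup ?X (var_mon s) = 0" by (simp only: lookup_zero)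
      then show False
        by (simp add: lookup_minus lookup_single when_def)
    qed
    then show "P \<subset> Q"
      using ideal_adjoin(2,3)[OF PI, of \<pi>] Q(2) by blast
    have "ev 1 * f ^ 1 \<in> M"
      unfolding M_def mem_Collect_eq by (rule exI[of _ 1], rule exI[of _ 1]) simp
    then show "f \<notin> Q"
      using Q(3) by auto
    show "indep_mod Q z (S - {s})"
      unfolding indep_mod_def
    proof (intro allI impI)
      fix p assume p: "supp_in (S - {s}) p" "ev p \<in> Q"
      show "p = 0"
      proof (rule ccontr)
        assume "p \<noteq> 0"
        then have "ev p * f ^ 0 \<in> M"
          unfolding M_def using p by blast
        then show False
          using p Q(3) by auto
      qed
    qed
  qed
qed

text \<open>\<open>T\<close> has the largest cardinality and need not contain \<open>S\<close>,
  which avoids any exchange property of algebraic independence.\<close>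

lemma ex_max_indep:
  assumes "indep_mod P z S" "S \<subseteq> {..<n}"
  obtains T where "T \<subseteq> {..<n}" "indep_mod P z T" "card S \<le> card T" "max_indep P (card T)"
proof -
  let ?F = "{T. T \<subseteq> {..<n} \<and> indep_mod P z T}"
  have F: "finite ?F"
    by (rule finite_subset[of _ "Pow {..<n}"]) auto
  have "Max (card ` ?F) \<in> card ` ?F"
    using F assms by (intro Max_in) auto
  then obtain T where T: "T \<in> ?F" "card T = Max (card ` ?F)" by auto
  then have "card U \<le> card T" if "U \<in> ?F" for U
    using F that by simp
  with T assms show ?thesis
    by (intro that[of T]) (auto simp: max_indep_def)
qed

lemma indep_mod_empty:
  assumes "prime_ideal_of Q"
  shows "indep_mod Q z {}"
  unfolding indep_mod_def
proof (intro allI impI)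
  fix p assume p: "supp_in {} p" "ev p \<in> Q"
  have eq: "p = single 0 (lookup p 0)"
    using p(1) by (intro poly_mapping_eqI) (auto simp: supp_in_def lookup_single when_def in_keys_iff keys_eq_empty)
  then have "ev p = \<phi> (lookup p 0)"
    by (metis poly_eval_const)
  moreover have "lookup p 0 = 0" if "\<phi> (lookup p 0) \<in> Q"
  proof (rule ccontr)
    assume "lookup p 0 \<noteq> 0"
    then show False
      using ideal_mult[OF prime_ideal_ideal[OF assms] that, of "\<phi> (inverse (lookup p 0))"]
        prime_ideal_1[OF assms] phi_inverse by simp
  qed
  ultimately show "p = 0"
    using p eq by (metis single_zero)
qed

text \<open>Each step first passes to an independent set of maximal size and then loses a single
  coordinate to \<open>ex_smaller_prime_quotient\<close>, used with \<open>f = 1\<close>.\<close>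

lemma ex_prime_chain:
  assumes "prime_ideal_of P" "indep_mod P z S" "S \<subseteq> {..<n}" "d \<le> card S"
  shows "\<exists>Q. Q 0 = P \<and> (\<forall>j\<le>d. prime_ideal_of (Q j)) \<and> (\<forall>j<d. Q j \<subset> Q (Suc j))"
  using assms
proof (induction d arbitrary: P S)
  case 0
  then show ?case
    by (intro exI[of _ "\<lambda>_. P"]) auto
next
  case (Suc d)
  obtain T where T: "T \<subseteq> {..<n}" "indep_mod P z T" "card S \<le> card T" "max_indep P (card T)"
    using ex_max_indep Suc.prems by metis
  then obtain s where s: "s \<in> T"
    using Suc.prems(4) by fastforce
  obtain P' where P': "prime_ideal_of P'" "P \<subset> P'" "indep_mod P' z (T - {s})"
    using ex_smaller_prime_quotient[OF Suc.prems(1) T(4,1) refl T(2) s, of 1]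
      prime_ideal_1[OF Suc.prems(1)] by metis
  have "d \<le> card (T - {s})"
    using T Suc.prems s by (simp add: card_Diff_singleton)
  then obtain Q where Q: "Q 0 = P'" "\<forall>j\<le>d. prime_ideal_of (Q j)" "\<forall>j<d. Q j \<subset> Q (Suc j)"
    using Suc.IH[OF P'(1,3)] T(1) by blast
  show ?case
  proof (intro exI[of _ "\<lambda>j. if j = 0 then P else Q (j - 1)"] conjI allI impI)
    fix j
    show "prime_ideal_of (if j = 0 then P else Q (j - 1))" if "j \<le> Suc d"
      using that Q Suc.prems by auto
    show "(if j = 0 then P else Q (j - 1)) \<subset> (if Suc j = 0 then P else Q (Suc j - 1))" if "j < Suc d"
      using that Q P' by (cases j) auto
  qed simp
qed

end

section \<open>Points and the Nullstellensatz over an algebraically closed field\<close>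

locale fg_algebra_closed = fg_algebra \<phi> z n
  for \<phi> :: "'k::{alg_closed_field, field_char_0} \<Rightarrow> 'r::comm_ring_1" and z n
begin

text \<open>The polynomial splits into linear factors over \<open>k\<close>, and a prime containing
  their product at \<open>a\<close> contains one of them; the constant left over is a unit.\<close>

lemma algebraic_mod_prime_is_scalar:
  assumes P: "prime_ideal_of P"
    and "0 < D" "q D \<noteq> 0" "(\<Sum>i\<le>D. \<phi> (q i) * a ^ i) \<in> P"
  shows "\<exists>c. a - \<phi> c \<in> P"
proof -
  define pe where "pe p = (\<Sum>i\<le>degree p. \<phi> (coeff p i) * a ^ i)" for p
  have pe: "pe p = (\<Sum>i\<le>N. \<phi> (coeff p i) * a ^ i)" if "degree p \<le> N" for p N
    unfolding pe_def using that by (intro sum.mono_neutral_left) (auto simp: coeff_eq_0)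
  have "\<exists>c. a - \<phi> c \<in> P" if "p \<noteq> 0" "pe p \<in> P" for p
    using that
  proof (induction "degree p" arbitrary: p)
    case 0
    then obtain c where c: "p = [:c:]" "c \<noteq> 0"
      by (metis degree_eq_zeroE pCons_0_0)
    then have "\<phi> (inverse c) * pe p \<in> P"
      using 0 by (intro ideal_mult[OF prime_ideal_ideal[OF P]])
    then show ?case
      using c phi_inverse prime_ideal_1[OF P] by (simp add: pe_def)
  next
    case (Suc N)
    then obtain c where "poly p c = 0"
      using alg_closed_imp_poly_has_root[of p] by auto
    then obtain p' where p': "p = [:- c, 1:] * p'"
      by (auto simp: poly_eq_0_iff_dvd dvd_def)
    have ne: "p' \<noteq> 0"
      using Suc.prems p' by auto
    have deg: "degree p' = N"
      using Suc.hyps(2) ne unfolding p' by (subst (asm) degree_mult_eq) auto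
    have co: "coeff p i = (if i = 0 then 0 else coeff p' (i - 1)) - c * coeff p' i" for i
      unfolding p' by (cases i) (auto simp: mult_pCons_left)
    have "pe p = (\<Sum>i\<le>Suc N. \<phi> (coeff p i) * a ^ i)"
      using Suc.hyps(2) by (simp add: pe_def)
    also have "\<dots> = (\<Sum>i\<le>Suc N. \<phi> (if i = 0 then 0 else coeff p' (i - 1)) * a ^ i)
        - (\<Sum>i\<le>Suc N. \<phi> (c * coeff p' i) * a ^ i)"
      by (simp only: co phi_diff left_diff_distrib sum_subtractf)
    also have "(\<Sum>i\<le>Suc N. \<phi> (if i = 0 then 0 else coeff p' (i - 1)) * a ^ i) = a * pe p'"
      unfolding sum.atMost_Suc_shift by (simp add: pe[of p' N] deg sum_distrib_left mult_ac)
    also have "(\<Sum>i\<le>Suc N. \<phi> (c * coeff p' i) * a ^ i) = \<phi> c * pe p'"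
      unfolding pe[of p' "Suc N", OF deg[THEN eq_imp_le, THEN le_SucI]]
      by (simp only: phi_mult sum_distrib_left mult.assoc)
    finally have "pe p = (a - \<phi> c) * pe p'"
      by (simp only: left_diff_distrib)
    then have "a - \<phi> c \<in> P \<or> pe p' \<in> P"
      using Suc.prems prime_ideal_mult[OF P] by simp
    then show ?case
      using Suc.hyps(1)[of p'] deg ne by auto
  qed
  moreover define p where "p = (\<Sum>i\<le>D. monom (q i) i)"
  have co: "coeff p i = (if i \<le> D then q i else 0)" for i
    by (simp add: p_def coeff_sum)
  then have "p \<noteq> 0"
    using assms(3) by (metis coeff_0 order_refl)
  moreover have "degree p \<le> D"
    using co by (intro degree_le) auto
  then have "pe p = (\<Sum>i\<le>D. \<phi> (q i) * a ^ i)"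
    by (subst pe) (auto simp: co)
  ultimately show ?thesis
    using assms(4) by simp
qed

lemma point_of_prime:
  assumes P: "prime_ideal_of P" and sc: "\<And>j. j < n \<Longrightarrow> \<exists>c. z j - \<phi> c \<in> P"
  obtains x where "x \<in> points \<phi>" "\<And>a. x a = 0 \<longleftrightarrow> a \<in> P"
proof -
  note PI = prime_ideal_ideal[OF P]
  have phi_P: "c = 0" if "\<phi> c \<in> P" for c
  proof (rule ccontr)
    assume "c \<noteq> 0"
    then show False
      using ideal_mult[OF PI that, of "\<phi> (inverse c)"] prime_ideal_1[OF P] phi_inverse by simp
  qed
  have mult: "\<exists>c. a * b - \<phi> c \<in> P" if ab: "\<exists>c. a - \<phi> c \<in> P" "\<exists>c. b - \<phi> c \<in> P" for a b
  proof -
    obtain c c' where c: "a - \<phi> c \<in> P" "b - \<phi> c' \<in> P"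
      using ab by auto
    have "a * b - \<phi> (c * c') = b * (a - \<phi> c) + \<phi> c * (b - \<phi> c')"
      by (simp add: phi_mult algebra_simps)
    also have "\<dots> \<in> P"
      using c by (intro ideal_add ideal_mult PI)
    finally show ?thesis by blast
  qed
  have scal: "\<exists>c'. \<phi> c - \<phi> c' \<in> P" for c
    using ideal_0[OF PI] by (intro exI[of _ c]) simp
  have mon: "\<exists>c. mon_eval z m - \<phi> c \<in> P" if "keys m \<subseteq> {..<n}" for m
    using that
  proof (induction m rule: mon_induct)
    case zero
    then show ?case using scal[of 1] by simp
  next
    case (var m i)
    then show ?case
      using mult[OF _ sc[of i]] by (auto simp: mon_eval_add keys_add_mon)
  qed
  have "\<exists>c. ev p - \<phi> c \<in> P" if "supp_in {..<n} p" for p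
    using that
  proof (induction rule: supp_in_induct)
    case zero
    then show ?case using scal[of 0] by simp
  next
    case (single m c)
    then show ?case
      using mult[OF scal mon] by (simp add: poly_eval_single)
  next
    case (add p q)
    then obtain c c' where c: "ev p - \<phi> c \<in> P" "ev q - \<phi> c' \<in> P" by auto
    have "ev (p + q) - \<phi> (c + c') = (ev p - \<phi> c) + (ev q - \<phi> c')"
      by (simp add: poly_eval_add phi_add)
    then show ?case
      using ideal_add[OF PI c] by metis
  qed
  then have ex: "\<exists>c. a - \<phi> c \<in> P" for a
    using generated[of a] by blast
  define x where "x a = (SOME c. a - \<phi> c \<in> P)" for a
  have x: "a - \<phi> (x a) \<in> P" for a
    unfolding x_def by (rule someI_ex[OF ex])
  have x_eq: "x a = c" if "a - \<phi> c \<in> P" for a c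
  proof -
    have "\<phi> (x a - c) \<in> P"
      using ideal_diff[OF PI that x[of a]] by (simp add: phi_diff)
    from phi_P[OF this] show ?thesis
      by simp
  qed
  show ?thesis
  proof (rule that)
    show "x \<in> points \<phi>"
      unfolding points_def mem_Collect_eq
    proof (intro conjI allI)
      fix a b
      have "(a + b) - \<phi> (x a + x b) = (a - \<phi> (x a)) + (b - \<phi> (x b))"
        by (simp add: phi_add)
      also have "\<dots> \<in> P"
        by (intro ideal_add PI x)
      finally show "x (a + b) = x a + x b"
        by (rule x_eq)
      have "a * b - \<phi> (x a * x b) = b * (a - \<phi> (x a)) + \<phi> (x a) * (b - \<phi> (x b))"
        by (simp add: phi_mult algebra_simps)
      also have "\<dots> \<in> P"
        by (intro ideal_add ideal_mult PI x)
      finally show "x (a * b) = x a * x b"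
        by (rule x_eq)
    next
      fix c show "x (\<phi> c) = c"
        by (rule x_eq) (simp add: ideal_0[OF PI])
    qed
    fix a
    show "x a = 0 \<longleftrightarrow> a \<in> P"
      using x[of a] x_eq[of a 0] by auto
  qed
qed

text \<open>Let \<open>Q\<close> be maximal among the ideals above \<open>P\<close> that miss all
  powers of \<open>f\<close>. A coordinate transcendental modulo \<open>Q\<close> would let
  \<open>ex_smaller_prime_quotient\<close> enlarge \<open>Q\<close> while still missing
  \<open>f\<close>. So all coordinates are algebraic, hence scalars, and \<open>Q\<close> is the
  kernel of a point.\<close>

theorem nullstellensatz:
  assumes P: "prime_ideal_of P" and f: "f \<notin> P"
  obtains x where "x \<in> points \<phi>" "\<And>a. a \<in> P \<Longrightarrow> x a = 0" "x f \<noteq> 0"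
proof -
  let ?M = "{f ^ e | e. True}"
  have "1 \<in> ?M"
    by (auto intro!: exI[of _ 0])
  moreover have "a * b \<in> ?M" if "a \<in> ?M" "b \<in> ?M" for a b
    using that by (auto simp flip: power_add)
  moreover have "P \<inter> ?M = {}"
    using prime_ideal_power[OF P] f by auto
  ultimately obtain Q where Q: "prime_ideal_of Q" "P \<subseteq> Q" "Q \<inter> ?M = {}"
    and max: "\<And>J. ideal_of J \<Longrightarrow> Q \<subset> J \<Longrightarrow> J \<inter> ?M \<noteq> {}"
    by (rule ex_prime_ideal_avoiding[OF prime_ideal_ideal[OF P], of ?M]) (assumption | rule that)+
  have fQ: "f \<notin> Q"
    using Q(3) by (auto intro!: exI[of _ 1] simp: disjoint_iff) (metis power_one_right)
  obtain T where T: "T \<subseteq> {..<n}" "indep_mod Q z T" "max_indep Q (card T)"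
    using ex_max_indep[OF indep_mod_empty[OF Q(1)]] by auto
  have "T = {}"
  proof (rule ccontr)
    assume "T \<noteq> {}"
    then obtain s where "s \<in> T" by auto
    then obtain Q' where Q': "prime_ideal_of Q'" "Q \<subset> Q'" "f \<notin> Q'"
      using ex_smaller_prime_quotient[OF Q(1) T(3,1) refl T(2) _ fQ] by metis
    then have "Q' \<inter> ?M \<noteq> {}"
      using max prime_ideal_ideal by blast
    then show False
      using Q' prime_ideal_power by auto
  qed
  have "\<exists>c. z j - \<phi> c \<in> Q" for j
  proof -
    obtain D q where q: "0 < D" "\<And>i. supp_in {} (q i)" "q D \<noteq> 0" "(\<Sum>i\<le>D. ev (q i) * z j ^ i) \<in> Q"
      using algebraic_equation[OF prime_ideal_ideal[OF Q(1)] T(3,1) refl T(2), of "z j"] \<open>T = {}\<close>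
      by metis
    have eq: "q i = single 0 (lookup (q i) 0)" for i
      using q(2)[of i] by (intro poly_mapping_eqI) (auto simp: supp_in_def lookup_single when_def in_keys_iff keys_eq_empty)
    have "ev (q i) = \<phi> (lookup (q i) 0)" for i
      by (metis eq poly_eval_const)
    moreover have "lookup (q D) 0 \<noteq> 0"
      using q(3) eq[of D] by (metis single_zero)
    ultimately show ?thesis
      using q algebraic_mod_prime_is_scalar[OF Q(1) q(1), of "\<lambda>i. lookup (q i) 0" "z j"] by simp
  qed
  then obtain x where x: "x \<in> points \<phi>" "\<And>a. x a = 0 \<longleftrightarrow> a \<in> Q"
    using point_of_prime[OF Q(1)] by metis
  then show ?thesis
    using that[OF x(1)] Q(2) fQ by auto
qed

end

section \<open>Vector fields, their rank and their symbols\<close>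

lemma (in kalgebra) span_mult_closed:
  assumes "y \<in> vs.span A" "\<And>g. g \<in> A \<Longrightarrow> t * g \<in> vs.span B"
  shows "t * y \<in> vs.span B"
  using assms(1)
proof (induction y rule: vs.span_induct_alt)
  case base
  then show ?case by (simp add: vs.span_zero)
next
  case (step c a y)
  have "\<phi> c * (t * a) + t * y \<in> vs.span B"
    using step assms(2) by (intro vs.span_add vs.span_scale)
  then show ?case
    by (simp add: distrib_left mult.left_commute)
qed

context fg_algebra
begin

lemma ex_deg_le_finite: "finite F \<Longrightarrow> \<exists>D. F \<subseteq> deg_le D"
proof (induction F rule: finite_induct)
  case (insert a F)
  then obtain D E where "F \<subseteq> deg_le D" "a \<in> deg_le E"
    using ex_deg_le by blast
  then have "insert a F \<subseteq> deg_le (max D E)"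
    using deg_le_mono[of D "max D E"] deg_le_mono[of E "max D E"] by auto
  then show ?case by blast
qed simp

end

section \<open>Zero sets of primes and their dimension\<close>

context fg_algebra_closed
begin

lemma zeroset_irreducible:
  assumes "prime_ideal_of Q"
  shows "zar_irreducible \<phi> (zeroset \<phi> Q)"
  unfolding zar_irreducible_def
proof (intro conjI allI impI)
  obtain x where "x \<in> points \<phi>" "\<And>a. a \<in> Q \<Longrightarrow> x a = 0" "x 1 \<noteq> 0"
    by (rule nullstellensatz[OF assms prime_ideal_1[OF assms]]) (rule that)
  then show "zeroset \<phi> Q \<noteq> {}"
    by (auto simp: zeroset_def)
  show "zeroset \<phi> Q \<subseteq> points \<phi>"
    by (auto simp: zeroset_def)
  fix T1 T2 assume *: "zeroset \<phi> Q \<subseteq> zeroset \<phi> T1 \<union> zeroset \<phi> T2"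
  show "zeroset \<phi> Q \<subseteq> zeroset \<phi> T1 \<or> zeroset \<phi> Q \<subseteq> zeroset \<phi> T2"
  proof (rule ccontr)
    assume "\<not> ?thesis"
    then obtain x1 x2 f1 f2 where f: "x1 \<in> zeroset \<phi> Q" "f1 \<in> T1" "x1 f1 \<noteq> 0"
      "x2 \<in> zeroset \<phi> Q" "f2 \<in> T2" "x2 f2 \<noteq> 0"
      by (auto simp: zeroset_def)
    then have "f1 \<notin> Q" "f2 \<notin> Q"
      by (auto simp: zeroset_def)
    then have "f1 * f2 \<notin> Q"
      using prime_ideal_mult[OF assms] by auto
    then obtain x where x: "x \<in> points \<phi>" "\<And>a. a \<in> Q \<Longrightarrow> x a = 0" "x (f1 * f2) \<noteq> 0"
      by (rule nullstellensatz[OF assms]) (rule that)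
    then have "x f1 \<noteq> 0" "x f2 \<noteq> 0" "x \<in> zeroset \<phi> Q"
      by (auto simp: points_def zeroset_def)
    then show False
      using * f by (auto simp: zeroset_def)
  qed
qed

lemma zeroset_strict_antimono:
  assumes "prime_ideal_of P" "P \<subset> Q"
  shows "zeroset \<phi> Q \<subset> zeroset \<phi> P"
proof -
  obtain f where f: "f \<in> Q" "f \<notin> P"
    using assms(2) by auto
  obtain x where "x \<in> points \<phi>" "\<And>a. a \<in> P \<Longrightarrow> x a = 0" "x f \<noteq> 0"
    by (rule nullstellensatz[OF assms(1) f(2)]) (rule that)
  then have "x \<in> zeroset \<phi> P" "x \<notin> zeroset \<phi> Q"
    using f by (auto simp: zeroset_def)
  moreover have "zeroset \<phi> Q \<subseteq> zeroset \<phi> P"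
    using assms(2) by (auto simp: zeroset_def)
  ultimately show ?thesis by blast
qed

lemma indep_le_zar_dim:
  assumes P: "prime_ideal_of P" and T: "T \<subseteq> {..<n}" "indep_mod P z T"
    and S: "zeroset \<phi> P \<subseteq> S" "zar_dim_le \<phi> S i"
  shows "card T \<le> i"
proof -
  let ?d = "card T"
  obtain Q where Q: "Q 0 = P" "\<And>j. j \<le> ?d \<Longrightarrow> prime_ideal_of (Q j)" "\<And>j. j < ?d \<Longrightarrow> Q j \<subset> Q (Suc j)"
    using ex_prime_chain[OF P T(2,1) order_refl] by blast
  have PQ: "P \<subseteq> Q j" if "j \<le> ?d" for j
    using that
  proof (induction j)
    case (Suc j)
    then show ?case
      using Q(3)[of j] by auto
  qed (simp add: Q(1))
  \<comment> \<open>Zero sets reverse inclusions, so the chain of primes is read backwards.\<close>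
  define Z where "Z j = zeroset \<phi> (Q (?d - j))" for j
  have "closed_in_sub \<phi> S (Z j) \<and> zar_irreducible \<phi> (Z j)" if "j \<le> ?d" for j
  proof
    have "Z j \<subseteq> zeroset \<phi> P"
      using PQ[of "?d - j"] by (auto simp: Z_def zeroset_def)
    then show "closed_in_sub \<phi> S (Z j)"
      unfolding closed_in_sub_def using S(1) by (intro exI[of _ "Q (?d - j)"]) (auto simp: Z_def)
    show "zar_irreducible \<phi> (Z j)"
      unfolding Z_def by (intro zeroset_irreducible Q) simp
  qed
  moreover have "Z j \<subset> Z (Suc j)" if "j < ?d" for j
    unfolding Z_def using that Q(3)[of "?d - Suc j"]
    by (intro zeroset_strict_antimono Q(2)) (auto simp: Suc_diff_Suc)
  ultimately show ?thesis
    using S(2) unfolding zar_dim_le_def by blast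
qed

end

section \<open>Rank of the Lie algebra at a point\<close>

locale vf_algebra = fg_algebra_closed \<phi> x n
  for \<phi> :: "'k::{alg_closed_field, field_char_0} \<Rightarrow> 'a::comm_ring_1" and x n +
  fixes V :: "('a \<Rightarrow> 'a) set"
  assumes lie: "lie_subalgebra \<phi> V"
begin

lemma V_deriv:
  assumes "D \<in> V"
  shows "D (a + b) = D a + D b" "D (\<phi> c * a) = \<phi> c * D a" "D (a * b) = a * D b + b * D a"
  using lie assms by (auto simp: lie_subalgebra_def Vect_def vector_field_def)

lemma V_0 [simp]: "D \<in> V \<Longrightarrow> D 0 = 0"
  using V_deriv(2)[of D 0 0] by simp

lemma V_phi [simp]:
  assumes "D \<in> V" shows "D (\<phi> c) = 0"
proof -
  have "D 1 = 0"
    using V_deriv(3)[OF assms, of 1 1] by simp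
  then show ?thesis
    using V_deriv(2)[OF assms, of c 1] by simp
qed

lemma add_in_V: "D \<in> V \<Longrightarrow> E \<in> V \<Longrightarrow> (\<lambda>f. D f + E f) \<in> V"
  and scale_in_V: "D \<in> V \<Longrightarrow> (\<lambda>f. \<phi> c * D f) \<in> V"
  using lie by (auto simp: lie_subalgebra_def)

lemma diff_scale_in_V: "D \<in> V \<Longrightarrow> E \<in> V \<Longrightarrow> (\<lambda>f. D f - \<phi> c * E f) \<in> V"
  using add_in_V[of D "\<lambda>f. \<phi> (- c) * E f"] scale_in_V[of E "- c"] by (simp add: phi_uminus)

lemma diff_sum_in_V:
  assumes "D \<in> V" "finite I" "\<And>i. i \<in> I \<Longrightarrow> Df i \<in> V"
  shows "(\<lambda>f. D f - (\<Sum>i\<in>I. \<phi> (c i) * Df i f)) \<in> V"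
  using assms(2,3)
proof (induction I rule: finite_induct)
  case (insert i I)
  then have "(\<lambda>f. (D f - (\<Sum>i\<in>I. \<phi> (c i) * Df i f)) - \<phi> (c i) * Df i f) \<in> V"
    by (intro diff_scale_in_V) auto
  then show ?case
    using insert by (simp add: algebra_simps)
qed (use assms in simp)

text \<open>A normalised certificate that the rank at \<open>p\<close> is at least
  \<open>card I\<close>: fields whose components along the coordinates in \<open>I\<close> form the
  identity matrix at \<open>p\<close>.\<close>

definition pivots :: "('a \<Rightarrow> 'k) \<Rightarrow> nat set \<Rightarrow> (nat \<Rightarrow> 'a \<Rightarrow> 'a) \<Rightarrow> bool" where
  "pivots p I Df \<longleftrightarrow> I \<subseteq> {..<n} \<and>
     (\<forall>i\<in>I. Df i \<in> V \<and> (\<forall>j\<in>I. p (Df i (x j)) = (if i = j then 1 else 0)))"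

context
  fixes p :: "'a \<Rightarrow> 'k" assumes p: "p \<in> points \<phi>"
begin

lemma point_hom:
  shows "p (a + b) = p a + p b" "p (a * b) = p a * p b" "p (\<phi> c) = c"
    "p 0 = 0" "p 1 = 1" "p (- a) = - p a" "p (a - b) = p a - p b"
proof -
  show 1: "p (a + b) = p a + p b" "p (a * b) = p a * p b" "p (\<phi> c) = c" for a b c
    using p by (auto simp: points_def)
  show 0: "p 0 = 0" "p 1 = 1"
    using 1(3)[of 0] 1(3)[of 1] by auto
  show neg: "p (- a) = - p a" for a
    using 1(1)[of a "- a"] 0 by (simp add: eq_neg_iff_add_eq_0 add.commute)
  show "p (a - b) = p a - p b"
    using 1(1)[of a "- b"] neg[of b] by simp
qed

lemma point_sum: "p (\<Sum>i\<in>I. g i) = (\<Sum>i\<in>I. p (g i))"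
  by (induction I rule: infinite_finite_induct) (auto simp: point_hom)

lemma point_deriv_eq_0:
  assumes D: "D \<in> V" and 0: "\<And>j. j < n \<Longrightarrow> p (D (x j)) = 0"
  shows "p (D a) = 0"
proof -
  have mon: "p (D (mon_eval x m)) = 0" if "keys m \<subseteq> {..<n}" for m
    using that
  proof (induction m rule: mon_induct)
    case zero
    then show ?case
      using V_phi[OF D, of 1] by (simp add: point_hom)
  next
    case (var m i)
    then show ?case
      using 0[of i] by (simp add: point_hom mon_eval_add keys_add_mon V_deriv(3)[OF D])
  qed
  obtain q where q: "supp_in {..<n} q" "a = ev q"
    using generated by blast
  have "p (D (ev q)) = 0"
    using q(1)
  proof (induction rule: supp_in_induct)
    case (single m c)
    then show ?case
      using mon by (simp add: point_hom poly_eval_single V_deriv(2)[OF D])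
  qed (auto simp: point_hom D poly_eval_add V_deriv(1)[OF D])
  with q show ?thesis by simp
qed

text \<open>Gauss elimination: the fields of a largest pivot set span the evaluation at
  \<open>p\<close>. A field reduced by them that still moves some coordinate \<open>x j\<close>
  would provide one more pivot.\<close>

lemma tvdim_le_pivots:
  assumes max: "\<And>I Df. pivots p I Df \<Longrightarrow> card I \<le> \<rho>"
  shows "tvdim (eval_at V p) \<le> \<rho>"
proof -
  interpret fs: vector_space "\<lambda>c (t::'a \<Rightarrow> 'k) a. c * t a"
    by unfold_locales (auto simp: fun_eq_iff algebra_simps)
  let ?F = "{I. \<exists>Df. pivots p I Df}"
  have finF: "finite ?F"
    by (rule finite_subset[of _ "Pow {..<n}"]) (auto simp: pivots_def)
  have "{} \<in> ?F"
    by (auto simp: pivots_def)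
  then have "Max (card ` ?F) \<in> card ` ?F"
    using finF by (intro Max_in) auto
  then obtain I Df where I: "pivots p I Df" "card I = Max (card ` ?F)" by auto
  have card_le: "card J \<le> card I" if "pivots p J Ef" for J Ef
    unfolding I(2) using that finF by (intro Max_ge) auto
  have In: "I \<subseteq> {..<n}" "finite I"
    using I finite_subset by (auto simp: pivots_def)
  have Df: "\<And>i. i \<in> I \<Longrightarrow> Df i \<in> V" "\<And>i j. i \<in> I \<Longrightarrow> j \<in> I \<Longrightarrow> p (Df i (x j)) = (if i = j then 1 else 0)"
    using I by (auto simp: pivots_def)
  have "eval_at V p \<subseteq> fs.span ((\<lambda>i f. p (Df i f)) ` I)"
  proof
    fix t assume "t \<in> eval_at V p"
    then obtain D where D: "D \<in> V" "t = (\<lambda>f. p (D f))"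
      by (auto simp: eval_at_def)
    define D0 where "D0 f = D f - (\<Sum>i\<in>I. \<phi> (p (D (x i))) * Df i f)" for f
    have D0: "D0 \<in> V"
      unfolding D0_def using D(1) In(2) Df(1) by (rule diff_sum_in_V)
    have D0_I: "p (D0 (x j)) = 0" if "j \<in> I" for j
    proof -
      have "(\<Sum>i\<in>I. p (D (x i)) * p (Df i (x j))) = (\<Sum>i\<in>I. if i = j then p (D (x j)) else 0)"
        using Df(2) that by (intro sum.cong) auto
      then show ?thesis
        using that In(2) by (simp add: D0_def point_hom point_sum)
    qed
    have "p (D0 (x j)) = 0" if j: "j < n" for j
    proof (rule ccontr)
      assume ne: "p (D0 (x j)) \<noteq> 0"
      then have jI: "j \<notin> I"
        using D0_I by auto
      define D1 where "D1 f = \<phi> (inverse (p (D0 (x j)))) * D0 f" for f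
      have D1: "D1 \<in> V" "p (D1 (x j)) = 1" "\<And>i. i \<in> I \<Longrightarrow> p (D1 (x i)) = 0"
        using scale_in_V[OF D0] ne D0_I unfolding D1_def by (auto simp: point_hom)
      define Ef where "Ef i = (if i = j then D1 else (\<lambda>f. Df i f - \<phi> (p (Df i (x j))) * D1 f))" for i
      have "pivots p (insert j I) Ef"
        unfolding pivots_def
      proof (intro conjI ballI)
        show "insert j I \<subseteq> {..<n}"
          using In j by auto
        fix i assume i: "i \<in> insert j I"
        show "Ef i \<in> V"
          using i Df(1) D1(1) by (auto simp: Ef_def intro: diff_scale_in_V)
        fix k assume k: "k \<in> insert j I"
        show "p (Ef i (x k)) = (if i = k then 1 else 0)"
          using i k jI D1 Df(2) by (auto simp: Ef_def point_hom)
      qed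
      then show False
        using card_le jI In(2) by fastforce
    qed
    then have "p (D0 f) = 0" for f
      using point_deriv_eq_0[OF D0] by blast
    moreover have "p (D0 f) = p (D f) - (\<Sum>i\<in>I. p (D (x i)) * p (Df i f))" for f
      by (simp add: D0_def point_hom point_sum)
    ultimately have eq: "p (D f) = (\<Sum>i\<in>I. p (D (x i)) * p (Df i f))" for f
      by (metis eq_iff_diff_eq_0)
    have "t = (\<Sum>i\<in>I. (\<lambda>f. p (D (x i)) * p (Df i f)))"
    proof
      fix f
      have fun_sum: "(\<Sum>i\<in>J. (\<lambda>f. p (D (x i)) * p (Df i f))) f = (\<Sum>i\<in>J. p (D (x i)) * p (Df i f))" for J
        by (induction J rule: infinite_finite_induct) auto
      show "t f = (\<Sum>i\<in>I. (\<lambda>f. p (D (x i)) * p (Df i f))) f"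
        unfolding fun_sum D(2) by (rule eq)
    qed
    also have "\<dots> \<in> fs.span ((\<lambda>i f. p (Df i f)) ` I)"
      by (intro fs.span_sum fs.span_scale fs.span_base) auto
    finally show "t \<in> fs.span ((\<lambda>i f. p (Df i f)) ` I)" .
  qed
  then have "fs.dim (eval_at V p) \<le> card ((\<lambda>i f. p (Df i f)) ` I)"
    using In(2) by (intro fs.dim_le_card) auto
  also have "\<dots> \<le> card I"
    using In(2) by (rule card_image_le)
  also have "\<dots> \<le> \<rho>"
    using max I(1) by blast
  finally show ?thesis
    by (simp add: tvdim_def)
qed

end

section \<open>The cotangent coordinates and the graded ideal of symbols\<close>

sublocale pol: kalgebra "\<lambda>c. single 0 (\<phi> c) :: 'a mp"
  by unfold_locales (auto simp: kalg_struct_def phi_add phi_mult single_add mult_single)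

text \<open>Indices below \<open>n\<close> are the generators of \<open>A\<close>, the next
  \<open>n\<close> are the cotangent variables, which are numbered from \<open>0\<close> inside
  \<open>A[\<xi>]\<close>.\<close>

definition coord :: "nat \<Rightarrow> 'a mp" where
  "coord i = (if i < n then single 0 (x i) else single (var_mon (i - n)) 1)"

definition symbol :: "('a \<Rightarrow> 'a) \<Rightarrow> 'a mp" where
  "symbol D = (\<Sum>i<n. single (var_mon i) (D (x i)))"

abbreviation deg :: "mon \<Rightarrow> nat" where
  "deg \<equiv> weight (\<lambda>_. 1)"

text \<open>The part of degree \<open>b\<close> in \<open>\<xi>\<close> of the ideal generated by
  the symbols; the multiplier has degree \<open>b - 1\<close> because symbols are linear in
  \<open>\<xi>\<close>. The inductive form permits induction on the way an element is built, on
  which \<open>symbol_part_reduction\<close> rests.\<close>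

inductive_set symbol_part :: "nat \<Rightarrow> 'a mp set" for b :: nat where
  zero: "0 \<in> symbol_part b"
| add: "p \<in> symbol_part b \<Longrightarrow> q \<in> symbol_part b \<Longrightarrow> p + q \<in> symbol_part b"
| base: "D \<in> V \<Longrightarrow> Suc (deg m) = b \<Longrightarrow> single m a * symbol D \<in> symbol_part b"

definition hom_part :: "nat \<Rightarrow> 'a mp \<Rightarrow> 'a mp" where
  "hom_part b = extend_linear (\<lambda>m c. if deg m = b then single m c else 0)"

text \<open>The ideal generated by the symbols, described by homogeneous parts so that these can be
  extracted from a member at no cost.\<close>

definition symbol_ideal :: "'a mp set" where
  "symbol_ideal = {p. \<forall>b. hom_part b p \<in> symbol_part b}"

lemma hom_part_0 [simp]: "hom_part b 0 = 0"
  by (simp add: hom_part_def)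

lemma hom_part_add: "hom_part b (p + q) = hom_part b p + hom_part b q"
  unfolding hom_part_def by (rule extend_linear_add) (auto simp: single_add)

lemma hom_part_single:
  "hom_part b (single m c) = (if deg m = b then single m c else 0)"
  unfolding hom_part_def by (rule extend_linear_single) auto

lemma hom_part_sum: "hom_part b (\<Sum>i\<in>I. g i) = (\<Sum>i\<in>I. hom_part b (g i))"
  by (induction I rule: infinite_finite_induct) (auto simp: hom_part_add)

lemma hom_part_mult_single:
  "hom_part b (single m c * p)
    = (if deg m \<le> b then single m c * hom_part (b - deg m) p else 0)"
proof (induction p rule: mp_induct)
  case (single m' c')
  then show ?case
    by (auto simp: mult_single hom_part_single weight_add)
next
  case (add p q)
  then show ?case
    by (simp add: distrib_left hom_part_add)
qed auto

lemma symbol_part_mult_single: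
  assumes "p \<in> symbol_part b"
  shows "single m c * p \<in> symbol_part (b + deg m)"
  using assms
proof induction
  case zero
  then show ?case by (simp add: symbol_part.zero)
next
  case (add p q)
  then show ?case by (simp add: distrib_left symbol_part.add)
next
  case (base D m' a)
  then have "single (m + m') (c * a) * symbol D \<in> symbol_part (b + deg m)"
    by (intro symbol_part.base) (auto simp: weight_add)
  then show ?case
    by (simp add: mult_single flip: mult.assoc)
qed

lemma ideal_symbol_ideal: "ideal_of symbol_ideal"
  unfolding ideal_of_def
proof (intro conjI ballI allI)
  show "0 \<in> symbol_ideal"
    by (simp add: symbol_ideal_def symbol_part.zero)
  show sum: "p + q \<in> symbol_ideal" if "p \<in> symbol_ideal" "q \<in> symbol_ideal" for p q
    using that by (simp add: symbol_ideal_def hom_part_add symbol_part.add)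
  fix r p assume p: "p \<in> symbol_ideal"
  show "r * p \<in> symbol_ideal"
  proof (induction r rule: mp_induct)
    case zero
    then show ?case by (simp add: symbol_ideal_def symbol_part.zero)
  next
    case (single m c)
    show ?case
      unfolding symbol_ideal_def mem_Collect_eq
    proof
      fix b
      show "hom_part b (single m c * p) \<in> symbol_part b"
      proof (cases "deg m \<le> b")
        case True
        have "hom_part (b - deg m) p \<in> symbol_part (b - deg m)"
          using p by (simp add: symbol_ideal_def)
        from symbol_part_mult_single[OF this, of m c] show ?thesis
          using True by (simp add: hom_part_mult_single)
      qed (simp add: hom_part_mult_single symbol_part.zero)
    qed
  next
    case (add r s)
    then show ?case
      using sum by (simp add: distrib_right)
  qed
qed

lemma symbol_in_ideal:
  assumes "D \<in> V"
  shows "symbol D \<in> symbol_ideal"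
  unfolding symbol_ideal_def mem_Collect_eq
proof
  fix b
  have "hom_part b (symbol D) = (if b = 1 then symbol D else 0)"
    by (auto simp: symbol_def hom_part_sum hom_part_single)
  moreover have "symbol D \<in> symbol_part 1"
    using symbol_part.base[OF assms, of 0 1 1] by simp
  ultimately show "hom_part b (symbol D) \<in> symbol_part b"
    by (auto simp: symbol_part.zero)
qed

end

section \<open>The zero set of the symbols\<close>

locale holonomic_vf = vf_algebra \<phi> x n V
  for \<phi> :: "'k::{alg_closed_field, field_char_0} \<Rightarrow> 'a::comm_ring_1" and x n V +
  assumes rank_dim: "zar_dim_le \<phi> {p \<in> points \<phi>. tvdim (eval_at V p) \<le> i} i"
begin

lemma symbol_eq: "symbol D = (\<Sum>i<n. single 0 (D (x i)) * single (var_mon i) 1)"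
  by (simp add: symbol_def mult_single)

lemma coefficient_prime:
  assumes "prime_ideal_of Q"
  shows "prime_ideal_of {a. single 0 a \<in> (Q :: 'a mp set)}"
proof -
  have "single 0 (a * b) = single 0 a * (single 0 b :: 'a mp)" for a b
    by (simp add: mult_single)
  with assms show ?thesis
    by (auto simp: prime_ideal_of_def ideal_of_def single_add)
qed

text \<open>The rank hypothesis enters here. If \<open>card I\<close> is the largest number of
  pivots at points of the zero set of \<open>P\<close>, this set lies in the locus of rank at most
  \<open>card I\<close>. That locus has dimension at most \<open>card I\<close>, while
  \<open>card T\<close> independent coordinates force dimension at least
  \<open>card T\<close>.\<close>

lemma ex_pivots_ge_indep:
  assumes P: "prime_ideal_of P" and T: "T \<subseteq> {..<n}" "indep_mod P x T"
  obtains p I Df where "p \<in> points \<phi>" "\<And>a. a \<in> P \<Longrightarrow> p a = 0" "pivots p I Df" "card T \<le> card I"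
proof -
  let ?F = "{I. \<exists>p Df. p \<in> zeroset \<phi> P \<and> pivots p I Df}"
  have finF: "finite ?F"
    by (rule finite_subset[of _ "Pow {..<n}"]) (auto simp: pivots_def)
  obtain p0 where "p0 \<in> points \<phi>" "\<And>a. a \<in> P \<Longrightarrow> p0 a = 0" "p0 1 \<noteq> 0"
    by (rule nullstellensatz[OF P prime_ideal_1[OF P]]) (rule that)
  then have "{} \<in> ?F"
    by (auto simp: pivots_def zeroset_def)
  then have "Max (card ` ?F) \<in> card ` ?F"
    using finF by (intro Max_in) auto
  then obtain p I Df where I: "p \<in> zeroset \<phi> P" "pivots p I Df" "card I = Max (card ` ?F)" by auto
  have "tvdim (eval_at V q) \<le> card I" if q: "q \<in> zeroset \<phi> P" for q
  proof (rule tvdim_le_pivots)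
    show "q \<in> points \<phi>"
      using q by (simp add: zeroset_def)
    show "card J \<le> card I" if "pivots q J Ef" for J Ef
      unfolding I(3) using that q finF by (intro Max_ge) auto
  qed
  then have "zeroset \<phi> P \<subseteq> {p \<in> points \<phi>. tvdim (eval_at V p) \<le> card I}"
    by (auto simp: zeroset_def)
  then have "card T \<le> card I"
    by (rule indep_le_zar_dim[OF P T _ rank_dim])
  then show ?thesis
    using I by (intro that[of p I Df]) (auto simp: zeroset_def)
qed

text \<open>At a point \<open>p\<close> with pivots \<open>I\<close> the coefficient matrix of the pivot symbols is the identity,
  so the cotangent variables indexed by \<open>I\<close> can be eliminated in a neighbourhood of \<open>p\<close>.\<close>

lemma eliminate_pivots:
  assumes Q: "prime_ideal_of Q" "symbol_ideal \<subseteq> Q" and p: "p \<in> points \<phi>" and I: "pivots p I Df"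
  obtains \<Delta> c where "p \<Delta> \<noteq> 0"
    "\<And>i. i < n \<Longrightarrow> single (var_mon i) \<Delta>
       - (\<Sum>j\<in>{..<n} - I. single (var_mon j) (c i j)) \<in> Q"
proof -
  note QI = prime_ideal_ideal[OF Q(1)]
  have In: "I \<subseteq> {..<n}" "finite I"
    using I finite_subset by (auto simp: pivots_def)
  let ?G = "{..<n} - I"
  let ?\<iota> = "single 0 :: 'a \<Rightarrow> 'a mp"
  let ?X = "\<lambda>i. single (var_mon i) 1 :: 'a mp"
  have iota: "?\<iota> (a * b) = ?\<iota> a * ?\<iota> b" "?\<iota> (a + b) = ?\<iota> a + ?\<iota> b" "?\<iota> (a - b) = ?\<iota> a - ?\<iota> b" for a b
    by (auto simp: mult_single single_add single_diff)
  have single_var: "single (var_mon i) a = ?\<iota> a * ?X i" for i a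
    by (simp add: mult_single)
  \<comment> \<open>Combinations of the non-pivot cotangent variables, modulo \<open>Q\<close>; each
    pivot variable has to be brought into \<open>Y\<close> by a function that is nonzero at
    \<open>p\<close>.\<close>
  define Y where "Y = {y. \<exists>c. y - (\<Sum>j\<in>?G. ?\<iota> (c j) * ?X j) \<in> Q}"
  have Y_add: "y + y' \<in> Y" if y: "y \<in> Y" "y' \<in> Y" for y y'
  proof -
    obtain c c' where "y - (\<Sum>j\<in>?G. ?\<iota> (c j) * ?X j) \<in> Q" "y' - (\<Sum>j\<in>?G. ?\<iota> (c' j) * ?X j) \<in> Q"
      using y by (auto simp: Y_def)
    then have "(y - (\<Sum>j\<in>?G. ?\<iota> (c j) * ?X j)) + (y' - (\<Sum>j\<in>?G. ?\<iota> (c' j) * ?X j)) \<in> Q"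
      by (rule ideal_add[OF QI])
    also have "(y - (\<Sum>j\<in>?G. ?\<iota> (c j) * ?X j)) + (y' - (\<Sum>j\<in>?G. ?\<iota> (c' j) * ?X j))
        = (y + y') - (\<Sum>j\<in>?G. ?\<iota> (c j + c' j) * ?X j)"
      by (simp only: iota distrib_right sum.distrib) simp
    finally show ?thesis
      unfolding Y_def mem_Collect_eq by (rule exI[where x = "\<lambda>j. c j + c' j"])
  qed
  have Y_scale: "?\<iota> a * y \<in> Y" if y: "y \<in> Y" for a y
  proof -
    obtain c where "y - (\<Sum>j\<in>?G. ?\<iota> (c j) * ?X j) \<in> Q"
      using y by (auto simp: Y_def)
    then have "?\<iota> a * (y - (\<Sum>j\<in>?G. ?\<iota> (c j) * ?X j)) \<in> Q"
      by (rule ideal_mult[OF QI])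
    also have "?\<iota> a * (y - (\<Sum>j\<in>?G. ?\<iota> (c j) * ?X j)) = ?\<iota> a * y - (\<Sum>j\<in>?G. ?\<iota> (a * c j) * ?X j)"
      by (simp only: iota right_diff_distrib sum_distrib_left mult.assoc)
    finally show ?thesis
      unfolding Y_def mem_Collect_eq by (rule exI[where x = "\<lambda>j. a * c j"])
  qed
  let ?m = "?\<iota> ` {a. p a = 0}"
  let ?W = "?\<iota> ` {a. p a \<noteq> 0}"
  note hom = point_hom[OF p]
  have "\<forall>e\<in>I. \<exists>w\<in>?W. w * ?X e \<in> Y"
  proof (rule nakayama_elimination[where R = "range ?\<iota>" and \<mm> = ?m and W = ?W, OF In(2)])
    show "r * s \<in> range ?\<iota>" if "r \<in> range ?\<iota>" "s \<in> range ?\<iota>" for r s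
      using that by (auto simp flip: iota)
    show "?m \<subseteq> range ?\<iota>" "?W \<subseteq> range ?\<iota>"
      by auto
    show "r * a \<in> ?m" if "r \<in> range ?\<iota>" "a \<in> ?m" for r a
      using that by (auto simp: hom simp flip: iota)
    show "a + b \<in> ?m" if "a \<in> ?m" "b \<in> ?m" for a b
      using that by (auto simp: hom simp flip: iota)
    show "1 \<in> ?W"
      by (auto simp: hom intro!: image_eqI[of _ _ 1])
    show "v * w \<in> ?W" if "v \<in> ?W" "w \<in> ?W" for v w
      using that by (auto simp: hom simp flip: iota)
    show "w - a \<in> ?W" if "w \<in> ?W" "a \<in> ?m" for w a
      using that by (auto simp: hom simp flip: iota)
    show "r * y \<in> Y" if "r \<in> range ?\<iota>" "y \<in> Y" for r y
      using that Y_scale by auto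
    show "y + y' \<in> Y" if "y \<in> Y" "y' \<in> Y" for y y'
      by (rule Y_add[OF that])
    fix e assume e: "e \<in> I"
    \<comment> \<open>The identity minus the pivot matrix: its entries vanish at \<open>p\<close>,
      which is what the elimination lemma requires.\<close>
    let ?a = "\<lambda>f. (if e = f then 1 else 0) - Df e (x f)"
    have "symbol (Df e) \<in> Q"
      using Q(2) symbol_in_ideal I e by (auto simp: pivots_def)
    moreover have "symbol (Df e) = (\<Sum>f\<in>I. ?\<iota> (Df e (x f)) * ?X f) + (\<Sum>f\<in>?G. ?\<iota> (Df e (x f)) * ?X f)"
      unfolding symbol_eq using In by (subst sum.subset_diff[of I]) (auto simp: add.commute)
    moreover have "(\<Sum>f\<in>I. ?\<iota> (if e = f then 1 else 0) * ?X f) = ?X e"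
    proof -
      have "(\<Sum>f\<in>I. ?\<iota> (if e = f then 1 else 0) * ?X f) = (\<Sum>f\<in>I. if f = e then ?X e else 0)"
        by (intro sum.cong) auto
      then show ?thesis
        using e In(2) by simp
    qed
    then have "?X e - (\<Sum>f\<in>I. ?\<iota> (?a f) * ?X f) = (\<Sum>f\<in>I. ?\<iota> (Df e (x f)) * ?X f)"
      by (simp only: iota left_diff_distrib sum_subtractf) simp
    ultimately have "(?X e - (\<Sum>f\<in>I. ?\<iota> (?a f) * ?X f)) - (\<Sum>f\<in>?G. ?\<iota> (- Df e (x f)) * ?X f) \<in> Q"
      by (simp add: single_uminus sum_negf)
    then have "1 * ?X e - (\<Sum>f\<in>I. ?\<iota> (?a f) * ?X f) \<in> Y"
      unfolding Y_def mem_Collect_eq mult_1 by (rule exI[where x = "\<lambda>f. - Df e (x f)"])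
    moreover have "\<forall>f\<in>I. ?\<iota> (?a f) \<in> ?m"
      using I e by (auto simp: pivots_def hom)
    moreover have "1 \<in> ?W"
      by (auto simp: hom intro!: image_eqI[of _ _ 1])
    ultimately show "\<exists>w\<in>?W. \<exists>a. (\<forall>f\<in>I. a f \<in> ?m) \<and> w * ?X e - (\<Sum>f\<in>I. a f * ?X f) \<in> Y"
      by (intro bexI[of _ 1] exI[of _ "\<lambda>f. ?\<iota> (?a f)"]) simp_all
  qed
  then have "\<exists>\<delta>. e \<in> I \<longrightarrow> p \<delta> \<noteq> 0 \<and> ?\<iota> \<delta> * ?X e \<in> Y" for e
    by auto
  then obtain \<delta> where \<delta>: "\<And>e. e \<in> I \<Longrightarrow> p (\<delta> e) \<noteq> 0 \<and> ?\<iota> (\<delta> e) * ?X e \<in> Y"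
    by metis
  define \<Delta> where "\<Delta> = (\<Prod>e\<in>I. \<delta> e)"
  have "p (\<Prod>e\<in>J. \<delta> e) \<noteq> 0" if "finite J" "J \<subseteq> I" for J
    using that by (induction J rule: finite_induct) (auto simp: hom \<delta>)
  then have p\<Delta>: "p \<Delta> \<noteq> 0"
    using In by (simp add: \<Delta>_def)
  have "?\<iota> \<Delta> * ?X i \<in> Y" if "i < n" for i
  proof (cases "i \<in> I")
    case True
    have "\<Delta> = (\<Prod>e\<in>I - {i}. \<delta> e) * \<delta> i"
      using True In(2) by (simp add: \<Delta>_def prod.remove mult.commute)
    then have "?\<iota> \<Delta> * ?X i = ?\<iota> (\<Prod>e\<in>I - {i}. \<delta> e) * (?\<iota> (\<delta> i) * ?X i)"
      by (simp only: iota mult.assoc)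
    then show ?thesis
      using Y_scale \<delta>[OF True] by simp
  next
    case False
    have "(\<Sum>j\<in>?G. ?\<iota> (if j = i then \<Delta> else 0) * ?X j) = (\<Sum>j\<in>?G. if j = i then ?\<iota> \<Delta> * ?X i else 0)"
      by (intro sum.cong) auto
    also have "\<dots> = ?\<iota> \<Delta> * ?X i"
      using False that by simp
    finally show ?thesis
      unfolding Y_def mem_Collect_eq using ideal_0[OF QI]
      by (intro exI[where x = "\<lambda>j. if j = i then \<Delta> else 0"]) simp
  qed
  then have "\<forall>i. \<exists>c. i < n \<longrightarrow> ?\<iota> \<Delta> * ?X i - (\<Sum>j\<in>?G. ?\<iota> (c j) * ?X j) \<in> Q"
    by (auto simp: Y_def)
  then have "\<exists>c. \<forall>i. i < n \<longrightarrow> ?\<iota> \<Delta> * ?X i - (\<Sum>j\<in>?G. ?\<iota> (c i j) * ?X j) \<in> Q"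
    by (rule choice)
  then obtain c where "\<And>i. i < n \<Longrightarrow> ?\<iota> \<Delta> * ?X i - (\<Sum>j\<in>?G. ?\<iota> (c i j) * ?X j) \<in> Q"
    by blast
  then show ?thesis
    by (intro that[OF p\<Delta>, of c]) (simp add: single_var[of _ \<Delta>] single_var[of _ "c _ _"])
qed

text \<open>Stratifying by the rank of \<open>V\<close>, the zero set of the symbols in the cotangent space has
  dimension at most \<open>n\<close>: over a locus of dimension \<open>d\<close> the fibre has dimension at most \<open>n - d\<close>.
  The dimension is measured by the growth of the coordinate ring.\<close>

lemma ex_relation_in_symbol_ideal:
  assumes S: "S \<subseteq> {..<2 * n}" "card S = Suc n"
  obtains h where "supp_in S h" "h \<noteq> 0" "poly_eval (\<lambda>c. single 0 (\<phi> c)) coord h \<in> symbol_ideal"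
proof (rule ccontr)
  assume no: "\<not> thesis"
  let ?ev = "poly_eval (\<lambda>c. single 0 (\<phi> c)) coord"
  let ?\<iota> = "single 0 :: 'a \<Rightarrow> 'a mp"
  let ?M = "{?ev h | h. supp_in S h \<and> h \<noteq> 0}"
  have finS: "finite S"
    using S finite_subset by auto
  have "1 \<in> ?M"
    by (auto intro!: exI[of _ 1])
  moreover have "a * b \<in> ?M" if ab: "a \<in> ?M" "b \<in> ?M" for a b
  proof -
    obtain h h' where "a = ?ev h" "b = ?ev h'" "supp_in S h" "supp_in S h'" "h \<noteq> 0" "h' \<noteq> 0"
      using ab by auto
    then show ?thesis
      by (auto intro!: exI[of _ "h * h'"] simp: pol.poly_eval_mult)
  qed
  moreover have "symbol_ideal \<inter> ?M = {}"
    using no that by blast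
  ultimately obtain Q where Q: "prime_ideal_of Q" "symbol_ideal \<subseteq> Q" "Q \<inter> ?M = {}"
    by (rule ex_prime_ideal_avoiding[OF ideal_symbol_ideal, of ?M]) (assumption | rule that)+
  note QI = prime_ideal_ideal[OF Q(1)]
  \<comment> \<open>Geometrically \<open>Q\<close> is an irreducible subvariety of the zero set of
    the symbols and \<open>P\<close> the closure of its image in \<open>X\<close>. The functions on
    it are counted as base, of dimension \<open>card T\<close>, times fibre.\<close>
  define P where "P = {a. ?\<iota> a \<in> Q}"
  have P: "prime_ideal_of P"
    unfolding P_def by (rule coefficient_prime[OF Q(1)])
  obtain T where T: "T \<subseteq> {..<n}" "indep_mod P x T" "max_indep P (card T)"
    using ex_max_indep[OF indep_mod_empty[OF P]] by auto
  obtain p I Df where p: "p \<in> points \<phi>" "\<And>a. a \<in> P \<Longrightarrow> p a = 0" and I: "pivots p I Df" "card T \<le> card I"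
    by (rule ex_pivots_ge_indep[OF P T(1,2)]) (rule that)
  obtain \<Delta> c where "p \<Delta> \<noteq> 0" and \<Delta>: "\<And>i. i < n \<Longrightarrow> single (var_mon i) \<Delta>
       - (\<Sum>j\<in>{..<n} - I. single (var_mon j) (c i j)) \<in> Q"
    by (rule eliminate_pivots[OF Q(1,2) p(1) I(1)]) (rule that)
  then have \<Delta>P: "\<Delta> \<notin> P"
    using p by auto
  let ?G = "{..<n} - I"
  have In: "I \<subseteq> {..<n}"
    using I by (simp add: pivots_def)
  \<comment> \<open>The decisive inequality: the fibre has \<open>n - card I\<close> free variables,
    and the base has dimension \<open>card T \<le> card I\<close>.\<close>
  have cardG: "card ?G + card T \<le> n" "finite ?G"
    using In I(2) card_Diff_subset[of I "{..<n}"] finite_subset[OF In] card_mono[OF _ In] by auto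
  have "finite ({\<Delta>} \<union> (\<lambda>i. \<Delta> * x i) ` {..<n} \<union> (\<lambda>(i, j). c i j) ` ({..<n} \<times> ?G))"
    by auto
  from ex_deg_le_finite[OF this] obtain N' where N': "{\<Delta>} \<union> (\<lambda>i. \<Delta> * x i) ` {..<n} \<union> (\<lambda>(i, j). c i j) ` ({..<n} \<times> ?G) \<subseteq> deg_le N'"
    by (rule exE)
  \<comment> \<open>\<open>Suc\<close> guarantees \<open>1 \<le> N\<close>, needed to bound
    \<open>e + 1\<close> by \<open>N * e + 1\<close> below.\<close>
  define N where "N = Suc N'"
  have sub: "{\<Delta>} \<union> (\<lambda>i. \<Delta> * x i) ` {..<n} \<union> (\<lambda>(i, j). c i j) ` ({..<n} \<times> ?G) \<subseteq> deg_le N"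
    by (rule subset_trans[OF N' deg_le_mono]) (simp add: N_def)
  have N: "1 \<le> N" "\<Delta> \<in> deg_le N" "\<And>i. i < n \<Longrightarrow> \<Delta> * x i \<in> deg_le N"
    "\<And>i j. i < n \<Longrightarrow> j \<in> ?G \<Longrightarrow> c i j \<in> deg_le N"
    using sub by (auto simp: N_def)
  \<comment> \<open>A filtration adapted to the denominator: multiplying by \<open>\<Delta>\<close>
    and one coordinate sends the span of \<open>B e\<close> into that of
    \<open>B (Suc e)\<close>.\<close>
  define B where "B e = {single \<beta> a | \<beta> a. keys \<beta> \<subseteq> ?G \<and> deg \<beta> \<le> e \<and> a \<in> deg_le (N * e)} \<union> Q" for e
  have BI: "single \<beta> a \<in> pol.vs.span (B e)"
    if "keys \<beta> \<subseteq> ?G" "deg \<beta> \<le> e" "a \<in> deg_le (N * e)" for \<beta> a e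
    using that unfolding B_def by (intro pol.vs.span_base UnI1) blast
  have BQ: "q \<in> pol.vs.span (B e)" if "q \<in> Q" for q e
    using that unfolding B_def by (intro pol.vs.span_base) auto
  have deg_N: "a * b \<in> deg_le (N * Suc e)" if "a \<in> deg_le N" "b \<in> deg_le (N * e)" for a b e
    using deg_le_mult[OF that] by simp
  have step0: "?\<iota> \<Delta> * y \<in> pol.vs.span (B (Suc e))" if y: "y \<in> pol.vs.span (B e)" for y e
    using y
  proof (rule pol.span_mult_closed)
    fix g assume "g \<in> B e"
    then consider "g \<in> Q" | \<beta> a where "g = single \<beta> a" "keys \<beta> \<subseteq> ?G" "deg \<beta> \<le> e" "a \<in> deg_le (N * e)"
      by (auto simp: B_def)
    then show "?\<iota> \<Delta> * g \<in> pol.vs.span (B (Suc e))"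
    proof cases
      case 1
      then show ?thesis by (intro BQ ideal_mult[OF QI])
    next
      case 2
      then show ?thesis
        using deg_N[OF N(2)] by (auto simp: mult_single intro!: BI)
    qed
  qed
  have step: "?\<iota> \<Delta> * (coord i * y) \<in> pol.vs.span (B (Suc e))"
    if i: "i < 2 * n" and y: "y \<in> pol.vs.span (B e)" for i y e
    unfolding mult.assoc[symmetric] using y
  proof (rule pol.span_mult_closed)
    fix g assume "g \<in> B e"
    then consider "g \<in> Q" | \<beta> a where "g = single \<beta> a" "keys \<beta> \<subseteq> ?G" "deg \<beta> \<le> e" "a \<in> deg_le (N * e)"
      by (auto simp: B_def)
    then show "?\<iota> \<Delta> * coord i * g \<in> pol.vs.span (B (Suc e))"
    proof cases
      case 1
      then show ?thesis by (intro BQ ideal_mult[OF QI])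
    next
      case 2
      show ?thesis
      proof (cases "i < n")
        case True
        then have "?\<iota> \<Delta> * coord i * g = single \<beta> ((\<Delta> * x i) * a)"
          by (simp add: 2 coord_def mult_single)
        also have "\<dots> \<in> pol.vs.span (B (Suc e))"
          using 2 deg_N[OF N(3)[OF True]] by (intro BI) auto
        finally show ?thesis .
      next
        case False
        let ?i = "i - n"
        have i': "?i < n"
          using i False by simp
        let ?s = "\<Sum>j\<in>?G. single (var_mon j) (c ?i j)"
        have "?\<iota> \<Delta> * coord i * g = (single (var_mon ?i) \<Delta> - ?s) * g + ?s * g"
          using False by (simp add: coord_def mult_single algebra_simps)
        moreover have "(single (var_mon ?i) \<Delta> - ?s) * g \<in> pol.vs.span (B (Suc e))"
          by (intro BQ ideal_mult_right[OF QI] \<Delta> i')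
        moreover have "?s * g \<in> pol.vs.span (B (Suc e))"
          unfolding sum_distrib_right
        proof (rule pol.vs.span_sum)
          fix j assume j: "j \<in> ?G"
          have "single (var_mon j) (c ?i j) * g = single (var_mon j + \<beta>) (c ?i j * a)"
            by (simp add: 2 mult_single)
          also have "\<dots> \<in> pol.vs.span (B (Suc e))"
            using 2 j deg_N[OF N(4)[OF i' j]] by (intro BI) (auto simp: keys_add_mon weight_add)
          finally show "single (var_mon j) (c ?i j) * g \<in> pol.vs.span (B (Suc e))" .
        qed
        ultimately show ?thesis
          by (simp only:) (rule pol.vs.span_add)
      qed
    qed
  qed
  have mon: "?\<iota> (\<Delta> ^ deg \<tau>) * mon_eval coord \<tau> \<in> pol.vs.span (B (deg \<tau>))" if "keys \<tau> \<subseteq> {..<2 * n}" for \<tau>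
    using that
  proof (induction \<tau> rule: mon_induct)
    case zero
    have "1 \<in> deg_le (N * 0)"
      using mon_eval_deg_le[of 0 0] by simp
    then show ?case
      using BI[of 0 0 1] by simp
  next
    case (var \<tau> i)
    then have "?\<iota> \<Delta> * (coord i * (?\<iota> (\<Delta> ^ deg \<tau>) * mon_eval coord \<tau>)) \<in> pol.vs.span (B (Suc (deg \<tau>)))"
      by (intro step) (auto simp: keys_add_mon)
    moreover have "?\<iota> \<Delta> * (coord i * (?\<iota> (\<Delta> ^ deg \<tau>) * mon_eval coord \<tau>))
        = (?\<iota> \<Delta> * ?\<iota> (\<Delta> ^ deg \<tau>)) * mon_eval coord (\<tau> + var_mon i)"
      by (simp only: mon_eval_add mon_eval_single power_one_right mult_ac power_Suc power_0 mult_1_right mult_1_left)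
    ultimately show ?case
      by (simp add: mult_single weight_add)
  qed
  \<comment> \<open>Extra factors \<open>\<Delta>\<close> bring all monomials of degree at most
    \<open>e\<close> to the common denominator \<open>\<Delta> ^ e\<close>, which can be cancelled
    modulo \<open>Q\<close> at the end.\<close>
  have mon': "?\<iota> (\<Delta> ^ e) * mon_eval coord \<tau> \<in> pol.vs.span (B e)"
    if "keys \<tau> \<subseteq> {..<2 * n}" "deg \<tau> \<le> e" for \<tau> e
    using that(2)
  proof (induction e rule: dec_induct)
    case base
    then show ?case using mon that by blast
  next
    case (step e)
    then have "?\<iota> \<Delta> * (?\<iota> (\<Delta> ^ e) * mon_eval coord \<tau>) \<in> pol.vs.span (B (Suc e))"
      by (intro step0)
    then show ?case
      by (simp add: mult_single flip: mult.assoc)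
  qed
  obtain C where C: "\<And>W. \<exists>X. finite X \<and> card X \<le> C * (W + 1) ^ card T \<and> deg_le W \<subseteq> vs.span (X \<union> P)"
    using growth_mod_ideal[OF prime_ideal_ideal[OF P] T(3)] by blast
  have B_count: "\<exists>X'. finite X' \<and> card X' \<le> C * (N * e + 1) ^ n \<and> B e \<subseteq> pol.vs.span (X' \<union> Q)" for e
  proof -
    obtain X where X: "finite X" "card X \<le> C * (N * e + 1) ^ card T" "deg_le (N * e) \<subseteq> vs.span (X \<union> P)"
      using C by blast
    define X' where "X' = (\<lambda>(\<beta>, a). single \<beta> a) ` (box_mons ?G e \<times> X)"
    have fin: "finite X'"
      unfolding X'_def using card_box_mons(1)[OF cardG(2)] X(1) by auto
    have "card X' \<le> card (box_mons ?G e \<times> X)"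
      unfolding X'_def by (rule card_image_le) (use card_box_mons(1)[OF cardG(2)] X(1) in auto)
    also have "\<dots> = (e + 1) ^ card ?G * card X"
      using card_box_mons(2)[OF cardG(2)] by (simp add: card_cartesian_product)
    also have "\<dots> \<le> (N * e + 1) ^ card ?G * (C * (N * e + 1) ^ card T)"
    proof (intro mult_mono power_mono X(2))
      show "e + 1 \<le> N * e + 1"
        using mult_le_mono1[OF N(1), of e] by simp
    qed auto
    also have "\<dots> = C * (N * e + 1) ^ (card ?G + card T)"
      by (simp only: power_add mult_ac)
    also have "\<dots> \<le> C * (N * e + 1) ^ n"
      using cardG(1) by (intro mult_left_mono power_increasing) auto
    finally have card: "card X' \<le> C * (N * e + 1) ^ n" .
    have single_span: "single \<beta> a \<in> pol.vs.span (X' \<union> Q)"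
      if \<beta>: "keys \<beta> \<subseteq> ?G" "deg \<beta> \<le> e" and a: "a \<in> deg_le (N * e)" for \<beta> a
    proof -
      have "a \<in> vs.span (X \<union> P)"
        using a X(3) by auto
      then show ?thesis
      proof (induction a rule: vs.span_induct_alt)
        case base
        then show ?case by (simp add: pol.vs.span_zero)
      next
        case (step k b b')
        have "single \<beta> b \<in> pol.vs.span (X' \<union> Q)"
        proof (cases "b \<in> P")
          case True
          then have "?\<iota> b * single \<beta> 1 \<in> Q"
            by (intro ideal_mult_right[OF QI]) (simp add: P_def)
          then show ?thesis
            by (intro pol.vs.span_base) (simp add: mult_single)
        next
          case False
          have "lookup \<beta> i \<le> e" for i
            using lookup_le_weight[of \<beta> "\<lambda>_. 1" i] \<beta>(2) by simp
          then have "\<beta> \<in> box_mons ?G e"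
            using \<beta> by (auto simp: box_mons_def)
          then show ?thesis
            using step False by (intro pol.vs.span_base) (auto simp: X'_def)
        qed
        then have "?\<iota> (\<phi> k) * single \<beta> b + single \<beta> b' \<in> pol.vs.span (X' \<union> Q)"
          using step by (intro pol.vs.span_add pol.vs.span_scale)
        then show ?case
          by (simp add: mult_single single_add)
      qed
    qed
    have "B e \<subseteq> pol.vs.span (X' \<union> Q)"
    proof
      fix y assume "y \<in> B e"
      then consider "y \<in> Q" | \<beta> a where "y = single \<beta> a" "keys \<beta> \<subseteq> ?G" "deg \<beta> \<le> e" "a \<in> deg_le (N * e)"
        by (auto simp: B_def)
      then show "y \<in> pol.vs.span (X' \<union> Q)"
      proof cases
        case 1
        then show ?thesis by (intro pol.vs.span_base) simp
      next
        case 2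
        then show ?thesis using single_span by simp
      qed
    qed
    with fin card show ?thesis by blast
  qed
  \<comment> \<open>Box monomials in the \<open>n + 1\<close> variables of \<open>S\<close> have
    degree at most \<open>Suc n * m = e\<close>, and \<open>N * e = D * m\<close> is the linear
    range demanded by \<open>power_growth_bound\<close>.\<close>
  define D where "D = N * Suc n"
  define m where "m = C * (D + 1) ^ n"
  define e where "e = Suc n * m"
  obtain X where X: "finite X" "card X \<le> C * (N * e + 1) ^ n" "B e \<subseteq> pol.vs.span (X \<union> Q)"
    using B_count by blast
  have "card (box_mons S m) \<le> card X"
  proof (rule pol.vs.card_le_of_independent_mod[where K = Q and f = "\<lambda>\<tau>. ?\<iota> (\<Delta> ^ e) * mon_eval coord \<tau>"])
    show "finite (box_mons S m)"
      by (rule card_box_mons[OF finS])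
    show "pol.vs.subspace Q"
      by (rule pol.ideal_subspace[OF QI])
    fix \<tau> assume \<tau>: "\<tau> \<in> box_mons S m"
    have "deg \<tau> \<le> card S * (1 * m)"
      using \<tau> by (intro weight_le_card finS) (auto simp: box_mons_def)
    then have "?\<iota> (\<Delta> ^ e) * mon_eval coord \<tau> \<in> pol.vs.span (B e)"
      using \<tau> S by (intro mon') (auto simp: box_mons_def e_def)
    also have "pol.vs.span (B e) \<subseteq> pol.vs.span (X \<union> Q)"
      using X(3) by (intro pol.vs.span_minimal) auto
    finally show "?\<iota> (\<Delta> ^ e) * mon_eval coord \<tau> \<in> pol.vs.span (X \<union> Q)" .
  next
    fix k assume k: "(\<Sum>\<tau>\<in>box_mons S m. ?\<iota> (\<phi> (k \<tau>)) * (?\<iota> (\<Delta> ^ e) * mon_eval coord \<tau>)) \<in> Q"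
    define h where "h = (\<Sum>\<tau>\<in>box_mons S m. single \<tau> (k \<tau>))"
    have supp: "supp_in S h"
      unfolding h_def by (intro supp_in_sum supp_in_single) (auto simp: box_mons_def)
    have "(\<Sum>\<tau>\<in>box_mons S m. ?\<iota> (\<phi> (k \<tau>)) * (?\<iota> (\<Delta> ^ e) * mon_eval coord \<tau>)) = ?\<iota> (\<Delta> ^ e) * ?ev h"
      unfolding h_def pol.poly_eval_sum pol.poly_eval_single sum_distrib_left by (simp only: mult_ac)
    then have "?\<iota> (\<Delta> ^ e) \<in> Q \<or> ?ev h \<in> Q"
      using k prime_ideal_mult[OF Q(1)] by simp
    moreover have "?\<iota> (\<Delta> ^ e) \<notin> Q"
      using prime_ideal_power[OF P, of \<Delta> e] \<Delta>P by (auto simp: P_def)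
    ultimately have "h = 0"
      using Q(3) supp by blast
    show "\<forall>\<tau>\<in>box_mons S m. k \<tau> = 0"
    proof
      fix \<tau> assume "\<tau> \<in> box_mons S m"
      then have "lookup h \<tau> = k \<tau>"
        using card_box_mons(1)[OF finS, of m] by (simp add: h_def lookup_sum lookup_single when_def)
      then show "k \<tau> = 0"
        using \<open>h = 0\<close> by simp
    qed
  qed (rule X(1))
  also have "\<dots> \<le> C * (N * e + 1) ^ n"
    by (rule X(2))
  also have "\<dots> < (m + 1) ^ Suc n"
  proof (rule power_growth_bound)
    show "N * e \<le> D * m"
      by (simp only: D_def e_def mult.assoc)
  qed (simp only: m_def)
  also have "\<dots> = card (box_mons S m)"
    using card_box_mons(2)[OF finS] S(2) by simp
  finally show False by simp
qed

end

section \<open>Invariant functionals\<close>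

definition mon_fact :: "mon \<Rightarrow> 'k::field_char_0" where
  "mon_fact m = (\<Prod>i\<in>keys m. fact (lookup m i))"

lemma mon_fact_neq_0 [simp]: "mon_fact m \<noteq> (0 :: 'k::field_char_0)"
  by (simp add: mon_fact_def)

lemma mon_fact_0 [simp]: "mon_fact 0 = 1"
  by (simp add: mon_fact_def)

lemma mon_fact_var: "mon_fact (m + var_mon i) = of_nat (Suc (lookup m i)) * mon_fact m"
proof -
  let ?F = "insert i (keys m)"
  have ext: "mon_fact m' = (\<Prod>j\<in>?F. fact (lookup m' j) :: 'a)" if "keys m' \<subseteq> ?F" for m' :: mon
    unfolding mon_fact_def using that by (intro prod.mono_neutral_left) (auto simp: in_keys_iff)
  have "mon_fact (m + var_mon i) = (\<Prod>j\<in>?F. fact (lookup (m + var_mon i) j) :: 'a)"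
    by (rule ext) (auto simp: keys_add_mon)
  also have "\<dots> = fact (lookup (m + var_mon i) i) * (\<Prod>j\<in>?F - {i}. fact (lookup (m + var_mon i) j))"
    by (subst prod.remove[of _ i]) auto
  also have "(\<Prod>j\<in>?F - {i}. fact (lookup (m + var_mon i) j)) = (\<Prod>j\<in>?F - {i}. fact (lookup m j) :: 'a)"
    by (intro prod.cong) (auto simp: lookup_add lookup_single when_def)
  also have "fact (lookup (m + var_mon i) i) = of_nat (Suc (lookup m i)) * (fact (lookup m i) :: 'a)"
    by (simp add: lookup_add)
  also have "of_nat (Suc (lookup m i)) * fact (lookup m i) * (\<Prod>j\<in>?F - {i}. fact (lookup m j))
      = of_nat (Suc (lookup m i)) * (\<Prod>j\<in>?F. fact (lookup m j) :: 'a)"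
    by (subst (2) prod.remove[of _ i]) (auto simp: mult.assoc)
  also have "(\<Prod>j\<in>?F. fact (lookup m j) :: 'a) = mon_fact m"
    by (rule ext[symmetric]) auto
  finally show ?thesis .
qed

definition mon_dvd :: "mon \<Rightarrow> mon \<Rightarrow> bool" where
  "mon_dvd m m' \<longleftrightarrow> (\<forall>i. lookup m i \<le> lookup m' i)"

lemma mon_dvd_add [simp]: "mon_dvd m (m + d)"
  by (simp add: mon_dvd_def lookup_add)

lemma mon_dvdE:
  assumes "mon_dvd m m'"
  obtains d where "m' = m + d"
  using mon_diff_add(1)[of m m'] assms by (auto simp: mon_dvd_def)

lemma mon_dvd_deg_eq:
  assumes "mon_dvd m m'" "weight (\<lambda>_. 1) m' \<le> weight (\<lambda>_. 1) m"
  shows "m = m'"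
proof -
  obtain d where d: "m' = m + d"
    using assms(1) by (rule mon_dvdE)
  then have "weight (\<lambda>_. 1) d = 0"
    using assms(2) by (simp add: weight_add)
  then have "d = 0"
    using lookup_le_weight[of d "\<lambda>_. 1"] by (intro poly_mapping_eqI) simp
  with d show ?thesis by simp
qed

lemma (in kalgebra) phi_of_nat: "\<phi> (of_nat k) = of_nat k"
  by (induction k) (auto simp: phi_add)

context vf_algebra
begin

text \<open>Where \<open>x i\<close> does not divide the monomial, the truncated difference is
  meaningless, but its coefficient is zero.\<close>

lemma deriv_mon_eval:
  assumes D: "D \<in> V" and "keys m \<subseteq> {..<n}"
  shows "D (mon_eval x m) = (\<Sum>i<n. of_nat (lookup m i) * (D (x i) * mon_eval x (m - var_mon i)))"
  using assms(2)
proof (induction m rule: mon_induct)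
  case zero
  then show ?case
    using V_phi[OF D, of 1] by simp
next
  case (var m k)
  then have k: "k < n" and m: "keys m \<subseteq> {..<n}"
    by (auto simp: keys_add_mon)
  have term_eq: "of_nat (lookup (m + var_mon k) i) * (D (x i) * mon_eval x (m + var_mon k - var_mon i))
      = x k * (of_nat (lookup m i) * (D (x i) * mon_eval x (m - var_mon i)))
        + (if i = k then mon_eval x m * D (x k) else 0)" for i
  proof (cases "lookup m i = 0")
    case True
    then show ?thesis
      by (auto simp: lookup_add lookup_single when_def)
  next
    case False
    then have "i \<in> keys m"
      by (simp add: in_keys_iff)
    then obtain m' where m': "m = m' + var_mon i"
      by (rule mon_split_var)
    have "m + var_mon k = (m' + var_mon k) + var_mon i"
      unfolding m' by (simp only: ac_simps)
    then have "m + var_mon k - var_mon i = m' + var_mon k"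
      by (simp only: add_diff_cancel_right')
    then show ?thesis
      by (auto simp: m' mon_eval_add lookup_add lookup_single when_def algebra_simps)
  qed
  have "D (mon_eval x (m + var_mon k)) = x k * D (mon_eval x m) + mon_eval x m * D (x k)"
    by (simp add: mon_eval_add V_deriv(3)[OF D] add.commute)
  also have "\<dots> = (\<Sum>i<n. of_nat (lookup (m + var_mon k) i) * (D (x i) * mon_eval x (m + var_mon k - var_mon i)))"
    unfolding term_eq sum.distrib var.IH[OF m] sum_distrib_left using k by simp
  finally show ?case .
qed

text \<open>\<open>pairing l q \<gamma>\<close> is the coefficient of \<open>y\<^sup>\<gamma>\<close> in the power series attached to \<open>q\<close>: a term
  \<open>a \<xi>\<^sup>\<beta>\<close> contributes \<open>y\<^sup>\<beta> l(a exp(x \<bullet> y))\<close>.\<close>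

definition pairing :: "('a \<Rightarrow> 'k) \<Rightarrow> 'a mp \<Rightarrow> mon \<Rightarrow> 'k" where
  "pairing l q \<gamma> = extend_linear
     (\<lambda>\<beta> a. if mon_dvd \<beta> \<gamma> then l (a * mon_eval x (\<gamma> - \<beta>)) / mon_fact (\<gamma> - \<beta>) else 0) q"

definition linear_functional :: "('a \<Rightarrow> 'k) \<Rightarrow> bool" where
  "linear_functional l \<longleftrightarrow> (\<forall>a b. l (a + b) = l a + l b) \<and> (\<forall>c a. l (\<phi> c * a) = c * l a)"

lemma functional_add: "linear_functional l \<Longrightarrow> l (a + b) = l a + l b"
  and functional_scale: "linear_functional l \<Longrightarrow> l (\<phi> c * a) = c * l a"
  by (auto simp: linear_functional_def)

lemma functional_0: "linear_functional l \<Longrightarrow> l 0 = 0"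
  using functional_scale[of l 0 0] by simp

lemma functional_sum: "linear_functional l \<Longrightarrow> l (\<Sum>i\<in>I. g i) = (\<Sum>i\<in>I. l (g i))"
  by (induction I rule: infinite_finite_induct) (auto simp: functional_0 functional_add)

lemma functional_of_nat: "linear_functional l \<Longrightarrow> l (of_nat k * a) = of_nat k * l a"
  using functional_scale[of l "of_nat k" a] by (simp add: phi_of_nat)

lemma pairing_add:
  assumes "linear_functional l"
  shows "pairing l (p + q) \<gamma> = pairing l p \<gamma> + pairing l q \<gamma>"
  unfolding pairing_def using assms
  by (intro extend_linear_add) (auto simp: functional_0 functional_add distrib_right add_divide_distrib)

lemma pairing_single:
  assumes "linear_functional l"
  shows "pairing l (single \<beta> a) \<gamma>
    = (if mon_dvd \<beta> \<gamma> then l (a * mon_eval x (\<gamma> - \<beta>)) / mon_fact (\<gamma> - \<beta>) else 0)"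
  unfolding pairing_def using assms
  by (intro extend_linear_single) (auto simp: functional_0)

lemma pairing_0 [simp]: "pairing l 0 \<gamma> = 0"
  by (simp add: pairing_def)

lemma pairing_sum:
  "linear_functional l \<Longrightarrow> pairing l (\<Sum>i\<in>I. g i) \<gamma> = (\<Sum>i\<in>I. pairing l (g i) \<gamma>)"
  by (induction I rule: infinite_finite_induct) (auto simp: pairing_add)

lemma pairing_scale:
  assumes "linear_functional l"
  shows "pairing l (single 0 (\<phi> c) * q) \<gamma> = c * pairing l q \<gamma>"
proof (induction q rule: mp_induct)
  case (single m a)
  then show ?case
    using assms by (simp add: mult_single pairing_single functional_scale mult.assoc)
next
  case (add p q)
  then show ?case
    using assms by (simp add: distrib_left pairing_add)
qed simp

definition invariant_functional :: "('a \<Rightarrow> 'k) \<Rightarrow> bool" where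
  "invariant_functional l \<longleftrightarrow> linear_functional l \<and> (\<forall>D\<in>V. \<forall>a. l (D a) = 0)"

text \<open>This is \<open>l (D (a x\<^sup>\<delta>)) = 0\<close>, where \<open>\<gamma> = \<beta> + \<delta>\<close>, expanded by the Leibniz rule.\<close>

lemma pairing_symbol:
  assumes inv: "invariant_functional l" and D: "D \<in> V" and \<gamma>: "keys \<gamma> \<subseteq> {..<n}"
  shows "pairing l (single \<beta> a * symbol D + single \<beta> (D a)) \<gamma> = 0"
proof -
  have lin: "linear_functional l"
    using inv by (simp add: invariant_functional_def)
  have eq: "single \<beta> a * symbol D = (\<Sum>i<n. single (\<beta> + var_mon i) (a * D (x i)))"
    by (simp add: symbol_def sum_distrib_left mult_single)
  show ?thesis
  proof (cases "mon_dvd \<beta> \<gamma>")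
    case False
    then have "\<not> mon_dvd (\<beta> + var_mon i) \<gamma>" for i
      by (auto simp: mon_dvd_def lookup_add dest: spec intro: add_leD1)
    then show ?thesis
      using False by (simp add: eq pairing_add[OF lin] pairing_sum[OF lin] pairing_single[OF lin])
  next
    case True
    then obtain \<delta> where \<delta>: "\<gamma> = \<beta> + \<delta>"
      by (rule mon_dvdE)
    have k\<delta>: "keys \<delta> \<subseteq> {..<n}"
      using \<gamma> by (auto simp: \<delta> keys_add_mon)
    have term_eq: "pairing l (single (\<beta> + var_mon i) b) \<gamma>
        = l (of_nat (lookup \<delta> i) * (b * mon_eval x (\<delta> - var_mon i))) / mon_fact \<delta>" for i b
    proof (cases "lookup \<delta> i = 0")
      case True
      then have "\<not> mon_dvd (\<beta> + var_mon i) \<gamma>"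
        by (auto simp: \<delta> mon_dvd_def lookup_add intro!: exI[of _ i])
      then show ?thesis
        using True by (simp add: pairing_single[OF lin] functional_0[OF lin])
    next
      case False
      then have "i \<in> keys \<delta>"
        by (simp add: in_keys_iff)
      then obtain d where d: "\<delta> = d + var_mon i"
        by (rule mon_split_var)
      have 1: "\<gamma> = (\<beta> + var_mon i) + d"
        by (simp add: \<delta> d ac_simps)
      then have 2: "\<gamma> - (\<beta> + var_mon i) = d" "mon_dvd (\<beta> + var_mon i) \<gamma>"
        by (simp_all only: add_diff_cancel_left' mon_dvd_add)
      have 3: "\<delta> - var_mon i = d"
        by (simp add: d)
      have "pairing l (single (\<beta> + var_mon i) b) \<gamma> = l (b * mon_eval x d) / mon_fact d"
        by (simp only: pairing_single[OF lin] 2 if_True)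
      \<comment> \<open>As \<open>\<delta>\<close> is \<open>d\<close> times \<open>y_i\<close>,
        \<open>1 / d!\<close> equals \<open>\<delta>_i / \<delta>!\<close>: the factorials of the
        exponential series produce the factor of the Leibniz rule.\<close>
      also have "\<dots> = of_nat (lookup \<delta> i) * l (b * mon_eval x d) / mon_fact \<delta>"
        unfolding d mon_fact_var by (simp add: lookup_add del: of_nat_Suc)
      finally show ?thesis
        by (simp only: 3 functional_of_nat[OF lin])
    qed
    have "D (a * mon_eval x \<delta>) = (\<Sum>i<n. of_nat (lookup \<delta> i) * (a * D (x i) * mon_eval x (\<delta> - var_mon i)))
        + D a * mon_eval x \<delta>"
      unfolding V_deriv(3)[OF D] deriv_mon_eval[OF D k\<delta>] by (simp add: sum_distrib_left mult_ac)
    then have "l (D (a * mon_eval x \<delta>)) = (\<Sum>i<n. l (of_nat (lookup \<delta> i) * (a * D (x i) * mon_eval x (\<delta> - var_mon i))))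
        + l (D a * mon_eval x \<delta>)"
      by (simp only: functional_add[OF lin] functional_sum[OF lin])
    moreover have "l (D (a * mon_eval x \<delta>)) = 0"
      using inv D by (simp add: invariant_functional_def)
    moreover have "pairing l (single \<beta> (D a)) \<gamma> = l (D a * mon_eval x \<delta>) / mon_fact \<delta>"
      by (simp add: pairing_single[OF lin] \<delta>)
    ultimately show ?thesis
      unfolding eq pairing_add[OF lin] pairing_sum[OF lin] term_eq
      by (simp only: add_divide_distrib[symmetric] sum_divide_distrib[symmetric]) simp
  qed
qed

text \<open>What the growth estimate uses of the annihilator of invariant functionals:
  \<open>a \<xi>^\<beta>\<close> times a symbol equals \<open>- D a \<xi>^\<beta>\<close>, of lower
  order. The last clause discards the monomials involving cotangent variables beyond the first
  \<open>n\<close>, which the type admits.\<close>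

definition relations :: "'a mp set \<Rightarrow> bool" where
  "relations K \<longleftrightarrow> pol.vs.subspace K
     \<and> (\<forall>\<beta> a. \<forall>D\<in>V. single \<beta> a * symbol D + single \<beta> (D a) \<in> K)
     \<and> (\<forall>\<beta> a. \<not> keys \<beta> \<subseteq> {..<n} \<longrightarrow> single \<beta> a \<in> K)"

lemma relations_annihilator:
  assumes "\<And>l. l \<in> L \<Longrightarrow> invariant_functional l"
  shows "relations {q. \<forall>l\<in>L. \<forall>\<gamma>. keys \<gamma> \<subseteq> {..<n} \<longrightarrow> pairing l q \<gamma> = 0}"
proof -
  have lin: "linear_functional l" if "l \<in> L" for l
    using assms[OF that] by (simp add: invariant_functional_def)
  have "\<not> mon_dvd \<beta> \<gamma>" if "\<not> keys \<beta> \<subseteq> {..<n}" "keys \<gamma> \<subseteq> {..<n}" for \<beta> \<gamma>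
  proof
    assume "mon_dvd \<beta> \<gamma>"
    then obtain d where "\<gamma> = \<beta> + d"
      by (rule mon_dvdE)
    with that show False
      by (simp add: keys_add_mon)
  qed
  then show ?thesis
    unfolding relations_def pol.vs.subspace_def mem_Collect_eq
    using pairing_symbol[OF assms] by (intro conjI allI ballI impI)
      (simp_all add: pairing_add[OF lin] pairing_scale[OF lin] pairing_single[OF lin])
qed

section \<open>Bidegree of monomials in the \<open>2 n\<close> coordinates\<close>

definition base_deg :: "mon \<Rightarrow> nat" where
  "base_deg = weight (\<lambda>i. if i < n then 1 else 0)"

definition fibre_deg :: "mon \<Rightarrow> nat" where
  "fibre_deg = weight (\<lambda>i. if i < n then 0 else 1)"

lemma coord_less: "i < n \<Longrightarrow> coord i = single 0 (x i)"
  and coord_ge: "\<not> i < n \<Longrightarrow> coord i = single (var_mon (i - n)) 1"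
  by (simp_all add: coord_def)

lemma coord_mon:
  assumes "keys \<tau> \<subseteq> {..<2 * n}"
  shows "\<exists>\<alpha> \<beta>. keys \<alpha> \<subseteq> {..<n} \<and> keys \<beta> \<subseteq> {..<n} \<and> deg \<alpha> = base_deg \<tau> \<and> deg \<beta> = fibre_deg \<tau>
    \<and> mon_eval coord \<tau> = single \<beta> (mon_eval x \<alpha>)"
  using assms
proof (induction \<tau> rule: mon_induct)
  case zero
  show ?case
    by (intro exI[of _ 0]) (simp add: base_deg_def fibre_deg_def)
next
  case (var \<tau> i)
  then obtain \<alpha> \<beta> where *: "keys \<alpha> \<subseteq> {..<n}" "keys \<beta> \<subseteq> {..<n}" "deg \<alpha> = base_deg \<tau>" "deg \<beta> = fibre_deg \<tau>"
    "mon_eval coord \<tau> = single \<beta> (mon_eval x \<alpha>)" and i: "i < 2 * n"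
    by (auto simp: keys_add_mon)
  show ?case
  proof (cases "i < n")
    case True
    then show ?thesis
      using * by (rule_tac exI[of _ "\<alpha> + var_mon i"], rule_tac exI[of _ \<beta>])
        (auto simp: keys_add_mon base_deg_def fibre_deg_def weight_add mon_eval_add coord_less coord_ge mult_single)
  next
    case False
    then show ?thesis
      using * i by (rule_tac exI[of _ \<alpha>], rule_tac exI[of _ "\<beta> + var_mon (i - n)"])
        (auto simp: keys_add_mon base_deg_def fibre_deg_def weight_add mon_eval_add coord_less coord_ge mult_single)
  qed
qed

lemma ex_base_mon:
  assumes "keys \<alpha> \<subseteq> {..<n}"
  shows "\<exists>\<tau>. keys \<tau> \<subseteq> {..<2 * n} \<and> base_deg \<tau> = deg \<alpha> \<and> fibre_deg \<tau> = 0
    \<and> mon_eval coord \<tau> = single 0 (mon_eval x \<alpha>)"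
  using assms
proof (induction \<alpha> rule: mon_induct)
  case zero
  show ?case
    by (intro exI[of _ 0]) (simp add: base_deg_def fibre_deg_def)
next
  case (var \<alpha> i)
  then obtain \<tau> where \<tau>: "keys \<tau> \<subseteq> {..<2 * n}" "base_deg \<tau> = deg \<alpha>" "fibre_deg \<tau> = 0"
    "mon_eval coord \<tau> = single 0 (mon_eval x \<alpha>)" and i: "i < n"
    by (auto simp: keys_add_mon)
  then show ?case
    by (intro exI[of _ "\<tau> + var_mon i"])
      (auto simp: keys_add_mon base_deg_def fibre_deg_def weight_add mon_eval_add coord_less coord_ge mult_single)
qed

lemma ex_coord_mon:
  assumes \<alpha>: "keys \<alpha> \<subseteq> {..<n}" and "keys \<beta> \<subseteq> {..<n}"
  shows "\<exists>\<tau>. keys \<tau> \<subseteq> {..<2 * n} \<and> base_deg \<tau> = deg \<alpha> \<and> fibre_deg \<tau> = deg \<beta>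
    \<and> mon_eval coord \<tau> = single \<beta> (mon_eval x \<alpha>)"
  using assms(2)
proof (induction \<beta> rule: mon_induct)
  case zero
  then show ?case
    using ex_base_mon[OF \<alpha>] by simp
next
  case (var \<beta> i)
  then obtain \<tau> where \<tau>: "keys \<tau> \<subseteq> {..<2 * n}" "base_deg \<tau> = deg \<alpha>" "fibre_deg \<tau> = deg \<beta>"
    "mon_eval coord \<tau> = single \<beta> (mon_eval x \<alpha>)" and i: "i < n"
    by (auto simp: keys_add_mon)
  then show ?case
    by (intro exI[of _ "\<tau> + var_mon (n + i)"])
      (auto simp: keys_add_mon base_deg_def fibre_deg_def weight_add mon_eval_add coord_less coord_ge mult_single)
qed

lemma single_in_span_coord:
  assumes \<beta>: "keys \<beta> \<subseteq> {..<n}" and a: "a \<in> deg_le E"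
  shows "single \<beta> a \<in> pol.vs.span (mon_eval coord `
    {\<sigma>. keys \<sigma> \<subseteq> {..<2 * n} \<and> fibre_deg \<sigma> = deg \<beta> \<and> base_deg \<sigma> \<le> E})"
    (is "_ \<in> pol.vs.span ?B")
  using a unfolding deg_le_def
proof (induction a rule: vs.span_induct_alt)
  case base
  then show ?case by (simp add: pol.vs.span_zero)
next
  case (step c a b)
  then obtain \<alpha> where \<alpha>: "keys \<alpha> \<subseteq> {..<n}" "deg \<alpha> \<le> E" "a = mon_eval x \<alpha>" by auto
  obtain \<tau> where "keys \<tau> \<subseteq> {..<2 * n}" "base_deg \<tau> = deg \<alpha>" "fibre_deg \<tau> = deg \<beta>"
    "mon_eval coord \<tau> = single \<beta> (mon_eval x \<alpha>)"
    using ex_coord_mon[OF \<alpha>(1) \<beta>] by blast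
  then have "single \<beta> a \<in> ?B"
    using \<alpha> by (intro image_eqI[of _ _ \<tau>]) auto
  then have "single 0 (\<phi> c) * single \<beta> a + single \<beta> b \<in> pol.vs.span ?B"
    using step by (intro pol.vs.span_add pol.vs.span_scale) (auto intro: pol.vs.span_base)
  then show ?case
    by (simp add: mult_single single_add)
qed

lemma deriv_deg_le:
  assumes D: "D \<in> V" and "\<And>i. i < n \<Longrightarrow> D (x i) \<in> deg_le E" and "keys m \<subseteq> {..<n}"
  shows "D (mon_eval x m) \<in> deg_le (deg m + E)"
  using assms(3)
proof (induction m rule: mon_induct)
  case zero
  then show ?case
    using V_phi[OF D, of 1] by (simp add: deg_le_def vs.span_zero)
next
  case (var m i)
  then have m: "keys m \<subseteq> {..<n}" and i: "i < n"
    by (auto simp: keys_add_mon)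
  have "x i \<in> deg_le 1"
    using mon_eval_deg_le[of "var_mon i" 1] i by simp
  then have "x i * D (mon_eval x m) \<in> deg_le (1 + (deg m + E))"
    using var.IH[OF m] by (rule deg_le_mult)
  moreover have "mon_eval x m * D (x i) \<in> deg_le (1 + (deg m + E))"
    using deg_le_mult[OF mon_eval_deg_le[OF m order_refl] assms(2)[OF i]] deg_le_mono[of "deg m + E" "1 + (deg m + E)"]
    by auto
  ultimately have "mon_eval x m * D (x i) + x i * D (mon_eval x m) \<in> deg_le (1 + (deg m + E))"
    by (intro deg_le_add)
  then show ?case
    by (simp add: mon_eval_add V_deriv(3)[OF D] weight_add)
qed

text \<open>Modulo \<open>K\<close>, multiplying a generator by
  \<open>x^\<alpha> \<xi>^\<beta>\<close> gives
  \<open>- D (a x^\<alpha>) \<xi>^(m + \<beta>)\<close>: the order in \<open>\<xi>\<close> drops by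
  one, and the degree in \<open>x\<close> grows by an amount independent of \<open>K\<close> and
  \<open>\<tau>\<close>.\<close>

lemma symbol_part_reduction:
  assumes "p \<in> symbol_part b"
  shows "\<exists>c. \<forall>K \<tau>. relations K \<longrightarrow> keys \<tau> \<subseteq> {..<2 * n} \<longrightarrow>
    p * mon_eval coord \<tau> \<in> pol.vs.span (mon_eval coord `
      {\<sigma>. keys \<sigma> \<subseteq> {..<2 * n} \<and> fibre_deg \<sigma> < b + fibre_deg \<tau> \<and> base_deg \<sigma> \<le> base_deg \<tau> + c} \<union> K)"
    (is "\<exists>c. \<forall>K \<tau>. _ \<longrightarrow> _ \<longrightarrow> _ \<in> pol.vs.span (?B c \<tau> \<union> K)")
  using assms
proof induction
  case zero
  then show ?case by (simp add: pol.vs.span_zero)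
next
  case (add p q)
  then obtain c d where c: "\<And>K (\<tau>::mon). relations K \<Longrightarrow> keys \<tau> \<subseteq> {..<2 * n} \<Longrightarrow> p * mon_eval coord \<tau> \<in> pol.vs.span (?B c \<tau> \<union> K)"
    and d: "\<And>K (\<tau>::mon). relations K \<Longrightarrow> keys \<tau> \<subseteq> {..<2 * n} \<Longrightarrow> q * mon_eval coord \<tau> \<in> pol.vs.span (?B d \<tau> \<union> K)"
    by blast
  show ?case
  proof (intro exI[of _ "max c d"] allI impI)
    fix K and \<tau> :: mon assume K: "relations K" and \<tau>: "keys \<tau> \<subseteq> {..<2 * n}"
    have "pol.vs.span (?B c \<tau> \<union> K) \<subseteq> pol.vs.span (?B (max c d) \<tau> \<union> K)"
      "pol.vs.span (?B d \<tau> \<union> K) \<subseteq> pol.vs.span (?B (max c d) \<tau> \<union> K)"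
      by (rule pol.vs.span_mono, fastforce)+
    then show "(p + q) * mon_eval coord \<tau> \<in> pol.vs.span (?B (max c d) \<tau> \<union> K)"
      unfolding distrib_right using c[OF K \<tau>] d[OF K \<tau>] by (intro pol.vs.span_add) blast+
  qed
next
  case (base D m a)
  have "finite ({a, D a} \<union> (\<lambda>i. D (x i)) ` {..<n})"
    by simp
  from ex_deg_le_finite[OF this] obtain E where E: "{a, D a} \<union> (\<lambda>i. D (x i)) ` {..<n} \<subseteq> deg_le E"
    by (rule exE)
  show ?case
  \<comment> \<open>One \<open>E\<close> pays for the factor \<open>a\<close>, the other for the
    degree that \<open>D\<close> adds to a monomial.\<close>
  proof (intro exI[of _ "E + E"] allI impI)
    fix K and \<tau> :: mon assume K: "relations K" and "keys \<tau> \<subseteq> {..<2 * n}"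
    then obtain \<alpha> \<beta> where \<alpha>: "keys \<alpha> \<subseteq> {..<n}" "keys \<beta> \<subseteq> {..<n}" "deg \<alpha> = base_deg \<tau>" "deg \<beta> = fibre_deg \<tau>"
      "mon_eval coord \<tau> = single \<beta> (mon_eval x \<alpha>)"
      using coord_mon by blast
    let ?a = "a * mon_eval x \<alpha>"
    have eq: "single m a * symbol D * mon_eval coord \<tau> = single (m + \<beta>) ?a * symbol D"
      unfolding \<alpha>(5) mult_single[symmetric] by (simp only: ac_simps)
    have mem: "single (m + \<beta>) ?a * symbol D + single (m + \<beta>) (D ?a) \<in> K"
      using K base.hyps by (auto simp: relations_def)
    have "single (m + \<beta>) (D ?a) \<in> pol.vs.span (?B (E + E) \<tau> \<union> K)"
    proof (cases "keys (m + \<beta>) \<subseteq> {..<n}")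
      case True
      have x\<alpha>: "mon_eval x \<alpha> \<in> deg_le (base_deg \<tau>)"
        using \<alpha> by (intro mon_eval_deg_le) auto
      have "a * D (mon_eval x \<alpha>) \<in> deg_le (E + (base_deg \<tau> + E))"
        using E deriv_deg_le[of D E \<alpha>] \<alpha> base.hyps by (intro deg_le_mult) auto
      moreover have "mon_eval x \<alpha> * D a \<in> deg_le (base_deg \<tau> + E)"
        using E x\<alpha> by (intro deg_le_mult) auto
      then have "mon_eval x \<alpha> * D a \<in> deg_le (E + (base_deg \<tau> + E))"
        using deg_le_mono[of "base_deg \<tau> + E" "E + (base_deg \<tau> + E)"] by auto
      ultimately have "D ?a \<in> deg_le (E + (base_deg \<tau> + E))"
        unfolding V_deriv(3)[OF base.hyps(1)] by (rule deg_le_add)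
      from single_in_span_coord[OF True this] show ?thesis
        by (rule subsetD[OF pol.vs.span_mono, rotated])
          (use base.hyps(2) in \<open>auto simp: weight_add \<alpha>(4)[symmetric] intro!: imageI\<close>)
    next
      case False
      then show ?thesis
        using K by (intro pol.vs.span_base) (auto simp: relations_def)
    qed
    from pol.vs.span_diff[OF pol.vs.span_base[OF UnI2[OF mem]] this]
    show "single m a * symbol D * mon_eval coord \<tau> \<in> pol.vs.span (?B (E + E) \<tau> \<union> K)"
      unfolding eq by simp
  qed
qed

end

section \<open>Finiteness of the coinvariants\<close>

context holonomic_vf
begin

lemma coord_weight:
  "weight (\<lambda>i. if i < n then 1 else k) \<tau> = base_deg \<tau> + k * fibre_deg \<tau>"
proof (induction \<tau> rule: mon_induct)
  case (var \<tau> i)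
  then show ?case
    by (simp add: weight_add base_deg_def fibre_deg_def)
qed (simp add: base_deg_def fibre_deg_def)

lemma hom_part_ev_single:
  assumes "keys m \<subseteq> {..<2 * n}"
  shows "hom_part b (single 0 (\<phi> c) * mon_eval coord m)
    = (if fibre_deg m = b then single 0 (\<phi> c) * mon_eval coord m else 0)"
proof -
  obtain \<alpha> \<beta> where "deg \<beta> = fibre_deg m" "mon_eval coord m = single \<beta> (mon_eval x \<alpha>)"
    using coord_mon[OF assms] by blast
  then show ?thesis
    by (simp add: mult_single hom_part_single)
qed

text \<open>Evaluation at \<open>coord\<close> respects the degree in \<open>\<xi>\<close> and the
  symbol ideal is graded, so one part of a relation is again a relation. \<open>b\<close> is read
  off from a monomial that occurs, which keeps the part nonzero as a polynomial.\<close>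

lemma ex_homogeneous_relation:
  assumes S: "S \<subseteq> {..<2 * n}" "card S = Suc n"
  shows "\<exists>h b. supp_in S h \<and> h \<noteq> 0 \<and> (\<forall>m\<in>keys h. fibre_deg m = b)
    \<and> poly_eval (\<lambda>c. single 0 (\<phi> c)) coord h \<in> symbol_part b"
proof -
  let ?ev = "poly_eval (\<lambda>c. single 0 (\<phi> c)) coord"
  obtain h where h: "supp_in S h" "h \<noteq> 0" "?ev h \<in> symbol_ideal"
    by (rule ex_relation_in_symbol_ideal[OF S]) (rule that)
  obtain m0 where m0: "m0 \<in> keys h"
    using h(2) by (metis all_not_in_conv keys_eq_empty)
  define b where "b = fibre_deg m0"
  define hb where "hb = (\<Sum>m\<in>{m \<in> keys h. fibre_deg m = b}. single m (lookup h m))"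
  have lookup_hb: "lookup hb m = (if m \<in> keys h \<and> fibre_deg m = b then lookup h m else 0)" for m
    by (auto simp: hb_def lookup_sum lookup_single when_def)
  have "?ev hb = (\<Sum>m\<in>{m \<in> keys h. fibre_deg m = b}. single 0 (\<phi> (lookup h m)) * mon_eval coord m)"
    by (simp only: hb_def pol.poly_eval_sum pol.poly_eval_single)
  also have "\<dots> = (\<Sum>m\<in>keys h. if fibre_deg m = b then single 0 (\<phi> (lookup h m)) * mon_eval coord m else 0)"
    by (rule sum.inter_filter) simp
  also have "\<dots> = (\<Sum>m\<in>keys h. hom_part b (single 0 (\<phi> (lookup h m)) * mon_eval coord m))"
  proof (rule sum.cong[OF refl])
    fix m assume "m \<in> keys h"
    then have "keys m \<subseteq> {..<2 * n}"
      using h(1) S(1) by (auto simp: supp_in_def)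
    from hom_part_ev_single[OF this]
    show "(if fibre_deg m = b then single 0 (\<phi> (lookup h m)) * mon_eval coord m else 0)
        = hom_part b (single 0 (\<phi> (lookup h m)) * mon_eval coord m)" ..
  qed
  also have "\<dots> = hom_part b (?ev h)"
    by (simp only: hom_part_sum poly_eval_def extend_linear_def)
  finally have "?ev hb \<in> symbol_part b"
    using h(3) by (simp add: symbol_ideal_def)
  moreover have "supp_in S hb"
    using h(1) by (auto simp: supp_in_def in_keys_iff lookup_hb split: if_splits)
  moreover have "lookup hb m0 \<noteq> 0"
    using m0 by (simp add: lookup_hb b_def in_keys_iff)
  then have "hb \<noteq> 0"
    by auto
  moreover have "\<forall>m\<in>keys hb. fibre_deg m = b"
    by (auto simp: in_keys_iff lookup_hb split: if_splits)
  ultimately show ?thesis by blast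
qed

text \<open>Giving the cotangent variables a large weight makes the lower order terms of
  all relations harmless, so that modulo the annihilator of invariant functionals the growth
  is that of a ring of dimension \<open>n\<close>, uniformly in the functionals.\<close>

lemma uniform_growth:
  "\<exists>C k. \<forall>K W. relations K \<longrightarrow> (\<exists>X. finite X \<and> card X \<le> C * (W + 1) ^ n \<and>
    (\<forall>\<tau>. keys \<tau> \<subseteq> {..<2 * n} \<longrightarrow> base_deg \<tau> + k * fibre_deg \<tau> \<le> W \<longrightarrow> mon_eval coord \<tau> \<in> pol.vs.span (X \<union> K)))"
proof -
  let ?ev = "poly_eval (\<lambda>c. single 0 (\<phi> c)) coord"
  let ?good = "\<lambda>S. S \<subseteq> {..<2 * n} \<and> card S = Suc n"
  let ?red = "\<lambda>h b c. \<forall>K \<tau>. relations K \<longrightarrow> keys \<tau> \<subseteq> {..<2 * n} \<longrightarrow>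
    ?ev h * mon_eval coord \<tau> \<in> pol.vs.span (mon_eval coord `
      {\<sigma>. keys \<sigma> \<subseteq> {..<2 * n} \<and> fibre_deg \<sigma> < b + fibre_deg \<tau> \<and> base_deg \<sigma> \<le> base_deg \<tau> + c} \<union> K)"
  \<comment> \<open>The triple holds the relation, its degree in the cotangent variables and the
    growth in base degree caused by reducing it; packing them allows a single choice.\<close>
  have "\<exists>t. ?good S \<longrightarrow> supp_in S (fst t) \<and> fst t \<noteq> 0 \<and> (\<forall>m\<in>keys (fst t). fibre_deg m = fst (snd t))
      \<and> ?red (fst t) (fst (snd t)) (snd (snd t))" for S
  proof (cases "?good S")
    case True
    then obtain h b where h: "supp_in S h" "h \<noteq> 0" "\<forall>m\<in>keys h. fibre_deg m = b" "?ev h \<in> symbol_part b"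
      using ex_homogeneous_relation by blast
    obtain c where "?red h b c"
      using symbol_part_reduction[OF h(4)] by (rule exE)
    with h show ?thesis
      by (intro exI[of _ "(h, b, c)"]) simp
  qed blast
  then have "\<exists>f. \<forall>S. ?good S \<longrightarrow> supp_in S (fst (f S)) \<and> fst (f S) \<noteq> 0
      \<and> (\<forall>m\<in>keys (fst (f S)). fibre_deg m = fst (snd (f S)))
      \<and> ?red (fst (f S)) (fst (snd (f S))) (snd (snd (f S)))"
    by (intro choice allI)
  then obtain f where f: "\<And>S. ?good S \<Longrightarrow> supp_in S (fst (f S)) \<and> fst (f S) \<noteq> 0
      \<and> (\<forall>m\<in>keys (fst (f S)). fibre_deg m = fst (snd (f S)))
      \<and> ?red (fst (f S)) (fst (snd (f S))) (snd (snd (f S)))"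
    by blast
  define h where "h S = fst (f S)" for S
  define b where "b S = fst (snd (f S))" for S
  define c where "c S = snd (snd (f S))" for S
  have h: "supp_in S (h S)" "h S \<noteq> 0" "\<And>m. m \<in> keys (h S) \<Longrightarrow> fibre_deg m = b S" "?red (h S) (b S) (c S)"
    if "?good S" for S
    using f[OF that] by (simp_all add: h_def b_def c_def)
  \<comment> \<open>Larger than every growth constant \<open>c S\<close>, with \<open>S\<close>
    ranging over the finitely many sets of coordinates.\<close>
  define k where "k = Suc (\<Sum>S\<in>Pow {..<2 * n}. c S)"
  have k: "c S < k" if "?good S" for S
  proof -
    have "c S \<le> (\<Sum>S\<in>Pow {..<2 * n}. c S)"
      using that by (intro member_le_sum) auto
    then show ?thesis by (simp add: k_def)
  qed
  let ?\<omega> = "\<lambda>i. if i < n then 1 else k"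
  obtain C where C: "\<And>K W. pol.vs.subspace K \<Longrightarrow>
    (\<And>S \<tau>. S \<subseteq> {..<2 * n} \<Longrightarrow> card S = Suc n \<Longrightarrow> keys \<tau> \<subseteq> {..<2 * n} \<Longrightarrow>
      ?ev (h S) * mon_eval coord \<tau> \<in> pol.vs.span (mon_eval coord `
        {\<sigma>. keys \<sigma> \<subseteq> {..<2 * n} \<and> weight ?\<omega> \<sigma> < wdeg ?\<omega> (h S) + weight ?\<omega> \<tau>} \<union> K)) \<Longrightarrow>
    \<exists>X. finite X \<and> card X \<le> C * (W + 1) ^ n \<and>
      (\<forall>\<tau>. keys \<tau> \<subseteq> {..<2 * n} \<longrightarrow> weight ?\<omega> \<tau> \<le> W \<longrightarrow> mon_eval coord \<tau> \<in> pol.vs.span (X \<union> K))"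
    by (rule pol.monomial_growth[of "2 * n" ?\<omega> n h coord]) (use h in \<open>auto simp: k_def\<close>)
  show ?thesis
  proof (rule exI[of _ C], rule exI[of _ k], intro allI impI)
    fix K W assume K: "relations K"
    show "\<exists>X. finite X \<and> card X \<le> C * (W + 1) ^ n \<and>
      (\<forall>\<tau>. keys \<tau> \<subseteq> {..<2 * n} \<longrightarrow> base_deg \<tau> + k * fibre_deg \<tau> \<le> W \<longrightarrow> mon_eval coord \<tau> \<in> pol.vs.span (X \<union> K))"
      unfolding coord_weight[symmetric]
    proof (rule C)
      show "pol.vs.subspace K"
        using K by (simp add: relations_def)
      fix S and \<tau> :: mon assume S: "S \<subseteq> {..<2 * n}" "card S = Suc n" and \<tau>: "keys \<tau> \<subseteq> {..<2 * n}"
      then have good: "?good S" by simp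
      obtain m where m: "m \<in> keys (h S)"
        using h(2)[OF good] by (metis all_not_in_conv keys_eq_empty)
      have "k * b S \<le> weight ?\<omega> m"
        using h(3)[OF good m] by (simp add: coord_weight)
      also have "\<dots> \<le> wdeg ?\<omega> (h S)"
        unfolding wdeg_def using m by (intro Max_ge) auto
      finally have wd: "k * b S \<le> wdeg ?\<omega> (h S)" .
      have sub: "{\<sigma>. keys \<sigma> \<subseteq> {..<2 * n} \<and> fibre_deg \<sigma> < b S + fibre_deg \<tau> \<and> base_deg \<sigma> \<le> base_deg \<tau> + c S}
        \<subseteq> {\<sigma>. keys \<sigma> \<subseteq> {..<2 * n} \<and> weight ?\<omega> \<sigma> < wdeg ?\<omega> (h S) + weight ?\<omega> \<tau>}"
      proof safe
        fix \<sigma> assume \<sigma>: "fibre_deg \<sigma> < b S + fibre_deg \<tau>" "base_deg \<sigma> \<le> base_deg \<tau> + c S"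
        \<comment> \<open>Losing one cotangent degree saves \<open>k\<close>, more than the
          \<open>c S\<close> by which the base degree may rise; so the weight drops
          strictly.\<close>
        have "k * Suc (fibre_deg \<sigma>) \<le> k * (b S + fibre_deg \<tau>)"
          using \<sigma>(1) by (intro mult_left_mono) auto
        then show "weight ?\<omega> \<sigma> < wdeg ?\<omega> (h S) + weight ?\<omega> \<tau>"
          unfolding coord_weight using \<sigma>(2) k[OF good] wd by (simp add: distrib_left)
      qed
      have "?ev (h S) * mon_eval coord \<tau> \<in> pol.vs.span (mon_eval coord `
        {\<sigma>. keys \<sigma> \<subseteq> {..<2 * n} \<and> fibre_deg \<sigma> < b S + fibre_deg \<tau> \<and> base_deg \<sigma> \<le> base_deg \<tau> + c S} \<union> K)"
        using h(4)[OF good] K \<tau> by blast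
      then show "?ev (h S) * mon_eval coord \<tau> \<in> pol.vs.span (mon_eval coord `
        {\<sigma>. keys \<sigma> \<subseteq> {..<2 * n} \<and> weight ?\<omega> \<sigma> < wdeg ?\<omega> (h S) + weight ?\<omega> \<tau>} \<union> K)"
        by (rule subsetD[OF pol.vs.span_mono[OF Un_mono[OF image_mono[OF sub] order_refl]]])
    qed
  qed
qed

text \<open>The exponents of \<open>\<beta>\<close> run up to a number \<open>m\<close> that also
  bounds the degrees of the \<open>g j\<close>. The weight of \<open>g j \<xi>^\<beta>\<close> is
  then linear in \<open>m\<close>, both counts have order \<open>n\<close>, and the power of
  \<open>m + 1\<close> cancels.\<close>

lemma dual_family_bounded:
  "\<exists>R. \<forall>r g l. (\<forall>i<r. invariant_functional (l i)) \<longrightarrow>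
    (\<forall>i<r. \<forall>j<r. l i (g j) = (if i = j then 1 else 0)) \<longrightarrow> r \<le> (R::nat)"
proof -
  obtain C k where C: "\<And>K W. relations K \<Longrightarrow> \<exists>X. finite X \<and> card X \<le> C * (W + 1) ^ n \<and>
    (\<forall>\<tau>. keys \<tau> \<subseteq> {..<2 * n} \<longrightarrow> base_deg \<tau> + k * fibre_deg \<tau> \<le> W \<longrightarrow> mon_eval coord \<tau> \<in> pol.vs.span (X \<union> K))"
    using uniform_growth by blast
  show ?thesis
  \<comment> \<open>The range below is \<open>W = m + k * (n * m)\<close>, and
    \<open>W + 1 \<le> (k * n + 2) * (m + 1)\<close>.\<close>
  proof (intro exI[of _ "C * (k * n + 2) ^ n"] allI impI)
    fix r :: nat and g l
    assume "\<forall>i<r. invariant_functional (l i)" and "\<forall>i<r. \<forall>j<r. l i (g j) = (if i = j then 1 else 0)"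
    then have inv: "\<And>i. i < r \<Longrightarrow> invariant_functional (l i)"
      and dual: "\<And>i j. i < r \<Longrightarrow> j < r \<Longrightarrow> l i (g j) = (if i = j then 1 else 0)"
      by blast+
    define K where "K = {q. \<forall>l'\<in>l ` {..<r}. \<forall>\<gamma>. keys \<gamma> \<subseteq> {..<n} \<longrightarrow> pairing l' q \<gamma> = 0}"
    have K: "relations K"
      unfolding K_def by (rule relations_annihilator) (use inv in auto)
    have lin: "linear_functional (l i)" if "i < r" for i
      using inv[OF that] by (simp add: invariant_functional_def)
    have "finite (g ` {..<r})" by simp
    from ex_deg_le_finite[OF this] obtain m where m: "g ` {..<r} \<subseteq> deg_le m"
      by (rule exE)
    define W where "W = m + k * (n * m)"
    obtain X where X: "finite X" "card X \<le> C * (W + 1) ^ n"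
      "\<And>\<tau>. keys \<tau> \<subseteq> {..<2 * n} \<Longrightarrow> base_deg \<tau> + k * fibre_deg \<tau> \<le> W \<Longrightarrow> mon_eval coord \<tau> \<in> pol.vs.span (X \<union> K)"
      using C[OF K, of W] by blast
    define T where "T = {..<r} \<times> box_mons {..<n} m"
    have T: "finite T" "card T = r * (m + 1) ^ n"
      using card_box_mons[of "{..<n}" m] by (simp_all add: T_def card_cartesian_product)
    have "card T \<le> card X"
    proof (rule pol.vs.card_le_of_independent_mod[where K = K and f = "\<lambda>t. single (snd t) (g (fst t))"])
      show "pol.vs.subspace K"
        using K by (simp add: relations_def)
      fix t assume t: "t \<in> T"
      then have "snd t \<in> box_mons {..<n} m"
        by (auto simp: T_def)
      moreover from this have "deg (snd t) \<le> card {..<n} * (1 * m)"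
        by (intro weight_le_card) (auto simp: box_mons_def)
      ultimately have \<beta>: "keys (snd t) \<subseteq> {..<n}" "deg (snd t) \<le> card {..<n} * (1 * m)"
        by (auto simp: box_mons_def)
      have "g (fst t) \<in> deg_le m"
        using t m by (auto simp: T_def)
      from single_in_span_coord[OF \<beta>(1) this]
      show "single (snd t) (g (fst t)) \<in> pol.vs.span (X \<union> K)"
      proof (rule subsetD[OF pol.vs.span_minimal, rotated 2])
        show "mon_eval coord ` {\<sigma>. keys \<sigma> \<subseteq> {..<2 * n} \<and> fibre_deg \<sigma> = deg (snd t) \<and> base_deg \<sigma> \<le> m}
          \<subseteq> pol.vs.span (X \<union> K)"
        proof safe
          fix \<sigma> assume \<sigma>: "keys \<sigma> \<subseteq> {..<2 * n}" "fibre_deg \<sigma> = deg (snd t)" "base_deg \<sigma> \<le> m"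
          have le: "k * fibre_deg \<sigma> \<le> k * (n * m)"
            using \<beta>(2) \<sigma>(2) by (intro mult_left_mono) auto
          show "mon_eval coord \<sigma> \<in> pol.vs.span (X \<union> K)"
            by (rule X(3)[OF \<sigma>(1)]) (simp only: W_def add_mono[OF \<sigma>(3) le])
        qed
      qed simp
    next
      fix a assume a: "(\<Sum>t\<in>T. single 0 (\<phi> (a t)) * single (snd t) (g (fst t))) \<in> K"
      show "\<forall>t\<in>T. a t = 0"
      proof (rule ccontr)
        assume "\<not> (\<forall>t\<in>T. a t = 0)"
        then obtain t1 where t1: "t1 \<in> T \<and> a t1 \<noteq> 0" by auto
        \<comment> \<open>A term of lowest order. At \<open>y^\<beta>0\<close> no other exponent
          contributes, since a divisor of \<open>\<beta>0\<close> of no smaller degree is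
          \<open>\<beta>0\<close>; among the terms with \<open>\<beta>0\<close> the functional
          \<open>l i0\<close> selects \<open>g i0\<close>.\<close>
        define t0 where "t0 = arg_min (\<lambda>t. deg (snd t)) (\<lambda>t. t \<in> T \<and> a t \<noteq> 0)"
        have t0: "t0 \<in> T" "a t0 \<noteq> 0"
          using arg_min_natI[of "\<lambda>t. t \<in> T \<and> a t \<noteq> 0", OF t1] by (auto simp: t0_def)
        have min: "deg (snd t0) \<le> deg (snd t)" if "t \<in> T" "a t \<noteq> 0" for t
          unfolding t0_def using that by (intro arg_min_nat_le) auto
        obtain i0 \<beta>0 where t0_eq: "t0 = (i0, \<beta>0)" "i0 < r" "keys \<beta>0 \<subseteq> {..<n}"
          using t0(1) by (auto simp: T_def box_mons_def)
        have "a t * pairing (l i0) (single (snd t) (g (fst t))) \<beta>0 = (if t = t0 then a t0 else 0)"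
          if t: "t \<in> T" for t
        proof (cases "a t \<noteq> 0 \<and> mon_dvd (snd t) \<beta>0")
          case True
          then have "snd t = \<beta>0"
            using min[OF t] by (intro mon_dvd_deg_eq) (auto simp: t0_eq)
          moreover have "fst t < r"
            using t by (auto simp: T_def)
          ultimately show ?thesis
            using dual[OF t0_eq(2), of "fst t"] t0_eq(1)
            by (cases t) (auto simp: pairing_single[OF lin[OF t0_eq(2)]] mon_dvd_def)
        next
          case False
          then have "t \<noteq> t0"
            using t0 by (auto simp: t0_eq mon_dvd_def)
          with False show ?thesis
            by (auto simp: pairing_single[OF lin[OF t0_eq(2)]])
        qed
        then have "(\<Sum>t\<in>T. a t * pairing (l i0) (single (snd t) (g (fst t))) \<beta>0) = a t0"
          using T(1) t0(1) by (simp cong: sum.cong)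
        moreover have "pairing (l i0) (\<Sum>t\<in>T. single 0 (\<phi> (a t)) * single (snd t) (g (fst t))) \<beta>0 = 0"
          using a t0_eq by (auto simp: K_def)
        then have "(\<Sum>t\<in>T. a t * pairing (l i0) (single (snd t) (g (fst t))) \<beta>0) = 0"
          by (simp only: pairing_sum[OF lin[OF t0_eq(2)]] pairing_scale[OF lin[OF t0_eq(2)]])
        ultimately show False
          using t0(2) by simp
      qed
    qed (use X(1) T(1) in auto)
    also have "\<dots> \<le> C * (W + 1) ^ n"
      by (rule X(2))
    also have "\<dots> \<le> C * ((k * n + 2) * (m + 1)) ^ n"
      by (intro mult_left_mono power_mono) (auto simp: W_def algebra_simps)
    also have "\<dots> = C * (k * n + 2) ^ n * (m + 1) ^ n"
      by (simp only: power_mult_distrib mult.assoc)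
    finally have "r * (m + 1) ^ n \<le> C * (k * n + 2) ^ n * (m + 1) ^ n"
      by (simp only: T(2))
    then show "r \<le> C * (k * n + 2) ^ n"
      by (simp only: mult_le_cancel2) simp
  qed
qed

text \<open>An infinite-dimensional quotient would admit arbitrarily large dual families: basis
  vectors outside \<open>vO\<close> together with their coordinate functionals.\<close>

theorem coinvariants_finite_dim: "fin_dim_quotient \<phi> (vO \<phi> V)"
proof (rule ccontr)
  assume not_fin: "\<not> ?thesis"
  let ?A = "{D f | D f. D \<in> V}"
  have vO: "vO \<phi> V = vs.span ?A"
    by (simp add: vO_def)
  obtain B0 where B0: "B0 \<subseteq> vO \<phi> V" "vs.independent B0" "vO \<phi> V \<subseteq> vs.span B0"
    using vs.maximal_independent_subset[of "vO \<phi> V"] by blast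
  \<comment> \<open>Extending a basis of \<open>vO\<close> to one of \<open>A\<close> makes the
    coordinates along \<open>B - B0\<close> vanish on \<open>vO\<close>, that is, invariant.\<close>
  define B where "B = vs.extend_basis B0"
  have B: "B0 \<subseteq> B" "vs.independent B" "vs.span B = UNIV"
    using vs.extend_basis_superset[OF B0(2)] vs.independent_extend_basis[OF B0(2)]
      vs.span_extend_basis[OF B0(2)] by (auto simp: B_def)
  have "infinite (B - B0)"
  proof
    assume "finite (B - B0)"
    moreover have "vs.span B \<subseteq> vs.span ((B - B0) \<union> vO \<phi> V)"
      using B0(1) by (intro vs.span_mono) auto
    ultimately show False
      using not_fin B(3) by (auto simp: fin_dim_quotient_def)
  qed
  obtain R where R: "\<forall>r g l. (\<forall>i<r. invariant_functional (l i)) \<longrightarrow>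
    (\<forall>i<r. \<forall>j<r. l i (g j) = (if i = j then 1 else 0)) \<longrightarrow> r \<le> (R::nat)"
    using dual_family_bounded by (rule exE)
  obtain G where G: "G \<subseteq> B - B0" "finite G" "card G = Suc R"
    using infinite_arbitrarily_large[OF \<open>infinite (B - B0)\<close>] by blast
  obtain g where "bij_betw g {0..<card G} G"
    using ex_bij_betw_nat_finite[OF G(2)] by blast
  then have g_img: "inj_on g {..<Suc R}" "g ` {..<Suc R} = G"
    using G(3) by (simp_all add: bij_betw_def lessThan_atLeast0)
  then have g: "inj_on g {..<Suc R}" "\<And>i. i < Suc R \<Longrightarrow> g i \<in> B - B0"
    using G(1) by blast+
  have "Suc R \<le> R"
  proof (rule R[rule_format, of _ "\<lambda>i a. vs.representation B a (g i)" g])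
    fix i assume i: "i < Suc R"
    show "invariant_functional (\<lambda>a. vs.representation B a (g i))"
      unfolding invariant_functional_def linear_functional_def
    proof (intro conjI allI ballI)
      show "vs.representation B (a + b) (g i) = vs.representation B a (g i) + vs.representation B b (g i)" for a b
        using B by (simp add: vs.representation_add)
      show "vs.representation B (\<phi> c * a) (g i) = c * vs.representation B a (g i)" for c a
        using B by (simp add: vs.representation_scale)
      fix D a assume "D \<in> V"
      then have "D a \<in> vs.span ?A"
        by (intro vs.span_base) blast
      then have D: "D a \<in> vs.span B0"
        using B0(3) vO by blast
      have "vs.representation B (D a) = vs.representation B0 (D a)"
        by (rule vs.representation_extend[OF B(2) D B(1)])
      then show "vs.representation B (D a) (g i) = 0"
        using vs.representation_ne_zero[of B0 "D a" "g i"] g(2)[OF i] by auto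
    qed
    fix j assume j: "j < Suc R"
    have "vs.representation B (g j) = (\<lambda>v. if v = g j then 1 else 0)"
      using g(2)[OF j] by (intro vs.representation_basis[OF B(2)]) simp
    then show "vs.representation B (g j) (g i) = (if i = j then 1 else 0)"
      using g(1) i j by (auto simp: inj_on_def)
  qed
  then show False by simp
qed

end

theorem theorem1p1:
  fixes \<phi> :: "'k::{alg_closed_field, field_char_0} \<Rightarrow> 'a::comm_ring_1"
    and V :: "('a \<Rightarrow> 'a) set"
  assumes "fin_gen_kalg \<phi>"
    and "lie_subalgebra \<phi> V"
    and "\<forall>i::nat. zar_dim_le \<phi> {x \<in> points \<phi>. tvdim (eval_at V x) \<le> i} i"
  shows "fin_dim_quotient \<phi> (vO \<phi> V)"
proof -
  interpret kalgebra \<phi>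
    using assms(1) by unfold_locales (simp add: fin_gen_kalg_def)
  obtain G where G: "finite G" "gen_alg \<phi> G = UNIV"
    using assms(1) by (auto simp: fin_gen_kalg_def)
  obtain x where "bij_betw x {0..<card G} G"
    using ex_bij_betw_nat_finite[OF G(1)] by blast
  then have x: "x ` {..<card G} = G"
    by (simp add: bij_betw_def lessThan_atLeast0)
  have gen: "\<exists>p. supp_in {..<card G} p \<and> a = poly_eval \<phi> x p" if "a \<in> gen_alg \<phi> G" for a
    using that
  proof induction
    case (gen g)
    then obtain i where "i < card G" "g = x i"
      using x by auto
    then show ?case
      by (intro exI[of _ "single (var_mon i) 1"]) auto
  next
    case (scal c)
    then show ?case
      by (intro exI[of _ "single 0 c"]) auto
  next
    case (add a b)
    then show ?case
      by (metis poly_eval_add supp_in_add)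
  next
    case (mult a b)
    then show ?case
      by (metis poly_eval_mult supp_in_mult)
  qed
  interpret holonomic_vf \<phi> x "card G" V
  proof unfold_locales
    show "\<exists>p. supp_in {..<card G} p \<and> a = poly_eval \<phi> x p" for a
      using gen[of a] G(2) by simp
  qed (use assms in auto)
  show ?thesis
    by (rule coinvariants_finite_dim)
qed

end
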